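(* Let $\mathbb{F}_r$ be a non-abelian free group of rank $r$, where $2\le r\le \aleph_0$. Then $\mathbb{F}_r$ has $2^{\aleph_0}$ many continuous $\mathrm{Inn}(\mathbb{F}_r)$-weakly mixing characteristic random subgroups.
   Context: For a countable discrete group $G$, $\mathrm{Sub}(G)$ is the compact metrizable space of subgroups of $G$ (with the topology induced from the product topology on $\{0,1\}^G$). The automorphism group $\mathrm{Aut}(G)$ and its subgroup $\mathrm{Inn}(G)$ of inner automorphisms act on $\mathrm{Sub}(G)$ by $(\phi,H)\mapsto \phi(H)$. A characteristic random subgroup (CRS) of $G$ is an $\mathrm{Aut}(G)$-invariant Borel probability measure on $\mathrm{Sub}(G)$. It is continuous if it has no atoms. A CRS $\mu$ is $\mathrm{Inn}(G)$-weakly mixing if the action of $\mathrm{Inn}(G)$ on $(\mathrm{Sub}(G),\mu)$ is weakly mixing, where a probability-measure-preserving action of a group $\Gamma$ on $(X,\mu)$ is weakly mixing if the only finite-dimensional $\Gamma$-invariant subspaces of $L^2(X,\mu)$ (under $(g\phi)(x)=\phi(g^{-1}x)$) are the zero subspace and the subspace of constant functions. *)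

theory Defs
  imports "HOL-Probability.Probability" "HOL-Algebra.Bij" "HOL-Library.Equipollence"
begin

section \<open>Free groups\<close>

text \<open>
  The free group on a set \<open>S\<close> is realised by reduced words.  A letter \<open>(a, True)\<close> stands for the
  generator \<open>a\<close>, and \<open>(a, False)\<close> for its inverse.
\<close>

type_synonym 'a letter = "'a \<times> bool"

definition inv_letter :: "'a letter \<Rightarrow> 'a letter" where
  "inv_letter x = (fst x, \<not> snd x)"

definition reduced :: "'a letter list \<Rightarrow> bool" where
  "reduced w \<longleftrightarrow> successively (\<lambda>x y. y \<noteq> inv_letter x) w"

fun red_cons :: "'a letter \<Rightarrow> 'a letter list \<Rightarrow> 'a letter list" where
  "red_cons x [] = [x]"
| "red_cons x (y # w) = (if y = inv_letter x then w else x # y # w)"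

text \<open>For reduced \<open>u\<close> and \<open>v\<close>, \<open>foldr red_cons u v\<close> is the reduced form of \<open>u @ v\<close>.\<close>

definition free_group :: "'a set \<Rightarrow> 'a letter list monoid" where
  "free_group S =
     \<lparr>carrier = {w. reduced w \<and> set w \<subseteq> S \<times> UNIV},
      mult = \<lambda>u v. foldr red_cons u v,
      one = []\<rparr>"

lemma inv_letter_inv_letter [simp]: "inv_letter (inv_letter x) = x"
  by (simp add: inv_letter_def)

lemma inv_letter_neq [simp]: "inv_letter x \<noteq> x" "x \<noteq> inv_letter x"
  by (metis inv_letter_def snd_conv)+

lemma reduced_simps [simp]:
  "reduced []" "reduced [x]"
  "reduced (x # y # w) \<longleftrightarrow> y \<noteq> inv_letter x \<and> reduced (y # w)"
  by (simp_all add: reduced_def)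

lemma reduced_ConsD: "reduced (x # w) \<Longrightarrow> reduced w"
  by (cases w) auto

lemma reduced_red_cons: "reduced w \<Longrightarrow> reduced (red_cons x w)"
  by (cases w) (auto dest: reduced_ConsD)

lemma set_red_cons: "set (red_cons x w) \<subseteq> insert x (set w)"
  by (cases w) auto

lemma red_cons_reduced: "reduced (x # w) \<Longrightarrow> red_cons x w = x # w"
  by (cases w) auto

lemma red_cons_cancel: "reduced w \<Longrightarrow> red_cons x (red_cons (inv_letter x) w) = w"
proof (cases w)
  case (Cons y v)
  assume "reduced w"
  then show ?thesis using Cons by (cases v) auto
qed simp

lemma reduced_foldr: "reduced v \<Longrightarrow> reduced (foldr red_cons u v)"
  by (induction u) (auto intro: reduced_red_cons)

lemma set_foldr: "set (foldr red_cons u v) \<subseteq> set u \<union> set v"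
proof (induction u)
  case (Cons x u)
  then show ?case using set_red_cons[of x "foldr red_cons u v"] by auto
qed simp

lemma foldr_red_cons_red_cons:
  assumes "reduced w"
  shows "foldr red_cons (red_cons x u) w = red_cons x (foldr red_cons u w)"
proof (cases u)
  case (Cons y v)
  then show ?thesis
    using red_cons_cancel[OF reduced_foldr[OF assms], of x v] by auto
qed simp

lemma foldr_red_cons_assoc:
  assumes "reduced w"
  shows "foldr red_cons (foldr red_cons u v) w = foldr red_cons u (foldr red_cons v w)"
  by (induction u) (auto simp: foldr_red_cons_red_cons[OF assms])

lemma foldr_red_cons_Nil: "reduced w \<Longrightarrow> foldr red_cons w [] = w"
proof (induction w)
  case (Cons x w)
  then show ?case using red_cons_reduced[of x w] reduced_ConsD[of x w] by auto
qed simp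

lemma foldr_red_cons_inverse: "foldr red_cons (rev (map inv_letter w)) w = []"
  by (induction w) auto

lemma reduced_inverse: "reduced w \<Longrightarrow> reduced (rev (map inv_letter w))"
proof -
  assume "reduced w"
  then have "successively (\<lambda>x y. x \<noteq> inv_letter y) w"
    unfolding reduced_def by (rule successively_mono) auto
  then show ?thesis
    unfolding reduced_def successively_rev successively_map
    by (rule successively_mono) (metis inv_letter_inv_letter)
qed

lemma group_free_group: "group (free_group S)"
proof (rule groupI)
  fix x assume "x \<in> carrier (free_group S)"
  then show "\<exists>y\<in>carrier (free_group S). y \<otimes>\<^bsub>free_group S\<^esub> x = \<one>\<^bsub>free_group S\<^esub>"
    by (intro bexI[of _ "rev (map inv_letter x)"])
      (auto simp: free_group_def reduced_inverse foldr_red_cons_inverse inv_letter_def)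
next
  fix x y assume "x \<in> carrier (free_group S)" "y \<in> carrier (free_group S)"
  then show "x \<otimes>\<^bsub>free_group S\<^esub> y \<in> carrier (free_group S)"
    using set_foldr[of x y] by (auto simp: free_group_def reduced_foldr)
qed (auto simp: free_group_def foldr_red_cons_assoc)

definition eval_word :: "('b, 'm) monoid_scheme \<Rightarrow> ('a \<Rightarrow> 'b) \<Rightarrow> 'a letter list \<Rightarrow> 'b" where
  "eval_word H f w =
     foldr (\<lambda>x h. (if snd x then f (fst x) else inv\<^bsub>H\<^esub> f (fst x)) \<otimes>\<^bsub>H\<^esub> h) w \<one>\<^bsub>H\<^esub>"

text \<open>The universal property.\<close>

lemma free_group_universal:
  assumes "group H" and f: "f \<in> S \<rightarrow> carrier H"
  shows "\<exists>!h. h \<in> hom (free_group S) H \<inter> extensional (carrier (free_group S)) \<and>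
              (\<forall>a\<in>S. h [(a, True)] = f a)"
proof -
  interpret H: group H by fact
  let ?F = "free_group S"
  let ?l = "\<lambda>x. if snd x then f (fst x) else inv\<^bsub>H\<^esub> f (fst x)"
  let ?h = "eval_word H f"
  have l: "?l x \<in> carrier H" if "x \<in> S \<times> UNIV" for x using that f by auto
  have Nil: "?h [] = \<one>\<^bsub>H\<^esub>" and Cons: "?h (x # w) = ?l x \<otimes>\<^bsub>H\<^esub> ?h w" for x w
    by (auto simp: eval_word_def)
  have cl: "?h w \<in> carrier H" if "set w \<subseteq> S \<times> UNIV" for w
    using that
  proof (induction w)
    case (Cons x w)
    then show ?case using l[of x] by (simp add: \<open>\<And>x w. ?h (x # w) = _\<close>)
  qed (simp add: Nil)
  have rc: "?h (red_cons x w) = ?l x \<otimes>\<^bsub>H\<^esub> ?h w" if "x \<in> S \<times> UNIV" "set w \<subseteq> S \<times> UNIV" for x w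
  proof (cases "\<exists>v. w = inv_letter x # v")
    case True
    then obtain v where v: "w = inv_letter x # v" by auto
    have "?l x \<otimes>\<^bsub>H\<^esub> ?l (inv_letter x) = \<one>\<^bsub>H\<^esub>"
      using that f by (auto simp: inv_letter_def Pi_iff)
    moreover have "?l x \<in> carrier H" "?l (inv_letter x) \<in> carrier H" "?h v \<in> carrier H"
      using that l[of x] l[of "inv_letter x"] cl[of v] v by (auto simp: inv_letter_def)
    ultimately show ?thesis
      unfolding v by (simp only: Cons red_cons.simps if_True refl H.m_assoc[symmetric] H.l_one)
  next
    case False
    then show ?thesis by (cases w) (auto simp: Cons)
  qed
  have mult: "?h (foldr red_cons u v) = ?h u \<otimes>\<^bsub>H\<^esub> ?h v"
    if "set u \<subseteq> S \<times> UNIV" "set v \<subseteq> S \<times> UNIV" for u v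
    using that
  proof (induction u)
    case Nil
    then show ?case by (simp add: \<open>?h [] = _\<close> cl)
  next
    case (Cons x u)
    then have "set (foldr red_cons u v) \<subseteq> S \<times> UNIV" using set_foldr[of u v] by auto
    then show ?case
      using Cons l[of x] cl[of u] cl[of v] rc[of x "foldr red_cons u v"]
      by (simp add: H.m_assoc \<open>\<And>x w. ?h (x # w) = _\<close>)
  qed
  interpret F: group ?F by (rule group_free_group)
  have gen: "[(a, b)] \<in> carrier ?F" if "a \<in> S" for a b using that by (simp add: free_group_def)
  show ?thesis
  proof (rule ex1I[of _ "restrict ?h (carrier ?F)"])
    have "restrict ?h (carrier ?F) \<in> hom ?F H"
    proof (rule homI)
      fix u v assume uv: "u \<in> carrier ?F" "v \<in> carrier ?F"
      then show "restrict ?h (carrier ?F) (u \<otimes>\<^bsub>?F\<^esub> v) =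
          restrict ?h (carrier ?F) u \<otimes>\<^bsub>H\<^esub> restrict ?h (carrier ?F) v"
        using F.m_closed[OF uv] mult[of u v] by (simp add: free_group_def)
    qed (use cl in \<open>auto simp: free_group_def\<close>)
    moreover have "restrict ?h (carrier ?F) [(a, True)] = f a" if "a \<in> S" for a
      using gen[OF that] that f by (auto simp: Nil Cons Pi_iff)
    ultimately show "restrict ?h (carrier ?F) \<in> hom ?F H \<inter> extensional (carrier ?F) \<and>
        (\<forall>a\<in>S. restrict ?h (carrier ?F) [(a, True)] = f a)"
      by auto
  next
    fix h assume h: "h \<in> hom ?F H \<inter> extensional (carrier ?F) \<and> (\<forall>a\<in>S. h [(a, True)] = f a)"
    then have hom: "h \<in> hom ?F H" and ext: "h \<in> extensional (carrier ?F)"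
      and hS: "\<And>a. a \<in> S \<Longrightarrow> h [(a, True)] = f a"
      by auto
    interpret h: group_hom ?F H h by unfold_locales (fact hom)
    have letter: "h [x] = ?l x" if x: "x \<in> S \<times> UNIV" for x
    proof (cases "snd x")
      case True
      then obtain a where "x = (a, True)" "a \<in> S" using x by (cases x) auto
      then show ?thesis by (simp add: hS)
    next
      case False
      then obtain a where a: "x = (a, False)" "a \<in> S" using x by (cases x) auto
      have "[(a, False)] \<otimes>\<^bsub>?F\<^esub> [(a, True)] = \<one>\<^bsub>?F\<^esub>"
        by (simp add: free_group_def inv_letter_def)
      then have "inv\<^bsub>?F\<^esub> [(a, True)] = [(a, False)]"
        using gen[OF a(2)] by (intro F.inv_equality)
      then have "h [(a, False)] = inv\<^bsub>H\<^esub> h [(a, True)]"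
        using h.hom_inv gen[OF a(2)] by metis
      then show ?thesis using a by (simp add: hS)
    qed
    have "h w = ?h w" if "reduced w" "set w \<subseteq> S \<times> UNIV" for w
      using that
    proof (induction w)
      case Nil
      then show ?case using h.hom_one by (simp add: \<open>?h [] = _\<close> free_group_def)
    next
      case (Cons x w)
      have w: "w \<in> carrier ?F" "[x] \<in> carrier ?F"
        using Cons.prems reduced_ConsD[of x w] by (auto simp: free_group_def)
      have "x # w = [x] \<otimes>\<^bsub>?F\<^esub> w"
        using red_cons_reduced[OF Cons.prems(1)] by (simp add: free_group_def)
      then have "h (x # w) = h [x] \<otimes>\<^bsub>H\<^esub> h w" using h.hom_mult w by metis
      then show ?case
        using Cons letter[of x] reduced_ConsD[of x w] by (simp add: \<open>\<And>x w. ?h (x # w) = _\<close>)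
    qed
    then show "h = restrict ?h (carrier ?F)"
      using ext by (intro extensionalityI[of _ "carrier ?F"]) (auto simp: free_group_def)
  qed
qed

section \<open>The space of subgroups\<close>

definition Sub :: "('a, 'm) monoid_scheme \<Rightarrow> 'a set topology" where
  "Sub G = pullback_topology {H. subgroup H G} (\<lambda>H. \<lambda>g\<in>carrier G. g \<in> H)
             (product_topology (\<lambda>_. discrete_topology (UNIV :: bool set)) (carrier G))"

lemma topspace_Sub [simp]: "topspace (Sub G) = {H. subgroup H G}"
  by (auto simp: Sub_def topspace_pullback_topology)

definition borel_of :: "'a topology \<Rightarrow> 'a measure" where
  "borel_of X = sigma (topspace X) {U. openin X U}"

lemma space_borel_of [simp]: "space (borel_of X) = topspace X"
  by (simp add: borel_of_def space_measure_of_conv)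

lemma sets_borel_of: "sets (borel_of X) = sigma_sets (topspace X) {U. openin X U}"
  unfolding borel_of_def by (rule sets_measure_of) (auto dest: openin_subset)

definition Inn :: "('a, 'm) monoid_scheme \<Rightarrow> ('a \<Rightarrow> 'a) set" where
  "Inn G = (\<lambda>g. \<lambda>x\<in>carrier G. g \<otimes>\<^bsub>G\<^esub> x \<otimes>\<^bsub>G\<^esub> inv\<^bsub>G\<^esub> g) ` carrier G"

definition InnGroup :: "('a, 'm) monoid_scheme \<Rightarrow> ('a \<Rightarrow> 'a) monoid" where
  "InnGroup G = AutoGroup G \<lparr>carrier := Inn G\<rparr>"

section \<open>Weakly mixing actions\<close>

text \<open>
  Elements of \<open>L\<^sup>2(M)\<close> are represented by square-integrable functions.  A linear subspace of the
  quotient by almost-everywhere equality is represented by its preimage, that is, by a space of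
  square-integrable functions that is saturated under almost-everywhere equality.
\<close>

definition L2 :: "'x measure \<Rightarrow> ('x \<Rightarrow> complex) set" where
  "L2 M = {f \<in> borel_measurable M. integrable M (\<lambda>x. (cmod (f x))\<^sup>2)}"

definition L2_subspace :: "'x measure \<Rightarrow> ('x \<Rightarrow> complex) set \<Rightarrow> bool" where
  "L2_subspace M V \<longleftrightarrow>
     V \<subseteq> L2 M \<and>
     (\<lambda>_. 0) \<in> V \<and>
     (\<forall>f\<in>V. \<forall>g\<in>V. (\<lambda>x. f x + g x) \<in> V) \<and>
     (\<forall>c. \<forall>f\<in>V. (\<lambda>x. c * f x) \<in> V) \<and>
     (\<forall>f\<in>V. \<forall>g\<in>L2 M. (AE x in M. f x = g x) \<longrightarrow> g \<in> V)"

definition L2_finite_dim :: "'x measure \<Rightarrow> ('x \<Rightarrow> complex) set \<Rightarrow> bool" where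
  "L2_finite_dim M V \<longleftrightarrow>
     (\<exists>B. finite B \<and> B \<subseteq> V \<and> (\<forall>f\<in>V. \<exists>c. AE x in M. f x = (\<Sum>b\<in>B. c b * b x)))"

definition L2_zero :: "'x measure \<Rightarrow> ('x \<Rightarrow> complex) set" where
  "L2_zero M = {f \<in> L2 M. AE x in M. f x = 0}"

definition L2_const :: "'x measure \<Rightarrow> ('x \<Rightarrow> complex) set" where
  "L2_const M = {f \<in> L2 M. \<exists>c. AE x in M. f x = c}"

definition weakly_mixing ::
    "('g, 'm) monoid_scheme \<Rightarrow> ('g \<Rightarrow> 'x \<Rightarrow> 'x) \<Rightarrow> 'x measure \<Rightarrow> bool" where
  "weakly_mixing \<Gamma> act M \<longleftrightarrow>
     (\<forall>V. L2_subspace M V \<and> L2_finite_dim M V \<and>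
          (\<forall>g\<in>carrier \<Gamma>. \<forall>f\<in>V. (\<lambda>x. f (act (inv\<^bsub>\<Gamma>\<^esub> g) x)) \<in> V)
        \<longrightarrow> V = L2_zero M \<or> V = L2_const M)"

section \<open>Characteristic random subgroups\<close>

definition CRS :: "('a, 'm) monoid_scheme \<Rightarrow> 'a set measure \<Rightarrow> bool" where
  "CRS G \<mu> \<longleftrightarrow>
     prob_space \<mu> \<and> sets \<mu> = sets (borel_of (Sub G)) \<and>
     (\<forall>\<phi>\<in>carrier (AutoGroup G). distr \<mu> \<mu> (\<lambda>H. \<phi> ` H) = \<mu>)"

definition continuous_CRS :: "('a, 'm) monoid_scheme \<Rightarrow> 'a set measure \<Rightarrow> bool" where
  "continuous_CRS G \<mu> \<longleftrightarrow> CRS G \<mu> \<and> (\<forall>H. subgroup H G \<longrightarrow> emeasure \<mu> {H} = 0)"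

definition Inn_weakly_mixing :: "('a, 'm) monoid_scheme \<Rightarrow> 'a set measure \<Rightarrow> bool" where
  "Inn_weakly_mixing G \<mu> \<longleftrightarrow> weakly_mixing (InnGroup G) (\<lambda>\<phi> H. \<phi> ` H) \<mu>"

text \<open>
  Two well-definedness checks: \<open>distr\<close> in \<open>CRS\<close> is applied to a measurable map, and
  \<open>continuous_CRS\<close> evaluates \<open>\<mu>\<close> only at Borel sets (a non-measurable set would have measure 0
  by convention).
\<close>

lemma continuous_map_Sub_membership:
  assumes "g \<in> carrier G"
  shows "continuous_map (Sub G) (discrete_topology UNIV) (\<lambda>H. g \<in> H)"
proof -
  have "continuous_map (Sub G) (discrete_topology UNIV)
          ((\<lambda>x. x g) \<circ> (\<lambda>H. \<lambda>g\<in>carrier G. g \<in> H))"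
    unfolding Sub_def
    by (intro continuous_map_pullback continuous_map_product_projection assms)
  then show ?thesis using assms by (simp add: o_def)
qed

lemma continuous_map_Aut_Sub:
  assumes "group G" and \<phi>: "\<phi> \<in> auto G"
  shows "continuous_map (Sub G) (Sub G) (\<lambda>H. \<phi> ` H)"
proof -
  interpret group G by fact
  have bij: "bij_betw \<phi> (carrier G) (carrier G)" and hom: "\<phi> \<in> hom G G"
    using \<phi> by (auto simp: auto_def Bij_def)
  interpret group_hom G G \<phi> by unfold_locales (fact hom)
  let ?\<psi> = "inv_into (carrier G) \<phi>"
  let ?P = "product_topology (\<lambda>_. discrete_topology (UNIV :: bool set)) (carrier G)"
  have mem: "g \<in> \<phi> ` H \<longleftrightarrow> ?\<psi> g \<in> H" if "g \<in> carrier G" "subgroup H G" for g H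
    using that bij subgroup.subset[OF that(2)]
    by (smt (verit) bij_betw_def bij_betw_inv_into_left bij_betw_inv_into_right image_iff subsetD)
  have "continuous_map (Sub G) ?P ((\<lambda>H. \<lambda>g\<in>carrier G. g \<in> H) \<circ> (\<lambda>H. \<phi> ` H))"
    unfolding continuous_map_componentwise
  proof (intro conjI ballI)
    fix g assume g: "g \<in> carrier G"
    then have "?\<psi> g \<in> carrier G" using bij by (meson bij_betwE bij_betw_inv_into)
    from continuous_map_Sub_membership[OF this]
    show "continuous_map (Sub G) (discrete_topology UNIV)
            (\<lambda>H. ((\<lambda>H. \<lambda>g\<in>carrier G. g \<in> H) \<circ> (\<lambda>H. \<phi> ` H)) H g)"
      by (rule continuous_map_eq) (use g mem in auto)
  qed auto
  moreover have "subgroup (\<phi> ` H) G" if "subgroup H G" for H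
    using that by (rule subgroup_img_is_subgroup)
  ultimately show ?thesis
    by (subst (2) Sub_def, intro continuous_map_pullback') auto
qed

lemma measurable_Aut_Sub:
  assumes "group G" "\<phi> \<in> auto G"
  shows "(\<lambda>H. \<phi> ` H) \<in> borel_of (Sub G) \<rightarrow>\<^sub>M borel_of (Sub G)"
proof -
  note c = continuous_map_Aut_Sub[OF assms]
  show ?thesis
    unfolding borel_of_def[of "Sub G"]
  proof (rule measurable_measure_of, goal_cases)
    case (3 U)
    then have "openin (Sub G) {x \<in> topspace (Sub G). \<phi> ` x \<in> U}"
      using openin_continuous_map_preimage[OF c] by simp
    moreover have "(\<lambda>H. \<phi> ` H) -` U \<inter> topspace (Sub G) = {x \<in> topspace (Sub G). \<phi> ` x \<in> U}"
      by auto
    ultimately show ?case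
      using sets_borel_of[of "Sub G"] by (simp add: borel_of_def space_measure_of_conv)
  next
    case 1
    then show ?case using openin_subset[of "Sub G"] by blast
  next
    case 2
    then show ?case using c by (auto simp: continuous_map_def space_measure_of_conv)
  qed
qed

lemma singleton_in_borel_of_Sub:
  assumes "countable (carrier G)" "subgroup H G"
  shows "{H} \<in> sets (borel_of (Sub G))"
proof -
  let ?X = "Sub G"
  define A where "A g = {K \<in> topspace ?X. (g \<in> K) = (g \<in> H)}" for g
  have A: "A g \<in> sets (borel_of ?X)" if "g \<in> carrier G" for g
  proof -
    have "openin ?X {K \<in> topspace ?X. (g \<in> K) \<in> {g \<in> H}}"
      by (rule openin_continuous_map_preimage[OF continuous_map_Sub_membership[OF that]]) simp
    then show ?thesis unfolding A_def sets_borel_of by (auto intro: sigma_sets.Basic)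
  qed
  have ne: "carrier G \<noteq> {}" using subgroup.one_closed[OF assms(2)] subgroup.subset[OF assms(2)] by auto
  have "{H} = (\<Inter>g\<in>carrier G. A g)"
  proof (intro equalityI subsetI)
    fix K assume K: "K \<in> (\<Inter>g\<in>carrier G. A g)"
    then have "subgroup K G" using ne by (auto simp: A_def)
    then show "K \<in> {H}"
      using K subgroup.subset[of K G] subgroup.subset[OF assms(2)] by (auto simp: A_def)
  qed (use assms(2) in \<open>auto simp: A_def\<close>)
  also have "\<dots> \<in> sets (borel_of ?X)"
    using A ne assms(1) by (intro sets.countable_INT') auto
  finally show ?thesis .
qed

end

theory Submission
  imports Defs "HOL-Algebra.Generated_Groups"
begin

text \<open>
  Let \<open>F\<close> be the free group and \<open>N\<close> a fully invariant subgroup on which all homomorphisms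
  \<open>F \<rightarrow> Z\<close> vanish and which has a nonzero homomorphism to \<open>Z/2\<close>.  The kernel \<open>H\<close> of a
  Haar-random homomorphism \<open>N \<rightarrow> Z/2\<close> is a characteristic random subgroup, and \<open>N\<close> can be read
  off from it, because \<open>n\<close> lies in \<open>H\<close> with positive probability iff \<open>n \<in> N\<close>.  The elements of
  \<open>N \<otimes> Z/2\<close> are the mod 2 cycles of the coset graph of \<open>N\<close>, so a nonzero one has infinitely many
  conjugates under the powers of a generator \<open>a\<close>.  The corresponding characters are orthonormal;
  hence by Bessel's inequality a Fourier coefficient along such an orbit tends to \<open>0\<close>, which
  excludes atoms as well as non-constant functions in a finite-dimensional invariant subspace.

  It remains to find continuum many such \<open>N\<close>.  For a set \<open>D\<close> of odd primes let \<open>N\<^sub>D\<close> be generated by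
  all \<open>[u, c u c\<^sup>-\<^sup>1]\<close> with \<open>u = [[t, x], t']\<close> and \<open>c = [m, m']\<close>, where \<open>t\<close>, \<open>t'\<close>, \<open>m\<close> have exponent sums
  \<open>0\<close> and the exponent sums of \<open>m'\<close> are divisible by some \<open>q \<in> D\<close>.  To separate them, let \<open>F\<close> act
  on the vertices of a semidirect product of a lamp group with the Heisenberg group, where some
  edges carry generators of an extraspecial 2-group.  Every \<open>u\<close> is a closed path, whose label has
  image \<open>U\<close>, and \<open>c\<close> translates it by a lamp configuration \<open>C\<close>; as all configurations are
  involutions, the label of \<open>[u, c u c\<^sup>-\<^sup>1]\<close> is central, and it is nontrivial iff \<open>|U|\<close> is odd and
  \<open>C\<close> equals the configuration \<open>g\<close> that defines the commutator form.  Choosing \<open>g\<close> as the configuration of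
  \<open>[[a, b], a\<^sup>n]\<close>, which no \<open>c\<close> belonging to an odd prime \<open>q \<noteq> n\<close> attains, detects whether \<open>n \<in> D\<close>.
\<close>

section \<open>Actions of free groups through letters\<close>

text \<open>Finite sets with symmetric difference serve throughout as vectors over Z/2, and the
  parity of the cardinality is a linear functional on them.\<close>

lemma odd_card_sym_diff:
  assumes "finite A" "finite B"
  shows "odd (card (sym_diff A B)) \<longleftrightarrow> (odd (card A) \<noteq> odd (card B))"
proof -
  have "card (sym_diff A B) = card (A - B) + card (B - A)"
    using assms by (intro card_Un_disjoint) auto
  moreover have "card A = card (A - B) + card (A \<inter> B)" "card B = card (B - A) + card (A \<inter> B)"
    using assms by (metis Diff_Diff_Int card_Diff_subset_Int card_Int_Diff add.commute inf_commute)+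
  ultimately show ?thesis by (simp add: even_add) blast
qed

lemma carrier_free_group: "carrier (free_group S) = {w. reduced w \<and> set w \<subseteq> S \<times> UNIV}"
  and mult_free_group: "u \<otimes>\<^bsub>free_group S\<^esub> v = foldr red_cons u v"
  and one_free_group: "\<one>\<^bsub>free_group S\<^esub> = []"
  by (simp_all add: free_group_def)

lemma inv_free_group:
  assumes "w \<in> carrier (free_group S)"
  shows "inv\<^bsub>free_group S\<^esub> w = rev (map inv_letter w)"
proof (rule group.inv_equality[OF group_free_group])
  show "rev (map inv_letter w) \<in> carrier (free_group S)"
    using assms by (auto simp: free_group_def reduced_inverse inv_letter_def)
qed (use assms in \<open>auto simp: free_group_def foldr_red_cons_inverse\<close>)

definition commutator :: "('a, 'm) monoid_scheme \<Rightarrow> 'a \<Rightarrow> 'a \<Rightarrow> 'a" where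
  "commutator G x y = x \<otimes>\<^bsub>G\<^esub> y \<otimes>\<^bsub>G\<^esub> inv\<^bsub>G\<^esub> x \<otimes>\<^bsub>G\<^esub> inv\<^bsub>G\<^esub> y"

lemma (in group) commutator_closed [simp, intro]:
  "x \<in> carrier G \<Longrightarrow> y \<in> carrier G \<Longrightarrow> commutator G x y \<in> carrier G"
  by (simp add: commutator_def)

text \<open>Words are read from left to right, so letters that undo each other make
  \<open>fold act\<close> a right action of the free group. The automaton below and the coset graph
  are both instances.\<close>

locale word_action =
  fixes S :: "'a set" and St :: "'s set" and act :: "'a letter \<Rightarrow> 's \<Rightarrow> 's"
  assumes act_in: "\<And>l s. l \<in> S \<times> UNIV \<Longrightarrow> s \<in> St \<Longrightarrow> act l s \<in> St"
    and act_inv: "\<And>l s. l \<in> S \<times> UNIV \<Longrightarrow> s \<in> St \<Longrightarrow> act (inv_letter l) (act l s) = s"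
begin

lemma fold_red_cons:
  "l \<in> S \<times> UNIV \<Longrightarrow> s \<in> St \<Longrightarrow> fold act (red_cons l w) s = fold act w (act l s)"
  by (cases w) (auto simp: act_inv)

lemma fold_foldr_red_cons:
  assumes "set u \<subseteq> S \<times> UNIV" "s \<in> St"
  shows "fold act (foldr red_cons u v) s = fold act v (fold act u s)"
  using assms
proof (induction u arbitrary: s)
  case (Cons l u)
  then show ?case by (auto simp: fold_red_cons act_in)
qed simp

lemma fold_mult:
  assumes "u \<in> carrier (free_group S)" "s \<in> St"
  shows "fold act (u \<otimes>\<^bsub>free_group S\<^esub> v) s = fold act v (fold act u s)"
  using assms by (simp add: mult_free_group fold_foldr_red_cons carrier_free_group)

lemma fold_inv:
  assumes "u \<in> carrier (free_group S)" "s \<in> St"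
  shows "fold act (inv\<^bsub>free_group S\<^esub> u) (fold act u s) = s"
proof -
  interpret group "free_group S" by (rule group_free_group)
  have "fold act (inv\<^bsub>free_group S\<^esub> u) (fold act u s) = fold act (u \<otimes>\<^bsub>free_group S\<^esub> inv\<^bsub>free_group S\<^esub> u) s"
    by (rule fold_mult[OF assms, symmetric])
  also have "\<dots> = s" unfolding r_inv[OF assms(1)] by (simp add: one_free_group)
  finally show ?thesis .
qed

lemma fold_commutator:
  assumes "u \<in> carrier (free_group S)" "v \<in> carrier (free_group S)" "s \<in> St"
  shows "fold act (commutator (free_group S) u v) s =
    fold act (inv\<^bsub>free_group S\<^esub> v) (fold act (inv\<^bsub>free_group S\<^esub> u) (fold act v (fold act u s)))"
proof -
  interpret group "free_group S" by (rule group_free_group)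
  show ?thesis using assms by (simp add: commutator_def fold_mult)
qed

end

text \<open>A subset of \<open>nat \<times> int\<close> is a configuration of lamps; \<open>lamp i\<close> switches on, for every modulus
  \<open>q\<close>, the lamps at the positions congruent to \<open>i\<close>.\<close>

definition lamp :: "int \<Rightarrow> (nat \<times> int) set" where
  "lamp i = {(q, r). int q dvd i - r}"

definition shift :: "int \<Rightarrow> (nat \<times> int) set \<Rightarrow> (nat \<times> int) set" where
  "shift i L = {(q, r). (q, r - i) \<in> L}"

lemma shift_simps [simp]:
  "shift 0 L = L" "shift i {} = {}" "shift i (shift j L) = shift (i + j) L"
  "shift i (L - M) = shift i L - shift i M"
  "shift i (L \<union> M) = shift i L \<union> shift i M"
  "shift i (lamp j) = lamp (i + j)"
proof -
  show "shift i (lamp j) = lamp (i + j)"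
    by (auto simp: shift_def lamp_def algebra_simps)
qed (auto simp: shift_def algebra_simps)

type_synonym vertex = "int \<times> int \<times> int \<times> (nat \<times> int) set"

text \<open>The integral Heisenberg group acts on lamp configurations through its first coordinate; this
  is the semidirect product.\<close>

fun vmult :: "vertex \<Rightarrow> vertex \<Rightarrow> vertex" where
  "vmult (i, j, k, L) (i', j', k', L') = (i + i', j + j', k + k' + i * j', sym_diff L (shift i L'))"

fun vinv :: "vertex \<Rightarrow> vertex" where
  "vinv (i, j, k, L) = (- i, - j, i * j - k, shift (- i) L)"

abbreviation vone :: vertex where "vone \<equiv> (0, 0, 0, {})"

lemma vmult_assoc: "vmult (vmult x y) z = vmult x (vmult y z)"
proof -
  obtain i j k L where x: "x = (i, j, k, L)" by (metis prod_cases4)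
  obtain i' j' k' L' where y: "y = (i', j', k', L')" by (metis prod_cases4)
  obtain i'' j'' k'' L'' where z: "z = (i'', j'', k'', L'')" by (metis prod_cases4)
  show ?thesis unfolding x y z by (auto simp: algebra_simps)
qed

lemma vmult_vone [simp]: "vmult x vone = x" "vmult vone x = x"
  by (cases x; simp)+

lemma vmult_vinv [simp]: "vmult x (vinv x) = vone" "vmult (vinv x) x = vone"
  by (cases x; simp add: algebra_simps)+

lemma vmult_left_cancel: "vmult x y = vmult x z \<longleftrightarrow> y = z"
  by (metis vmult_assoc vmult_vinv(2) vmult_vone(2))

section \<open>An automaton with labels in an extraspecial 2-group\<close>

locale machine =
  fixes S :: "'a set" and a b :: 'a and g :: "(nat \<times> int) set" and pt :: "nat \<times> int"
  assumes ab: "a \<in> S" "b \<in> S" "a \<noteq> b" and pt: "pt \<in> g"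
begin

text \<open>The inverse of \<open>b\<close> toggles the same lamps as \<open>b\<close>, because
  configurations are involutions and the first coordinate of \<open>b\<close> is 0.\<close>

definition vgen :: "'a letter \<Rightarrow> vertex" where
  "vgen l = (let e = (if snd l then 1 else - 1) in
     if fst l = a then (e, 0, 0, {}) else if fst l = b then (0, e, 0, lamp 0) else vone)"

definition vstep :: "'a letter \<Rightarrow> vertex \<Rightarrow> vertex" where
  "vstep l p = vmult p (vgen l)"

text \<open>The labelled edges are the \<open>b\<close>-edges that start over the identity of the
  Heisenberg group; the lamps there name the extraspecial generator. An inverse letter traverses the
  edge that starts at its target.\<close>

definition label :: "vertex \<Rightarrow> 'a letter \<Rightarrow> (nat \<times> int) set option" where
  "label p l = (if fst l = b then
     (case (if snd l then p else vstep l p) of (i, j, k, L) \<Rightarrow>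
        if i = 0 \<and> j = 0 \<and> k = 0 then Some L else None) else None)"

text \<open>A pair \<open>(U, c)\<close> stands for an element of the extraspecial group with involutive generators
  \<open>e\<^sub>L\<close> in which \<open>e\<^sub>L\<close> and \<open>e\<^sub>M\<close> fail to commute iff \<open>M\<close> is the sum of \<open>L\<close> and \<open>g\<close>: \<open>U\<close> is the image in
  the abelianization, \<open>c\<close> the central part.  The lamp \<open>pt\<close> of \<open>g\<close> selects one of the two orderings of
  each such pair, which makes the commutator form the antisymmetrization of a cocycle.\<close>

fun emult :: "(nat \<times> int) set option \<Rightarrow> (nat \<times> int) set set \<times> bool \<Rightarrow> (nat \<times> int) set set \<times> bool" where
  "emult None e = e"
| "emult (Some L) (U, c) = (sym_diff U {L}, c \<noteq> (sym_diff L g \<in> U \<and> pt \<notin> sym_diff L g))"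

definition step :: "'a letter \<Rightarrow> vertex \<times> (nat \<times> int) set set \<times> bool \<Rightarrow> vertex \<times> (nat \<times> int) set set \<times> bool"
  where "step l s = (vstep l (fst s), emult (label (fst s) l) (snd s))"

lemma vgen_inv: "vmult (vgen l) (vgen (inv_letter l)) = vone"
  using ab by (auto simp: vgen_def inv_letter_def Let_def)

lemma vstep_inv: "vstep (inv_letter l) (vstep l p) = p"
  by (simp add: vstep_def vmult_assoc vgen_inv)

lemma label_inv: "label (vstep l p) (inv_letter l) = label p l"
  using vstep_inv[of l p] by (cases "snd l") (auto simp: label_def inv_letter_def)

lemma emult_emult: "emult o' (emult o' e) = e"
proof (cases o')
  case (Some L)
  obtain U c where e: "e = (U, c)" by (cases e)
  have "sym_diff L g \<noteq> L" using pt by auto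
  then show ?thesis unfolding Some e by (auto split: if_splits)
qed simp

end

sublocale machine \<subseteq> vact: word_action S UNIV vstep
  by unfold_locales (auto simp: vstep_inv)

sublocale machine \<subseteq> sact: word_action S UNIV step
  by unfold_locales (auto simp: step_def vstep_inv label_inv emult_emult)

section \<open>The effect of a word on the automaton\<close>

definition (in machine) vpos :: "'a letter list \<Rightarrow> vertex" where
  "vpos w = fold vstep w vone"

definition (in machine) labels :: "vertex \<Rightarrow> 'a letter list \<Rightarrow> (nat \<times> int) set set" where
  "labels p w = fst (snd (fold step w (p, {}, False)))"

definition (in machine) ebit :: "vertex \<Rightarrow> 'a letter list \<Rightarrow> bool" where
  "ebit p w = snd (snd (fold step w (p, {}, False)))"

text \<open>This is the bilinear cocycle of the extraspecial group: multiplying an element with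
  image \<open>U\<close> by one with image \<open>V\<close> adds \<open>form U V\<close> to the
  central part.\<close>

definition (in machine) form :: "(nat \<times> int) set set \<Rightarrow> (nat \<times> int) set set \<Rightarrow> bool" where
  "form U V \<longleftrightarrow> odd (card {L \<in> V. sym_diff L g \<in> U \<and> pt \<notin> sym_diff L g})"

context machine
begin

lemma fold_vstep: "fold vstep w p = vmult p (vpos w)"
proof (induction w rule: rev_induct)
  case (snoc l w)
  then show ?case by (simp add: vpos_def vstep_def vmult_assoc)
qed (simp add: vpos_def)

lemma step_pair: "step l (p, e) = (vstep l p, emult (label p l) e)"
  by (simp add: step_def)

lemma fst_fold_step: "fst (fold step w s) = vmult (fst s) (vpos w)"
proof (induction w rule: rev_induct)
  case (snoc l w)
  then show ?case by (simp add: vpos_def vstep_def vmult_assoc step_def)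
qed (simp add: vpos_def)

lemma form_sym_diff_right:
  assumes "finite V" "finite W"
  shows "form U (sym_diff V W) \<longleftrightarrow> (form U V \<noteq> form U W)"
proof -
  let ?P = "\<lambda>L. sym_diff L g \<in> U \<and> pt \<notin> sym_diff L g"
  have "{L \<in> sym_diff V W. ?P L} = sym_diff {L \<in> V. ?P L} {L \<in> W. ?P L}" by blast
  moreover have "finite {L \<in> V. ?P L}" "finite {L \<in> W. ?P L}" using assms by simp_all
  ultimately show ?thesis unfolding form_def by (simp only: odd_card_sym_diff)
qed

lemma form_sym_diff_left:
  assumes "finite W"
  shows "form (sym_diff U V) W \<longleftrightarrow> (form U W \<noteq> form V W)"
proof -
  let ?P = "\<lambda>U L. sym_diff L g \<in> U \<and> pt \<notin> sym_diff L g"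
  have "{L \<in> W. ?P (sym_diff U V) L} = sym_diff {L \<in> W. ?P U L} {L \<in> W. ?P V L}" by blast
  moreover have "finite {L \<in> W. ?P U L}" "finite {L \<in> W. ?P V L}" using assms by simp_all
  ultimately show ?thesis unfolding form_def by (simp only: odd_card_sym_diff)
qed

lemma form_singleton: "form U {L} \<longleftrightarrow> sym_diff L g \<in> U \<and> pt \<notin> sym_diff L g"
proof -
  have "{L' \<in> {L}. sym_diff L' g \<in> U \<and> pt \<notin> sym_diff L' g} =
    (if sym_diff L g \<in> U \<and> pt \<notin> sym_diff L g then {L} else {})" by auto
  then show ?thesis unfolding form_def by simp
qed

text \<open>Bilinearity of \<open>form\<close> makes multiplication letter by letter agree with
  multiplication by a single group element, so the run of \<open>w\<close> from the trivial label
  determines its run from any label.\<close>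

lemma fold_step:
  "finite (labels p w) \<and> fold step w (p, U, c) =
    (vmult p (vpos w), sym_diff U (labels p w), c \<noteq> (form U (labels p w) \<noteq> ebit p w))"
proof (induction w rule: rev_induct)
  case Nil
  then show ?case by (simp add: vpos_def labels_def ebit_def form_def)
next
  case (snoc l w)
  let ?o = "label (vmult p (vpos w)) l"
  have 0: "fold step w (p, {}, False) = (vmult p (vpos w), labels p w, ebit p w)"
    using fst_fold_step[of w "(p, {}, False)"] by (simp add: labels_def ebit_def prod_eq_iff)
  have v: "vpos (w @ [l]) = vmult (vpos w) (vgen l)" by (simp add: vpos_def vstep_def)
  have e: "(labels p (w @ [l]), ebit p (w @ [l])) = emult ?o (labels p w, ebit p w)"
    unfolding labels_def[of p "w @ [l]"] ebit_def[of p "w @ [l]"] fold_append comp_apply 0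
    by (simp add: step_pair)
  have fin: "finite (labels p w)"
    and IH: "fold step w (p, U, c) =
      (vmult p (vpos w), sym_diff U (labels p w), c \<noteq> (form U (labels p w) \<noteq> ebit p w))"
    using snoc by simp_all
  show ?case
  proof (cases ?o)
    case None
    then show ?thesis using e fin by (simp add: IH v step_pair) (simp add: vstep_def vmult_assoc)
  next
    case (Some L)
    then have l: "labels p (w @ [l]) = sym_diff (labels p w) {L}"
      and b: "ebit p (w @ [l]) \<longleftrightarrow> ebit p w \<noteq> form (labels p w) {L}"
      using e by (simp_all add: form_singleton)
    have "finite {L}" by simp
    note f = form_sym_diff_right[OF fin this] form_sym_diff_left[OF this]
    have "fold step (w @ [l]) (p, U, c) = (vstep l (vmult p (vpos w)),
        sym_diff (sym_diff U (labels p w)) {L},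
        (c \<noteq> (form U (labels p w) \<noteq> ebit p w)) \<noteq> form (sym_diff U (labels p w)) {L})"
      by (simp add: IH Some step_pair form_singleton)
    moreover have "sym_diff (sym_diff U (labels p w)) {L} = sym_diff U (labels p (w @ [l]))"
      unfolding l by blast
    moreover have "finite (labels p (w @ [l]))" unfolding l using fin by simp
    moreover have "(c \<noteq> (form U (labels p w) \<noteq> ebit p w)) \<noteq> form (sym_diff U (labels p w)) {L}
      \<longleftrightarrow> c \<noteq> (form U (labels p (w @ [l])) \<noteq> ebit p (w @ [l]))"
      unfolding l b f by blast
    ultimately show ?thesis by (simp only: v vstep_def vmult_assoc)
  qed
qed

lemma finite_labels: "finite (labels p w)"
  using fold_step by blast

text \<open>Left multiplication by a lamp configuration commutes with right multiplication by
  generators and keeps the Heisenberg part, so it maps labelled edges to labelled edges and adds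
  \<open>M\<close> to each label.\<close>

lemma labels_translate:
  "labels (vmult (0, 0, 0, M) p) w = (\<lambda>L. sym_diff M L) ` labels p w"
proof (induction w rule: rev_induct)
  case Nil
  then show ?case by (simp add: labels_def)
next
  case (snoc l w)
  have inj: "inj (\<lambda>L. sym_diff M L)" by (rule injI) blast
  have e: "labels q (w @ [l]) = fst (emult (label (vmult q (vpos w)) l) (labels q w, ebit q w))" for q
  proof -
    have "fold step w (q, {}, False) = (vmult q (vpos w), labels q w, ebit q w)"
      using fst_fold_step[of w "(q, {}, False)"] by (simp add: labels_def ebit_def prod_eq_iff)
    then show ?thesis unfolding labels_def[of q "w @ [l]"] by (simp add: step_pair)
  qed
  have L: "label (vmult (0, 0, 0, M) q) l = map_option (\<lambda>L. sym_diff M L) (label q l)" for q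
  proof (cases q)
    case (fields i j k L)
    obtain i' j' k' L' where "vgen l = (i', j', k', L')" by (metis prod_cases4)
    then show ?thesis unfolding fields by (auto simp: label_def vstep_def)
  qed
  show ?case
  proof (cases "label (vmult p (vpos w)) l")
    case None
    show ?thesis unfolding e vmult_assoc L None snoc by simp
  next
    case (Some K)
    have "(\<lambda>L. sym_diff M L) ` sym_diff (labels p w) {K} =
        sym_diff ((\<lambda>L. sym_diff M L) ` labels p w) {sym_diff M K}"
      unfolding image_Un image_set_diff[OF inj] by simp
    moreover have "labels p (w @ [l]) = sym_diff (labels p w) {K}"
      unfolding e Some by simp
    moreover have "labels (vmult (0, 0, 0, M) p) (w @ [l]) =
        sym_diff ((\<lambda>L. sym_diff M L) ` labels p w) {sym_diff M K}"
      unfolding e vmult_assoc L Some snoc option.map emult.simps fst_conv ..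
    ultimately show ?thesis by (simp only:)
  qed
qed

text \<open>The lamp \<open>pt\<close> of \<open>g\<close> lies in exactly one of \<open>L\<close>
  and \<open>sym_diff L g\<close>, so the two orderings together count every noncommuting pair
  once.\<close>

lemma form_swap:
  assumes "finite U" "finite V"
  shows "(form U V \<noteq> form V U) \<longleftrightarrow> odd (card {L \<in> V. sym_diff L g \<in> U})"
proof -
  let ?d = "\<lambda>L. sym_diff L g"
  have dd: "?d (?d L) = L" for L by blast
  have "bij_betw ?d {L \<in> U. ?d L \<in> V \<and> pt \<notin> ?d L} {L \<in> V. ?d L \<in> U \<and> pt \<notin> L}"
    by (rule bij_betwI[where g = ?d]) (auto simp: dd)
  then have "form V U \<longleftrightarrow> odd (card {L \<in> V. ?d L \<in> U \<and> pt \<notin> L})"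
    unfolding form_def by (simp only: bij_betw_same_card)
  moreover have "form U V \<longleftrightarrow> odd (card {L \<in> V. ?d L \<in> U \<and> pt \<in> L})"
    unfolding form_def using pt by (intro arg_cong[where f = odd] arg_cong[where f = card]) blast
  moreover have "{L \<in> V. ?d L \<in> U} = sym_diff {L \<in> V. ?d L \<in> U \<and> pt \<in> L} {L \<in> V. ?d L \<in> U \<and> pt \<notin> L}"
    by blast
  moreover have "finite {L \<in> V. ?d L \<in> U \<and> pt \<in> L}" "finite {L \<in> V. ?d L \<in> U \<and> pt \<notin> L}"
    using assms by simp_all
  ultimately show ?thesis by (simp only: odd_card_sym_diff)
qed

text \<open>After substituting the translate, one counts the \<open>L\<close> in \<open>U\<close>
  with \<open>sym_diff L e\<close> in \<open>U\<close>, where \<open>e\<close> is the sum of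
  \<open>M\<close> and \<open>g\<close>. For empty \<open>e\<close> this is all of \<open>U\<close>;
  otherwise adding \<open>e\<close> is an involution without fixed points, and the count is
  even.\<close>

lemma odd_card_translate:
  fixes M :: "(nat \<times> int) set"
  assumes "finite U"
  shows "odd (card {L \<in> (\<lambda>L. sym_diff M L) ` U. sym_diff L g \<in> U}) \<longleftrightarrow> M = g \<and> odd (card U)"
proof -
  let ?m = "\<lambda>L. sym_diff M L" and ?d = "\<lambda>L. sym_diff L g"
  have m: "?m (?m L) = L" for L by blast
  define e where "e = sym_diff M g"
  let ?e = "\<lambda>L. sym_diff L e"
  have e: "?d (?m L) = ?e L" for L unfolding e_def by blast
  have ee: "?e (?e L) = L" for L by blast
  have "bij_betw ?m {L \<in> U. ?e L \<in> U} {L \<in> ?m ` U. ?d L \<in> U}"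
  proof (rule bij_betwI[where g = ?m], goal_cases)
    case 1
    show ?case unfolding Pi_iff mem_Collect_eq e by blast
  next
    case 2
    show ?case
    proof (rule Pi_I)
      fix x assume x: "x \<in> {L \<in> ?m ` U. ?d L \<in> U}"
      then obtain y where y: "x = ?m y" "y \<in> U" by blast
      then have "?m x = y" using m[of y] by simp
      moreover have "?e y \<in> U" using x e[of y] y(1) by simp
      ultimately show "?m x \<in> {L \<in> U. ?e L \<in> U}" using y(2) by (simp only: mem_Collect_eq simp_thms)
    qed
  qed (rule m)+
  then have eq: "card {L \<in> ?m ` U. ?d L \<in> U} = card {L \<in> U. ?e L \<in> U}"
    by (simp only: bij_betw_same_card)
  show ?thesis
  proof (cases "M = g")
    case True
    then have "e = {}" by (simp add: e_def)
    then show ?thesis unfolding eq by (simp add: True)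
  next
    case False
    \<comment> \<open>Adding \<open>e\<close> changes the lamp \<open>z\<close>, hence exchanges the
      configurations with \<open>z\<close> and those without it.\<close>
    then obtain z where z: "z \<in> e" unfolding e_def by blast
    have ze: "z \<in> ?e L \<longleftrightarrow> z \<notin> L" for L using z by blast
    have "bij_betw ?e {L \<in> U. ?e L \<in> U \<and> z \<in> L} {L \<in> U. ?e L \<in> U \<and> z \<notin> L}"
    proof (rule bij_betwI[where g = ?e], goal_cases)
      case 1
      show ?case unfolding Pi_iff mem_Collect_eq ee ze by blast
    next
      case 2
      show ?case unfolding Pi_iff mem_Collect_eq ee ze by blast
    qed (rule ee)+
    then have "card {L \<in> U. ?e L \<in> U \<and> z \<in> L} = card {L \<in> U. ?e L \<in> U \<and> z \<notin> L}"
      by (rule bij_betw_same_card)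
    moreover have "{L \<in> U. ?e L \<in> U} = sym_diff {L \<in> U. ?e L \<in> U \<and> z \<in> L} {L \<in> U. ?e L \<in> U \<and> z \<notin> L}"
      by blast
    moreover have "finite {L \<in> U. ?e L \<in> U \<and> z \<in> L}" "finite {L \<in> U. ?e L \<in> U \<and> z \<notin> L}"
      using assms by simp_all
    ultimately have "odd (card {L \<in> U. ?e L \<in> U}) \<longleftrightarrow> False"
      by (simp only: odd_card_sym_diff simp_thms)
    then show ?thesis unfolding eq using False by simp
  qed
qed

end

section \<open>A family of fully invariant subgroups\<close>

definition int_chars :: "('a, 'm) monoid_scheme \<Rightarrow> ('a \<Rightarrow> int) set" where
  "int_chars G = {h. \<forall>x\<in>carrier G. \<forall>y\<in>carrier G. h (x \<otimes>\<^bsub>G\<^esub> y) = h x + h y}"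

text \<open>Phrasing this through all homomorphisms to the integers avoids a basis, so that
  endomorphisms preserve the set by pullback. In a free group these are the words with all exponent
  sums 0.\<close>

definition chars_ker :: "('a, 'm) monoid_scheme \<Rightarrow> 'a set" where
  "chars_ker G = {x \<in> carrier G. \<forall>h\<in>int_chars G. h x = 0}"

definition chars_mod :: "('a, 'm) monoid_scheme \<Rightarrow> nat \<Rightarrow> 'a set" where
  "chars_mod G q = {x \<in> carrier G. \<forall>h\<in>int_chars G. int q dvd h x}"

definition base_comms :: "('a, 'm) monoid_scheme \<Rightarrow> 'a set" where
  "base_comms G = {commutator G (commutator G t x) t' | t x t'.
     t \<in> chars_ker G \<and> x \<in> carrier G \<and> t' \<in> chars_ker G}"

definition mod_comms :: "('a, 'm) monoid_scheme \<Rightarrow> nat \<Rightarrow> 'a set" where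
  "mod_comms G q = {commutator G m m' | m m'. m \<in> chars_ker G \<and> m' \<in> chars_mod G q}"

definition twisted_comm :: "('a, 'm) monoid_scheme \<Rightarrow> 'a \<Rightarrow> 'a \<Rightarrow> 'a" where
  "twisted_comm G u c = commutator G u (c \<otimes>\<^bsub>G\<^esub> u \<otimes>\<^bsub>G\<^esub> inv\<^bsub>G\<^esub> c)"

definition rel_subgroup :: "('a, 'm) monoid_scheme \<Rightarrow> nat set \<Rightarrow> 'a set" where
  "rel_subgroup G D = generate G {twisted_comm G u c | u c q. q \<in> D \<and> u \<in> base_comms G \<and> c \<in> mod_comms G q}"

lemma (in group) int_chars_one: "h \<in> int_chars G \<Longrightarrow> h \<one> = 0"
  unfolding int_chars_def by (metis (mono_tags, lifting) add_cancel_left_left l_one mem_Collect_eq one_closed)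

lemma (in group) int_chars_inv: "h \<in> int_chars G \<Longrightarrow> x \<in> carrier G \<Longrightarrow> h (inv x) = - h x"
  using int_chars_one[of h] unfolding int_chars_def
  by (metis (mono_tags, lifting) eq_neg_iff_add_eq_0 inv_closed l_inv mem_Collect_eq)

lemma (in group) int_chars_commutator:
  "h \<in> int_chars G \<Longrightarrow> x \<in> carrier G \<Longrightarrow> y \<in> carrier G \<Longrightarrow> h (commutator G x y) = 0"
  using int_chars_inv[of h x] int_chars_inv[of h y]
  by (simp add: commutator_def) (simp add: int_chars_def)

lemma (in group) commutator_chars_ker:
  "x \<in> carrier G \<Longrightarrow> y \<in> carrier G \<Longrightarrow> commutator G x y \<in> chars_ker G"
  by (simp add: chars_ker_def int_chars_commutator)

lemma (in group) twisted_comm_chars_ker: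
  "u \<in> carrier G \<Longrightarrow> c \<in> carrier G \<Longrightarrow> twisted_comm G u c \<in> chars_ker G"
  by (simp add: twisted_comm_def commutator_chars_ker)

lemma (in group) base_comms_closed: "base_comms G \<subseteq> carrier G"
  and mod_comms_closed: "mod_comms G q \<subseteq> carrier G"
  by (auto simp: base_comms_def mod_comms_def chars_ker_def chars_mod_def)

lemma (in group) subgroup_chars_ker: "subgroup (chars_ker G) G"
proof (rule subgroupI)
  fix x y assume xy: "x \<in> chars_ker G" "y \<in> chars_ker G"
  have "h (x \<otimes> y) = 0" if h: "h \<in> int_chars G" for h
  proof -
    have "h x = 0" "h y = 0" "x \<in> carrier G" "y \<in> carrier G"
      using xy h by (simp_all add: chars_ker_def)
    then show ?thesis using h by (simp add: int_chars_def)
  qed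
  then show "x \<otimes> y \<in> chars_ker G" using xy by (simp add: chars_ker_def)
qed (auto simp: chars_ker_def int_chars_inv int_chars_one)

lemma (in group) rel_subgroup_gens:
  "{twisted_comm G u c | u c q. q \<in> D \<and> u \<in> base_comms G \<and> c \<in> mod_comms G q} \<subseteq> chars_ker G"
proof
  fix x assume "x \<in> {twisted_comm G u c | u c q. q \<in> D \<and> u \<in> base_comms G \<and> c \<in> mod_comms G q}"
  then obtain u c q where "x = twisted_comm G u c" "u \<in> base_comms G" "c \<in> mod_comms G q" by blast
  then show "x \<in> chars_ker G"
    using twisted_comm_chars_ker[of u c] base_comms_closed mod_comms_closed by (simp add: subset_iff)
qed

lemma (in group) rel_subgroup_subset: "rel_subgroup G D \<subseteq> chars_ker G"
  unfolding rel_subgroup_def by (rule generate_subgroup_incl[OF rel_subgroup_gens subgroup_chars_ker])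

lemma (in group) subgroup_rel_subgroup: "subgroup (rel_subgroup G D) G"
  unfolding rel_subgroup_def
  by (rule generate_is_subgroup[OF subset_trans[OF rel_subgroup_gens subgroup.subset[OF subgroup_chars_ker]]])

section \<open>The defining relators on the automaton\<close>

context machine
begin

abbreviation F :: "'a letter list monoid" where "F \<equiv> free_group S"

sublocale F: group F by (rule group_free_group)

lemma vpos_mult: "u \<in> carrier F \<Longrightarrow> vpos (u \<otimes>\<^bsub>F\<^esub> v) = vmult (vpos u) (vpos v)"
  unfolding vpos_def[of "u \<otimes>\<^bsub>F\<^esub> v"] by (simp add: vact.fold_mult) (simp add: fold_vstep)

lemma vpos_inv: "u \<in> carrier F \<Longrightarrow> vpos (inv\<^bsub>F\<^esub> u) = vinv (vpos u)"
proof -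
  assume u: "u \<in> carrier F"
  have "vmult (vpos u) (vpos (inv\<^bsub>F\<^esub> u)) = vone"
    unfolding vpos_mult[OF u, symmetric] F.r_inv[OF u] by (simp add: one_free_group vpos_def)
  then have "vmult (vpos u) (vpos (inv\<^bsub>F\<^esub> u)) = vmult (vpos u) (vinv (vpos u))" by (simp only: vmult_vinv)
  then show ?thesis by (simp only: vmult_left_cancel)
qed

lemma vpos_commutator:
  "u \<in> carrier F \<Longrightarrow> v \<in> carrier F \<Longrightarrow> vpos (commutator F u v) =
     vmult (vmult (vmult (vpos u) (vpos v)) (vinv (vpos u))) (vinv (vpos v))"
  by (simp add: commutator_def vpos_mult vpos_inv)

lemma fst_vpos_char: "(\<lambda>w. fst (vpos w)) \<in> int_chars F"
  and fst_snd_vpos_char: "(\<lambda>w. fst (snd (vpos w))) \<in> int_chars F"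
proof -
  have "fst (vmult x y) = fst x + fst y" "fst (snd (vmult x y)) = fst (snd x) + fst (snd y)" for x y
    by (cases x; cases y; simp)+
  then show "(\<lambda>w. fst (vpos w)) \<in> int_chars F" "(\<lambda>w. fst (snd (vpos w))) \<in> int_chars F"
    by (simp_all add: int_chars_def vpos_mult)
qed

lemma chars_ker_vpos:
  assumes "t \<in> chars_ker F"
  obtains k L where "vpos t = (0, 0, k, L)"
proof -
  have "fst (vpos t) = 0" "fst (snd (vpos t)) = 0"
    using assms bspec[OF _ fst_vpos_char] bspec[OF _ fst_snd_vpos_char] by (auto simp: chars_ker_def)
  then show ?thesis using that by (cases "vpos t") auto
qed

text \<open>A letter toggles whole residue classes modulo \<open>q\<close> in row \<open>q\<close>,
  so the rows of reachable configurations are periodic.\<close>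

lemma vpos_periodic: "vpos w = (i, j, k, L) \<Longrightarrow> int q dvd r - r' \<Longrightarrow> (q, r) \<in> L \<longleftrightarrow> (q, r') \<in> L"
proof (induction w arbitrary: i j k L rule: rev_induct)
  case (snoc l w)
  obtain i' j' k' L' where w: "vpos w = (i', j', k', L')" by (metis prod_cases4)
  have "vpos (w @ [l]) = vmult (vpos w) (vgen l)" by (simp add: vpos_def vstep_def)
  then have "L = L' \<or> L = sym_diff L' (lamp i')"
    using snoc.prems(1) unfolding w by (auto simp: vgen_def Let_def split: if_splits)
  moreover have "(q, r) \<in> lamp i' \<longleftrightarrow> (q, r') \<in> lamp i'"
    using dvd_add_left_iff[OF snoc.prems(2), of "i' - r"] by (simp add: lamp_def)
  moreover have "(q, r) \<in> L' \<longleftrightarrow> (q, r') \<in> L'" by (rule snoc.IH[OF w snoc.prems(2)])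
  ultimately show ?case by blast
qed (simp add: vpos_def)

text \<open>A word \<open>t\<close> with exponent sums 0 ends over the centre of the Heisenberg
  group, so \<open>[t, x]\<close> ends at a pure lamp configuration. The second such word
  \<open>t'\<close> does not shift lamps, hence commutes with it.\<close>

lemma base_comms_vpos:
  assumes "u \<in> base_comms F"
  shows "vpos u = vone"
proof -
  obtain t x t' where u: "u = commutator F (commutator F t x) t'"
    and t: "t \<in> chars_ker F" "x \<in> carrier F" "t' \<in> chars_ker F"
    using assms unfolding base_comms_def by blast
  then have c: "t \<in> carrier F" "t' \<in> carrier F" by (auto simp: chars_ker_def)
  obtain k L where "vpos t = (0, 0, k, L)" using chars_ker_vpos t by blast
  moreover obtain i j k'' L'' where "vpos x = (i, j, k'', L'')" by (metis prod_cases4)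
  ultimately obtain M where M: "vpos (commutator F t x) = (0, 0, 0, M)"
    using c t by (simp add: vpos_commutator)
  obtain k' L' where "vpos t' = (0, 0, k', L')" using chars_ker_vpos t by blast
  then show ?thesis unfolding u using c t M by (auto simp: vpos_commutator)
qed

text \<open>As \<open>m\<close> ends over the centre, the commutator is the sum of the lamps of
  \<open>m\<close> and their shift by the first coordinate of \<open>m'\<close>. This coordinate is
  divisible by \<open>q\<close>, so by periodicity the two summands agree in row
  \<open>q\<close>.\<close>

lemma mod_comms_vpos:
  assumes "c \<in> mod_comms F q"
  shows "\<exists>C. vpos c = (0, 0, 0, C) \<and> (\<forall>r. (q, r) \<notin> C)"
proof -
  obtain m m' where c: "c = commutator F m m'" and m: "m \<in> chars_ker F" "m' \<in> chars_mod F q"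
    using assms unfolding mod_comms_def by blast
  have cl: "m \<in> carrier F" "m' \<in> carrier F" using m by (auto simp: chars_ker_def chars_mod_def)
  obtain k L where k: "vpos m = (0, 0, k, L)" using chars_ker_vpos m by blast
  obtain i j k' L' where i: "vpos m' = (i, j, k', L')" by (metis prod_cases4)
  have "int q dvd i"
  proof -
    have "\<forall>h\<in>int_chars F. int q dvd h m'" using m(2) by (simp add: chars_mod_def)
    from bspec[OF this fst_vpos_char] show ?thesis by (simp add: i)
  qed
  then have "(q, r - i) \<in> L \<longleftrightarrow> (q, r) \<in> L" for r
    by (intro vpos_periodic[OF k]) simp
  then have "(q, r) \<notin> sym_diff L (shift i L)" for r by (simp add: shift_def)
  moreover have "vpos c = (0, 0, 0, sym_diff L (shift i L))"
    unfolding c vpos_commutator[OF cl] k i by auto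
  ultimately show ?thesis by blast
qed

lemma fold_step_mult: "u \<in> carrier F \<Longrightarrow> fold step (u \<otimes>\<^bsub>F\<^esub> v) s = fold step v (fold step u s)"
  by (simp add: sact.fold_mult)

lemma labels_mult:
  assumes "u \<in> carrier F"
  shows "labels p (u \<otimes>\<^bsub>F\<^esub> v) = sym_diff (labels p u) (labels (vmult p (vpos u)) v)"
proof -
  have "fold step (u \<otimes>\<^bsub>F\<^esub> v) (p, {}, False) = fold step v (fold step u (p, {}, False))"
    by (rule fold_step_mult[OF assms])
  then show ?thesis by (simp add: fold_step)
qed

lemma labels_Nil: "labels p [] = {}"
  by (simp add: labels_def)

text \<open>As \<open>u\<close> is a closed path, \<open>c\<close> and its inverse run along the
  same edges, and their labels cancel.\<close>

lemma labels_conj: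
  assumes "u \<in> carrier F" "c \<in> carrier F" "vpos u = vone"
  shows "labels p (c \<otimes>\<^bsub>F\<^esub> u \<otimes>\<^bsub>F\<^esub> inv\<^bsub>F\<^esub> c) = labels (vmult p (vpos c)) u"
proof -
  have "labels p (c \<otimes>\<^bsub>F\<^esub> inv\<^bsub>F\<^esub> c) = {}"
    using assms(2) by (simp add: one_free_group labels_Nil)
  then have "labels p c = labels (vmult p (vpos c)) (inv\<^bsub>F\<^esub> c)"
    unfolding labels_mult[OF assms(2)] by blast
  moreover have "labels p (c \<otimes>\<^bsub>F\<^esub> u \<otimes>\<^bsub>F\<^esub> inv\<^bsub>F\<^esub> c) =
    sym_diff (sym_diff (labels p c) (labels (vmult p (vpos c)) u)) (labels (vmult p (vpos c)) (inv\<^bsub>F\<^esub> c))"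
    using assms by (simp only: labels_mult F.m_closed vpos_mult vmult_vone)
  ultimately show ?thesis by blast
qed

lemma fold_step_loop:
  assumes "vpos u = vone"
  shows "fold step u (vone, X, c) = (vone, sym_diff X (labels vone u), c \<noteq> (form X (labels vone u) \<noteq> ebit vone u))"
  using fold_step[of vone u X c] by (simp only: assms vmult_vone)

lemma fold_step_inv_loop:
  assumes "u \<in> carrier F" "vpos u = vone"
  shows "fold step (inv\<^bsub>F\<^esub> u) (vone, X, c) = (vone, sym_diff X (labels vone u),
    c \<noteq> (form (sym_diff X (labels vone u)) (labels vone u) \<noteq> ebit vone u))"
proof -
  let ?X = "sym_diff X (labels vone u)"
  let ?c = "c \<noteq> (form ?X (labels vone u) \<noteq> ebit vone u)"
  have X: "sym_diff ?X (labels vone u) = X" by blast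
  have c: "?c \<noteq> (form ?X (labels vone u) \<noteq> ebit vone u) \<longleftrightarrow> c" by blast
  have "fold step u (vone, ?X, ?c) = (vone, X, c)"
    unfolding fold_step_loop[OF assms(2)] X c ..
  then show ?thesis using sact.fold_inv[OF assms(1), of "(vone, ?X, ?c)"] by simp
qed

text \<open>The central bits of \<open>u\<close> and \<open>v\<close> each enter twice and cancel,
  which leaves the antisymmetrization of \<open>form\<close>.\<close>

lemma fold_step_commutator:
  assumes "u \<in> carrier F" "v \<in> carrier F" "vpos u = vone" "vpos v = vone"
  shows "fold step (commutator F u v) (vone, {}, c) =
    (vone, {}, c \<noteq> (form (labels vone u) (labels vone v) \<noteq> form (labels vone v) (labels vone u)))"
proof -
  let ?U = "labels vone u" and ?V = "labels vone v"
  have s: "sym_diff {} X = X" "sym_diff X X = {}" "sym_diff (sym_diff Y X) Y = X" for X Y :: "(nat \<times> int) set set"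
    by blast+
  have f: "form {} X \<longleftrightarrow> False" for X by (simp add: form_def)
  show ?thesis
    unfolding sact.fold_commutator[OF assms(1,2) UNIV_I] fold_step_loop[OF assms(3)] fold_step_loop[OF assms(4)]
      fold_step_inv_loop[OF assms(1,3)] fold_step_inv_loop[OF assms(2,4)] s f
    by auto
qed

lemma fold_step_twisted:
  assumes "u \<in> carrier F" "c \<in> carrier F" "vpos u = vone" "vpos c = (0, 0, 0, C)"
  shows "fold step (twisted_comm F u c) (vone, {}, \<beta>) =
    (vone, {}, \<beta> \<noteq> (C = g \<and> odd (card (labels vone u))))"
proof -
  let ?v = "c \<otimes>\<^bsub>F\<^esub> u \<otimes>\<^bsub>F\<^esub> inv\<^bsub>F\<^esub> c"
  have v: "?v \<in> carrier F" using assms by simp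
  have p: "vpos ?v = vone" using assms by (simp add: vpos_mult vpos_inv)
  have l: "labels vone ?v = (\<lambda>L. sym_diff C L) ` labels vone u"
    using labels_conj[OF assms(1-3), of vone] labels_translate[of C vone u]
    by (simp only: assms(4) vmult_vone)
  show ?thesis
    unfolding twisted_comm_def fold_step_commutator[OF assms(1) v assms(3) p] form_swap[OF finite_labels finite_labels]
    unfolding l odd_card_translate[OF finite_labels] ..
qed

definition vbit :: "'a letter list \<Rightarrow> bool" where
  "vbit w = snd (snd (fold step w (vone, {}, False)))"

end

lemma (in group_hom) hom_commutator:
  "x \<in> carrier G \<Longrightarrow> y \<in> carrier G \<Longrightarrow> h (commutator G x y) = commutator H (h x) (h y)"
  by (simp add: commutator_def)

text \<open>Homomorphisms to the integers pull back along \<open>f\<close>, so \<open>f\<close>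
  preserves every set from which the arguments of the commutators are taken, and therefore the set
  of generators.\<close>

lemma rel_subgroup_hom:
  assumes "group G" "f \<in> hom G G"
  shows "f ` rel_subgroup G D \<subseteq> rel_subgroup G D"
proof -
  interpret group_hom G G f
    using assms by (simp add: group_hom_def group_hom_axioms_def)
  have ch: "(\<lambda>x. k (f x)) \<in> int_chars G" if "k \<in> int_chars G" for k
    using that by (simp add: int_chars_def)
  have ker: "f x \<in> chars_ker G" if "x \<in> chars_ker G" for x
  proof -
    have "k (f x) = 0" if k: "k \<in> int_chars G" for k
      using bspec[OF _ ch[OF k], of "\<lambda>h. h x = 0"] \<open>x \<in> chars_ker G\<close> by (simp add: chars_ker_def)
    then show ?thesis using that by (simp add: chars_ker_def)
  qed
  have md: "f x \<in> chars_mod G q" if "x \<in> chars_mod G q" for x q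
  proof -
    have "int q dvd k (f x)" if k: "k \<in> int_chars G" for k
      using bspec[OF _ ch[OF k], of "\<lambda>h. int q dvd h x"] \<open>x \<in> chars_mod G q\<close> by (simp add: chars_mod_def)
    then show ?thesis using that by (simp add: chars_mod_def)
  qed
  have cl: "x \<in> carrier G" if "x \<in> chars_ker G" for x using that by (simp add: chars_ker_def)
  have cl': "x \<in> carrier G" if "x \<in> chars_mod G q" for x q using that by (simp add: chars_mod_def)
  have base: "f u \<in> base_comms G" if u: "u \<in> base_comms G" for u
  proof -
    obtain t x t' where u: "u = commutator G (commutator G t x) t'"
      and t: "t \<in> chars_ker G" "x \<in> carrier G" "t' \<in> chars_ker G"
      using u unfolding base_comms_def by blast
    note [simp] = t(2) cl[OF t(1)] cl[OF t(3)]
    have "f u = commutator G (commutator G (f t) (f x)) (f t')"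
      unfolding u by (simp add: hom_commutator)
    moreover have "f x \<in> carrier G" by simp
    ultimately show ?thesis unfolding base_comms_def using ker t by blast
  qed
  have mod: "f c \<in> mod_comms G q" if c: "c \<in> mod_comms G q" for c q
  proof -
    obtain m m' where c: "c = commutator G m m'" and m: "m \<in> chars_ker G" "m' \<in> chars_mod G q"
      using c unfolding mod_comms_def by blast
    have "f c = commutator G (f m) (f m')"
      unfolding c by (rule hom_commutator[OF cl[OF m(1)] cl'[OF m(2)]])
    then show ?thesis unfolding mod_comms_def using ker md m by blast
  qed
  let ?A = "{twisted_comm G u c | u c q. q \<in> D \<and> u \<in> base_comms G \<and> c \<in> mod_comms G q}"
  have "f ` ?A \<subseteq> ?A"
  proof
    fix y assume "y \<in> f ` ?A"
    then obtain u c q where y: "y = f (twisted_comm G u c)" and *: "q \<in> D" "u \<in> base_comms G" "c \<in> mod_comms G q"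
      by blast
    then have [simp]: "u \<in> carrier G" "c \<in> carrier G"
      using base_comms_closed mod_comms_closed by blast+
    have "y = twisted_comm G (f u) (f c)" unfolding y by (simp add: twisted_comm_def hom_commutator)
    then show "y \<in> ?A" using * base mod by blast
  qed
  moreover have "?A \<subseteq> carrier G"
    using rel_subgroup_gens[of D] cl by blast
  ultimately show ?thesis
    unfolding rel_subgroup_def by (simp add: generate_img[symmetric] mono_generate)
qed

text \<open>The configuration reached by \<open>[[a, b], a^n]\<close>, see
  \<open>vpos_mod_word\<close>.\<close>

definition lamp_pattern :: "nat \<Rightarrow> (nat \<times> int) set" where
  "lamp_pattern n = sym_diff (sym_diff (lamp 0) (lamp 1)) (sym_diff (lamp (int n)) (lamp (int n + 1)))"

text \<open>If row \<open>q\<close> were dark at the positions 0 and 1, then \<open>q\<close> would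
  divide both \<open>n + 1\<close> and \<open>n - 1\<close>, hence 2.\<close>

lemma lamp_pattern_neq:
  assumes "prime q" "odd q" "prime n" "q \<noteq> n"
  shows "\<exists>r. (q, r) \<in> lamp_pattern n"
proof -
  have q: "q \<noteq> 1" "\<not> q dvd n" using assms primes_dvd_imp_eq by auto
  then have 1: "\<not> int q dvd 1" "\<not> int q dvd int n" by auto
  have "\<not> int q dvd 2"
  proof
    assume "int q dvd 2"
    then have "int q dvd int 2" by simp
    then have "q dvd 2" by (simp only: int_dvd_int_iff)
    then have "q = 2" using q(1) by (meson assms(1) primes_dvd_imp_eq two_is_prime_nat)
    then show False using assms by simp
  qed
  moreover have "(int n + 1) - (int n - 1) = 2" by simp
  ultimately have "\<not> (int q dvd int n + 1 \<and> int q dvd int n - 1)" by (metis dvd_diff)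
  then have "(q, 0) \<in> lamp_pattern n \<or> (q, 1) \<in> lamp_pattern n"
    using 1 by (auto simp: lamp_pattern_def lamp_def)
  then show ?thesis by blast
qed

context machine
begin

text \<open>A twisted commutator affects only the central bit and flips it or not regardless of its
  initial value; inverses and products inherit this. If \<open>g\<close> has a lit lamp in row
  \<open>q\<close> for every \<open>q \<in> D\<close>, then no word in \<open>mod_comms F q\<close>
  has the configuration \<open>g\<close>, because its row \<open>q\<close> is empty.\<close>

lemma rel_subgroup_step:
  assumes "w \<in> rel_subgroup F D"
  shows "fold step w (vone, {}, \<beta>) = (vone, {}, \<beta> \<noteq> vbit w)"
    and "(\<And>q. q \<in> D \<Longrightarrow> \<exists>r. (q, r) \<in> g) \<Longrightarrow> \<not> vbit w"
proof -
  let ?P = "\<lambda>w. \<exists>b. (\<forall>\<beta>. fold step w (vone, {}, \<beta>) = (vone, {}, \<beta> \<noteq> b)) \<and> ((\<forall>q\<in>D. \<exists>r. (q, r) \<in> g) \<longrightarrow> \<not> b)"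
  let ?A = "{twisted_comm F u c | u c q. q \<in> D \<and> u \<in> base_comms F \<and> c \<in> mod_comms F q}"
  have cl: "w \<in> carrier F" if "w \<in> generate F ?A" for w
    using F.generate_in_carrier that F.rel_subgroup_gens[of D] by (auto simp: chars_ker_def)
  have gen: "?P w" if wA: "w \<in> ?A" for w
  proof -
    obtain u c q where w: "w = twisted_comm F u c" "q \<in> D" "u \<in> base_comms F" "c \<in> mod_comms F q"
      using wA by blast
    have uc: "u \<in> carrier F" "c \<in> carrier F"
      using w F.base_comms_closed F.mod_comms_closed by blast+
    obtain C where C: "vpos c = (0, 0, 0, C)" "\<forall>r. (q, r) \<notin> C"
      using mod_comms_vpos[OF w(4)] by blast
    have "\<not> (C = g \<and> odd (card (labels vone u)))" if "\<forall>q\<in>D. \<exists>r. (q, r) \<in> g"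
      using bspec[OF that w(2)] C(2) by auto
    then show ?thesis
      unfolding w(1) using fold_step_twisted[OF uc base_comms_vpos[OF w(3)] C(1)] by (intro exI conjI allI impI)
  qed
  have inv: "?P (inv\<^bsub>F\<^esub> w)" if "?P w" "w \<in> carrier F" for w
  proof -
    obtain b where b: "\<And>\<beta>. fold step w (vone, {}, \<beta>) = (vone, {}, \<beta> \<noteq> b)"
      "(\<forall>q\<in>D. \<exists>r. (q, r) \<in> g) \<longrightarrow> \<not> b" using \<open>?P w\<close> by blast
    have "fold step (inv\<^bsub>F\<^esub> w) (vone, {}, \<beta>) = (vone, {}, \<beta> \<noteq> b)" for \<beta>
    proof -
      have "(\<beta> \<noteq> b) \<noteq> b \<longleftrightarrow> \<beta>" by blast
      then have "fold step w (vone, {}, \<beta> \<noteq> b) = (vone, {}, \<beta>)" using b(1)[of "\<beta> \<noteq> b"] by simp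
      then show ?thesis using sact.fold_inv[OF that(2), of "(vone, {}, \<beta> \<noteq> b)"] by simp
    qed
    then show ?thesis using b(2) by blast
  qed
  have "?P w" using assms unfolding rel_subgroup_def
  proof (induction rule: generate.induct)
    case one
    then show ?case by (intro exI[of _ False]) (simp add: one_free_group)
  next
    case (incl h)
    then show ?case by (rule gen)
  next
    case (inv h)
    then show ?case by (intro \<open>\<And>w. ?P w \<Longrightarrow> w \<in> carrier F \<Longrightarrow> ?P (inv\<^bsub>F\<^esub> w)\<close> gen cl generate.incl)
  next
    case (eng h1 h2)
    then obtain b1 b2 where "\<And>\<beta>. fold step h1 (vone, {}, \<beta>) = (vone, {}, \<beta> \<noteq> b1)"
      "(\<forall>q\<in>D. \<exists>r. (q, r) \<in> g) \<longrightarrow> \<not> b1" "\<And>\<beta>. fold step h2 (vone, {}, \<beta>) = (vone, {}, \<beta> \<noteq> b2)"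
      "(\<forall>q\<in>D. \<exists>r. (q, r) \<in> g) \<longrightarrow> \<not> b2" by blast
    then show ?case
      by (intro exI[of _ "b1 \<noteq> b2"]) (auto simp: fold_step_mult[OF cl[OF eng(1)]])
  qed
  then obtain b where b: "\<And>\<beta>. fold step w (vone, {}, \<beta>) = (vone, {}, \<beta> \<noteq> b)"
    "(\<forall>q\<in>D. \<exists>r. (q, r) \<in> g) \<longrightarrow> \<not> b" by blast
  then have "vbit w \<longleftrightarrow> b" by (simp add: vbit_def)
  then show "fold step w (vone, {}, \<beta>) = (vone, {}, \<beta> \<noteq> vbit w)"
    "(\<And>q. q \<in> D \<Longrightarrow> \<exists>r. (q, r) \<in> g) \<Longrightarrow> \<not> vbit w"
    using b by blast+
qed

lemma vbit_mult:
  assumes "u \<in> rel_subgroup F D" "v \<in> rel_subgroup F D"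
  shows "vbit (u \<otimes>\<^bsub>F\<^esub> v) \<longleftrightarrow> vbit u \<noteq> vbit v"
proof -
  have "u \<in> carrier F" using assms F.rel_subgroup_subset by (auto simp: chars_ker_def)
  from fold_step_mult[OF this, of v "(vone, {}, False)"] show ?thesis
    unfolding rel_subgroup_step(1)[OF assms(1)] rel_subgroup_step(1)[OF assms(2)]
    by (simp add: vbit_def)
qed

text \<open>Changing the initial lamps translates the labels without changing their number, so the
  parity can be computed from the Heisenberg coordinates alone.\<close>

definition crossing :: "int \<Rightarrow> int \<Rightarrow> int \<Rightarrow> 'a letter list \<Rightarrow> bool" where
  "crossing i j k w \<longleftrightarrow> odd (card (labels (i, j, k, {}) w))"

lemma crossing_eq: "odd (card (labels (i, j, k, L) w)) \<longleftrightarrow> crossing i j k w"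
proof -
  have "inj (\<lambda>M. sym_diff L M)" by (rule injI) blast
  then have "card ((\<lambda>M. sym_diff L M) ` labels (i, j, k, {}) w) = card (labels (i, j, k, {}) w)"
    by (rule card_image[OF inj_on_subset[OF _ subset_UNIV]])
  moreover have "vmult (0, 0, 0, L) (i, j, k, {}) = (i, j, k, L)" by simp
  ultimately show ?thesis unfolding crossing_def using labels_translate[of L "(i, j, k, {})" w] by metis
qed

lemma labels_Cons: "labels p (l # w) = sym_diff (set_option (label p l)) (labels (vstep l p) w)"
proof -
  have "fold step (l # w) (p, {}, False) = fold step w (vstep l p, emult (label p l) ({}, False))"
    by (simp add: step_pair)
  then show ?thesis
    unfolding labels_def[of p "l # w"] by (cases "label p l") (simp_all add: fold_step)
qed

lemma crossing_Nil: "\<not> crossing i j k []"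
  by (simp add: crossing_def labels_Nil)

text \<open>The inverse of \<open>b\<close> crosses the edge that starts at its target, which turns
  the test \<open>j = 0\<close> into \<open>j = 1\<close>.\<close>

lemma crossing_Cons:
  "crossing i j k ((a, e) # w) \<longleftrightarrow> crossing (if e then i + 1 else i - 1) j k w"
  "crossing i j k ((b, True) # w) \<longleftrightarrow> (i = 0 \<and> j = 0 \<and> k = 0) \<noteq> crossing i (j + 1) (k + i) w"
  "crossing i j k ((b, False) # w) \<longleftrightarrow> (i = 0 \<and> j = 1 \<and> k = 0) \<noteq> crossing i (j - 1) (k - i) w"
proof -
  have fin: "finite (set_option x)" for x :: "(nat \<times> int) set option" by simp
  show "crossing i j k ((a, e) # w) \<longleftrightarrow> crossing (if e then i + 1 else i - 1) j k w"
    using ab unfolding crossing_def[of i j k] labels_Cons odd_card_sym_diff[OF fin finite_labels]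
    by (auto simp: label_def vstep_def vgen_def Let_def crossing_eq)
  show "crossing i j k ((b, True) # w) \<longleftrightarrow> (i = 0 \<and> j = 0 \<and> k = 0) \<noteq> crossing i (j + 1) (k + i) w"
    using ab unfolding crossing_def[of i j k] labels_Cons odd_card_sym_diff[OF fin finite_labels]
    by (auto simp: label_def vstep_def vgen_def Let_def crossing_eq)
  show "crossing i j k ((b, False) # w) \<longleftrightarrow> (i = 0 \<and> j = 1 \<and> k = 0) \<noteq> crossing i (j - 1) (k - i) w"
    using ab unfolding crossing_def[of i j k] labels_Cons odd_card_sym_diff[OF fin finite_labels]
    by (auto simp: label_def vstep_def vgen_def Let_def crossing_eq)
qed

section \<open>Explicit words with a nontrivial central bit\<close>

abbreviation "ga \<equiv> [(a, True)]"
abbreviation "gb \<equiv> [(b, True)]"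

text \<open>Exactly one edge on the path of \<open>[[a, b], a]\<close> belongs to \<open>b\<close> and starts in the centre of the
  Heisenberg group; conjugation by \<open>[b, a]\<close> moves it to the labelled edge at the origin.\<close>

definition base_word :: "'a letter list" where
  "base_word = commutator F (commutator F (commutator F ga gb) ga) (commutator F gb ga)"

definition mod_word :: "nat \<Rightarrow> 'a letter list" where
  "mod_word n = commutator F (commutator F ga gb) (replicate n (a, True))"

lemma gen_closed: "ga \<in> carrier F" "gb \<in> carrier F"
  using ab by (simp_all add: carrier_free_group)

lemma replicate_closed: "replicate n (a, True) \<in> carrier F"
proof -
  have "reduced (replicate n (a, True))"
  proof (induction n)
    case (Suc n)
    then show ?case by (cases n) (auto simp: inv_letter_def)
  qed simp
  then show ?thesis using ab by (auto simp: carrier_free_group)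
qed

lemma replicate_Suc_mult: "replicate (Suc n) (a, True) = ga \<otimes>\<^bsub>F\<^esub> replicate n (a, True)"
  by (cases n) (auto simp: mult_free_group inv_letter_def)

lemma base_word_in: "base_word \<in> base_comms F"
  using gen_closed F.commutator_chars_ker unfolding base_comms_def base_word_def by blast

lemma int_chars_replicate: "h \<in> int_chars F \<Longrightarrow> h (replicate n (a, True)) = int n * h ga"
proof (induction n)
  case 0
  then show ?case using F.int_chars_one by (simp add: one_free_group)
next
  case (Suc n)
  then have "h (replicate (Suc n) (a, True)) = h ga + h (replicate n (a, True))"
    unfolding replicate_Suc_mult using gen_closed replicate_closed by (simp add: int_chars_def)
  then show ?case using Suc by (simp add: algebra_simps)
qed

lemma mod_word_in: "mod_word n \<in> mod_comms F n"
proof -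
  have "replicate n (a, True) \<in> chars_mod F n"
    using replicate_closed by (simp add: chars_mod_def int_chars_replicate)
  then show ?thesis
    using gen_closed F.commutator_chars_ker unfolding mod_comms_def mod_word_def by blast
qed

lemma vpos_gen: "vpos ga = (1, 0, 0, {})" "vpos gb = (0, 1, 0, lamp 0)" "vpos (replicate n (a, True)) = (int n, 0, 0, {})"
proof -
  show 1: "vpos ga = (1, 0, 0, {})" "vpos gb = (0, 1, 0, lamp 0)"
    using ab by (auto simp: vpos_def vstep_def vgen_def)
  show "vpos (replicate n (a, True)) = (int n, 0, 0, {})"
    by (induction n) (simp_all add: replicate_Suc_mult vpos_mult gen_closed 1 vpos_def[of "[]"] del: replicate_Suc)
qed

lemma vpos_mod_word: "vpos (mod_word n) = (0, 0, 0, lamp_pattern n)"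
proof -
  have "vpos (commutator F ga gb) = (0, 0, 1, sym_diff (lamp 1) (lamp 0))"
    using gen_closed by (simp add: vpos_commutator vpos_gen)
  then show ?thesis
    using gen_closed replicate_closed unfolding mod_word_def
    by (simp add: vpos_commutator vpos_gen lamp_pattern_def) (blast | auto)
qed

lemma odd_labels_base_word: "odd (card (labels vone base_word))"
proof -
  have "base_word = [(a, True), (b, True), (a, False), (b, False), (a, True), (b, True), (a, True),
     (b, False), (a, False), (a, False), (b, True), (a, True), (b, False), (a, True), (b, True),
     (a, False), (b, False), (a, False)]"
    using ab gen_closed
    by (simp add: base_word_def commutator_def inv_free_group mult_free_group carrier_free_group inv_letter_def)
  then show ?thesis unfolding crossing_eq by (simp add: crossing_Cons crossing_Nil)
qed

lemma vbit_twisted: "vbit (twisted_comm F base_word (mod_word n)) \<longleftrightarrow> g = lamp_pattern n"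
proof -
  have "base_word \<in> carrier F" "mod_word n \<in> carrier F"
    using base_word_in mod_word_in F.base_comms_closed F.mod_comms_closed by blast+
  note fold_step_twisted[OF this base_comms_vpos[OF base_word_in] vpos_mod_word]
  then show ?thesis using odd_labels_base_word by (auto simp: vbit_def)
qed

lemma twisted_in_rel: "n \<in> D \<Longrightarrow> twisted_comm F base_word (mod_word n) \<in> rel_subgroup F D"
  unfolding rel_subgroup_def using base_word_in mod_word_in by (intro generate.incl) blast

end

section \<open>Measures on the space of subgroups\<close>

definition supergroups :: "('a, 'm) monoid_scheme \<Rightarrow> 'a set \<Rightarrow> 'a set set" where
  "supergroups G A = {H. subgroup H G \<and> A \<subseteq> H}"

lemma supergroups_Un: "supergroups G A \<inter> supergroups G B = supergroups G (A \<union> B)"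
  by (auto simp: supergroups_def)

lemma openin_supergroups_singleton:
  assumes "g \<in> carrier G"
  shows "openin (Sub G) (supergroups G {g})"
proof -
  have "openin (Sub G) {H \<in> topspace (Sub G). (g \<in> H) \<in> {True}}"
    by (rule openin_continuous_map_preimage[OF continuous_map_Sub_membership[OF assms]]) simp
  then show ?thesis by (simp add: supergroups_def)
qed

abbreviation supergroup_sets :: "('a, 'm) monoid_scheme \<Rightarrow> 'a set set set" where
  "supergroup_sets G \<equiv> {supergroups G A | A. finite A \<and> A \<subseteq> carrier G}"

lemma Int_stable_supergroup_sets: "Int_stable (supergroup_sets G)"
  unfolding Int_stable_def using supergroups_Un by (smt (verit) Un_least finite_UnI mem_Collect_eq)

lemma supergroup_sets_Pow: "supergroup_sets G \<subseteq> Pow {H. subgroup H G}"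
  by (auto simp: supergroups_def)

lemma supergroups_in_sets:
  assumes "finite A" "A \<subseteq> carrier G"
  shows "supergroups G A \<in> sets (borel_of (Sub G))"
  using assms
proof (induction A)
  case empty
  have "supergroups G {} = space (borel_of (Sub G))" by (simp add: supergroups_def)
  then show ?case by (simp only: sets.top)
next
  case (insert g A)
  have "supergroups G {g} \<in> sets (borel_of (Sub G))"
    using openin_supergroups_singleton[of g G] insert unfolding sets_borel_of by (auto intro: sigma_sets.Basic)
  then show ?case using insert supergroups_Un[of G "{g}" A] by (metis insert_is_Un insert_subset sets.Int)
qed

text \<open>An open set is a union of cylinders that prescribe finitely many memberships and
  non-memberships. There are only countably many cylinders, and each arises from sets
  \<open>supergroups G A\<close> by differences.\<close>

lemma sets_borel_Sub:
  assumes count: "countable (carrier G)"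
  shows "sets (borel_of (Sub G)) = sigma_sets {H. subgroup H G} (supergroup_sets G)"
proof (rule antisym)
  let ?\<Omega> = "{H. subgroup H G}"
  let ?S = "sigma_sets ?\<Omega> (supergroup_sets G)"
  let ?P = "product_topology (\<lambda>_. discrete_topology (UNIV :: bool set)) (carrier G)"
  interpret sigma_algebra ?\<Omega> ?S by (rule sigma_algebra_sigma_sets[OF supergroup_sets_Pow])
  define cyl where "cyl A B = {H. subgroup H G \<and> A \<subseteq> H \<and> B \<inter> H = {}}" for A B
  have cyl: "cyl A B \<in> ?S" if "finite A" "A \<subseteq> carrier G" "finite B" "B \<subseteq> carrier G" for A B
    using that(3,4)
  proof (induction B)
    case empty
    have "cyl A {} = supergroups G A" by (auto simp: cyl_def supergroups_def)
    then show ?case using that by (auto intro: sigma_sets.Basic)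
  next
    case (insert b B)
    have "supergroups G {b} \<in> ?S" using insert by (intro sigma_sets.Basic) auto
    moreover have "cyl A (insert b B) = cyl A B - supergroups G {b}" by (auto simp: cyl_def supergroups_def)
    ultimately show ?case using insert by (simp add: Diff)
  qed
  have op: "U \<in> ?S" if "openin (Sub G) U" for U
  proof -
    obtain V where V: "openin ?P V" and U: "U = (\<lambda>H. \<lambda>g\<in>carrier G. g \<in> H) -` V \<inter> ?\<Omega>"
      using \<open>openin (Sub G) U\<close> unfolding Sub_def openin_pullback_topology by blast
    define I where "I = {(A, B). finite A \<and> A \<subseteq> carrier G \<and> finite B \<and> B \<subseteq> carrier G \<and> cyl A B \<subseteq> U}"
    have "countable {A. finite A \<and> A \<subseteq> carrier G}" using count by (rule countable_Collect_finite_subset)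
    then have "countable ({A. finite A \<and> A \<subseteq> carrier G} \<times> {A. finite A \<and> A \<subseteq> carrier G})" by blast
    then have "countable I" by (rule countable_subset[rotated]) (auto simp: I_def)
    moreover have "U = (\<Union>(A, B)\<in>I. cyl A B)"
    proof (intro equalityI subsetI)
      fix H assume H: "H \<in> U"
      let ?x = "\<lambda>g\<in>carrier G. g \<in> H"
      have "?x \<in> V" and sub: "subgroup H G" using H U by auto
      then obtain W where W: "finite {g \<in> carrier G. W g \<noteq> topspace (discrete_topology (UNIV :: bool set))}"
        "?x \<in> Pi\<^sub>E (carrier G) W" "Pi\<^sub>E (carrier G) W \<subseteq> V"
        using V unfolding openin_product_topology_alt by blast
      \<comment> \<open>Only the finitely many coordinates that the box \<open>W\<close> restricts
        have to be prescribed.\<close>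
      define J where "J = {g \<in> carrier G. W g \<noteq> UNIV}"
      have J: "finite J" "J \<subseteq> carrier G" using W(1) by (auto simp: J_def)
      have "cyl (J \<inter> H) (J - H) \<subseteq> U"
      proof
        fix K assume K: "K \<in> cyl (J \<inter> H) (J - H)"
        have "(\<lambda>g\<in>carrier G. g \<in> K) \<in> Pi\<^sub>E (carrier G) W"
        proof (rule PiE_I)
          fix g assume g: "g \<in> carrier G"
          show "(\<lambda>g\<in>carrier G. g \<in> K) g \<in> W g"
          proof (cases "g \<in> J")
            case True
            then have "(g \<in> K) = (g \<in> H)" using K by (auto simp: cyl_def)
            moreover have "(g \<in> H) \<in> W g" using PiE_mem[OF W(2) g] g by simp
            ultimately show ?thesis using g by simp
          next
            case False
            then show ?thesis using g by (simp add: J_def)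
          qed
        qed auto
        then have "(\<lambda>g\<in>carrier G. g \<in> K) \<in> V" using W(3) by blast
        then show "K \<in> U" unfolding U using K by (simp add: cyl_def)
      qed
      then have "(J \<inter> H, J - H) \<in> I" using J by (auto simp: I_def)
      moreover have "H \<in> cyl (J \<inter> H) (J - H)" using sub by (auto simp: cyl_def)
      ultimately show "H \<in> (\<Union>(A, B)\<in>I. cyl A B)" by blast
    qed (auto simp: I_def)
    moreover have "(\<Union>(A, B)\<in>I. cyl A B) \<in> ?S"
    proof (rule countable_UN'')
      show "(case p of (A, B) \<Rightarrow> cyl A B) \<in> ?S" if "p \<in> I" for p
        using that cyl[of "fst p" "snd p"] by (cases p) (simp add: I_def)
    qed fact
    ultimately show ?thesis by simp
  qed
  show "sets (borel_of (Sub G)) \<subseteq> ?S"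
    unfolding sets_borel_of topspace_Sub using op by (intro sigma_sets_subset) auto
  show "?S \<subseteq> sets (borel_of (Sub G))"
  proof -
    have "sigma_sets (space (borel_of (Sub G))) (supergroup_sets G) \<subseteq> sets (borel_of (Sub G))"
      using supergroups_in_sets by (intro sets.sigma_sets_subset) blast
    then show ?thesis by simp
  qed
qed

lemma measure_Sub_eqI:
  assumes count: "countable (carrier G)" and "prob_space \<mu>"
    and \<mu>: "sets \<mu> = sets (borel_of (Sub G))" and \<nu>: "sets \<nu> = sets (borel_of (Sub G))"
    and eq: "\<And>A. finite A \<Longrightarrow> A \<subseteq> carrier G \<Longrightarrow> emeasure \<mu> (supergroups G A) = emeasure \<nu> (supergroups G A)"
  shows "\<mu> = \<nu>"
proof -
  interpret prob_space \<mu> by fact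
  have "emeasure \<mu> X = emeasure \<nu> X" if "X \<in> supergroup_sets G" for X
    using eq that by blast
  note 1 = measure_eqI_generator_eq[OF Int_stable_supergroup_sets supergroup_sets_Pow this
      \<mu>[unfolded sets_borel_Sub[OF count]] \<nu>[unfolded sets_borel_Sub[OF count]],
      where A = "\<lambda>_. supergroups G {}"]
  show ?thesis
  proof (rule 1)
    show "range (\<lambda>_ :: nat. supergroups G {}) \<subseteq> supergroup_sets G" by blast
    show "(\<Union>i :: nat. supergroups G {}) = {H. subgroup H G}" by (simp add: supergroups_def)
  qed simp_all
qed

section \<open>Fourier analysis on kernels of characters\<close>

definition chi :: "'a \<Rightarrow> 'a set \<Rightarrow> complex" where
  "chi n H = (if n \<in> H then 1 else - 1)"

text \<open>By \<open>AE_char\<close> a random subgroup \<open>H\<close> is almost surely the kernel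
  of a homomorphism from \<open>N\<close> to Z/2; the corresponding character is
  \<open>\<lambda>n. chi n H\<close>.\<close>

locale character_measure = group G for G :: "('a, 'm) monoid_scheme" (structure) +
  fixes N :: "'a set" and \<mu> :: "'a set measure"
  assumes count: "countable (carrier G)"
    and prob: "prob_space \<mu>"
    and sets_mu: "sets \<mu> = sets (borel_of (Sub G))"
    and sub: "subgroup N G"
    and AE_char: "AE H in \<mu>. H \<subseteq> N \<and> (\<forall>n\<in>N. \<forall>m\<in>N. chi (n \<otimes> m) H = chi n H * chi m H)"
begin

sublocale prob_space \<mu> by (rule prob)

lemma space_mu: "space \<mu> = {H. subgroup H G}"
  using sets_eq_imp_space_eq[OF sets_mu] by simp

lemma N_closed: "n \<in> N \<Longrightarrow> n \<in> carrier G"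
  using subgroup.subset[OF sub] by blast

lemma supergroups_sets: "finite A \<Longrightarrow> A \<subseteq> carrier G \<Longrightarrow> supergroups G A \<in> sets \<mu>"
  unfolding sets_mu by (rule supergroups_in_sets)

lemma chi_measurable [measurable]:
  assumes "n \<in> carrier G"
  shows "chi n \<in> borel_measurable \<mu>"
proof -
  have "(\<lambda>H. if H \<in> supergroups G {n} then 1 else - 1 :: complex) \<in> borel_measurable \<mu>"
    using supergroups_sets[of "{n}"] assms by (intro measurable_If_set) auto
  then show ?thesis
    by (rule measurable_cong[THEN iffD1, rotated]) (auto simp: chi_def space_mu supergroups_def)
qed

lemma integrable_mult_chi:
  assumes "integrable \<mu> f" "n \<in> carrier G"
  shows "integrable \<mu> (\<lambda>H. f H * chi n H)"
proof (rule Bochner_Integration.integrable_bound[OF assms(1)])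
  show "(\<lambda>H. f H * chi n H) \<in> borel_measurable \<mu>"
    using assms chi_measurable by (intro borel_measurable_times) auto
qed (auto simp: chi_def norm_mult)

lemma integrable_mult_indicator':
  assumes "integrable \<mu> f" "X \<in> sets \<mu>"
  shows "integrable \<mu> (\<lambda>H. f H * indicator X H :: complex)"
  using integrable_mult_indicator[OF assms(2,1)]
  by (rule Bochner_Integration.integrable_cong[THEN iffD1, rotated 2]) (auto simp: indicator_def)

text \<open>Since the indicator of \<open>m \<in> H\<close> is \<open>(1 + chi m H) / 2\<close>, the integrals over all sets \<open>supergroups G A\<close>
  are determined by the integrals against characters.\<close>

lemma integral_insert:
  assumes f: "integrable \<mu> f" and n: "n \<in> N" and A: "finite A" "A \<subseteq> carrier G" and m: "m \<in> carrier G"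
  shows "(\<integral>H. f H * chi n H * indicator (supergroups G (insert m A)) H \<partial>\<mu>) =
    (if m \<in> N then ((\<integral>H. f H * chi n H * indicator (supergroups G A) H \<partial>\<mu>) +
       (\<integral>H. f H * chi (n \<otimes> m) H * indicator (supergroups G A) H \<partial>\<mu>)) / 2 else 0)"
proof (cases "m \<in> N")
  case True
  have i: "integrable \<mu> (\<lambda>H. f H * chi k H * indicator (supergroups G A) H)" if "k \<in> carrier G" for k
    using that supergroups_sets[OF A] by (intro integrable_mult_indicator' integrable_mult_chi f)
  have "(\<integral>H. f H * chi n H * indicator (supergroups G (insert m A)) H \<partial>\<mu>) =
    (\<integral>H. (f H * chi n H * indicator (supergroups G A) H + f H * chi (n \<otimes> m) H * indicator (supergroups G A) H) / 2 \<partial>\<mu>)"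
  proof (rule integral_cong_AE)
    show "AE H in \<mu>. f H * chi n H * indicator (supergroups G (insert m A)) H =
      (f H * chi n H * indicator (supergroups G A) H + f H * chi (n \<otimes> m) H * indicator (supergroups G A) H) / 2"
      using AE_char
    proof eventually_elim
      case (elim H)
      then have "chi (n \<otimes> m) H = chi n H * chi m H" using n True by blast
      then show ?case by (auto simp: indicator_def supergroups_def chi_def)
    qed
  qed (use f i A n m N_closed supergroups_sets in \<open>auto intro!: borel_measurable_times borel_measurable_add
      borel_measurable_divide borel_measurable_indicator\<close>)
  then show ?thesis using True i N_closed n m by simp
next
  case False
  have "(\<integral>H. f H * chi n H * indicator (supergroups G (insert m A)) H \<partial>\<mu>) = (\<integral>H. 0 \<partial>\<mu>)"
  proof (rule integral_cong_AE)
    show "AE H in \<mu>. f H * chi n H * indicator (supergroups G (insert m A)) H = 0"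
      using AE_char by eventually_elim (use False in \<open>auto simp: supergroups_def indicator_def\<close>)
  qed (use f A n m N_closed supergroups_sets in \<open>auto intro!: borel_measurable_times borel_measurable_indicator\<close>)
  then show ?thesis using False by simp
qed

text \<open>Completeness of the characters: \<open>integral_insert\<close> passes from characters to
  all sets \<open>supergroups G A\<close> by induction on \<open>A\<close>, and Dynkin's argument
  passes from this intersection-stable generator to all Borel sets.\<close>

lemma AE_zero_of_chi:
  assumes f: "integrable \<mu> f" and zero: "\<And>n. n \<in> N \<Longrightarrow> (\<integral>H. f H * chi n H \<partial>\<mu>) = 0"
  shows "AE H in \<mu>. f H = 0"
proof -
  have A: "(\<integral>H. f H * chi n H * indicator (supergroups G A) H \<partial>\<mu>) = 0"
    if "finite A" "A \<subseteq> carrier G" "n \<in> N" for A n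
    using that
  proof (induction A arbitrary: n)
    case empty
    have "(\<integral>H. f H * chi n H * indicator (supergroups G {}) H \<partial>\<mu>) = (\<integral>H. f H * chi n H \<partial>\<mu>)"
      by (intro Bochner_Integration.integral_cong) (auto simp: supergroups_def space_mu indicator_def)
    then show ?case using zero empty by simp
  next
    case (insert m A)
    then show ?case
      by (simp add: integral_insert f subgroup.m_closed[OF sub])
  qed
  have one: "\<one> \<in> N" by (rule subgroup.one_closed[OF sub])
  have int: "integrable \<mu> (\<lambda>H. f H * indicator X H)" if "X \<in> sets \<mu>" for X
    using that f by (rule integrable_mult_indicator'[rotated])
  have E: "(\<integral>H. f H * indicator (supergroups G A) H \<partial>\<mu>) = 0" if "finite A" "A \<subseteq> carrier G" for A
  proof -
    have "(\<integral>H. f H * indicator (supergroups G A) H \<partial>\<mu>) = (\<integral>H. f H * chi \<one> H * indicator (supergroups G A) H \<partial>\<mu>)"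
      by (intro Bochner_Integration.integral_cong)
        (auto simp: supergroups_def space_mu indicator_def chi_def subgroup.one_closed)
    then show ?thesis using A[OF that one] by simp
  qed
  have "(\<integral>H. f H * indicator X H \<partial>\<mu>) = 0" if "X \<in> sigma_sets {H. subgroup H G} (supergroup_sets G)" for X
    using Int_stable_supergroup_sets supergroup_sets_Pow that
  proof (induction rule: sigma_sets_induct_disjoint)
    case (basic X)
    then show ?case using E by blast
  next
    case empty
    then show ?case by simp
  next
    case (compl X)
    then have X: "X \<in> sets \<mu>" by (simp add: sets_mu sets_borel_Sub[OF count])
    have "(\<integral>H. f H * indicator ({H. subgroup H G} - X) H \<partial>\<mu>) =
      (\<integral>H. f H * indicator (supergroups G {}) H - f H * indicator X H \<partial>\<mu>)"
      by (intro Bochner_Integration.integral_cong) (auto simp: supergroups_def indicator_def space_mu)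
    also have "\<dots> = 0" using E[of "{}"] compl int X supergroups_sets[of "{}"] by simp
    finally show ?case .
  next
    case (union X)
    then have X: "X i \<in> sets \<mu>" for i by (auto simp: sets_mu sets_borel_Sub[OF count])
    have "set_lebesgue_integral \<mu> (\<Union>i. X i) f = (\<Sum>i. set_lebesgue_integral \<mu> (X i) f)"
    proof (rule lebesgue_integral_countable_add)
      show "set_integrable \<mu> (\<Union>i. X i) f"
        unfolding set_integrable_def using X f by (intro integrable_mult_indicator) auto
    qed (use X union(1) in \<open>auto simp: disjoint_family_on_def\<close>)
    moreover have "set_lebesgue_integral \<mu> Y f = (\<integral>H. f H * indicator Y H \<partial>\<mu>)" for Y
      unfolding set_lebesgue_integral_def
      by (intro Bochner_Integration.integral_cong) (auto simp: indicator_def)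
    ultimately show ?case using union(3) by simp
  qed
  then show ?thesis
  proof (intro density_zero[OF f], goal_cases)
    case (1 X)
    then have "X \<in> sigma_sets {H. subgroup H G} (supergroup_sets G)" by (simp add: sets_mu sets_borel_Sub[OF count])
    moreover have "set_lebesgue_integral \<mu> X f = (\<integral>H. f H * indicator X H \<partial>\<mu>)"
      unfolding set_lebesgue_integral_def
      by (intro Bochner_Integration.integral_cong) (auto simp: indicator_def)
    ultimately show ?case using 1 by simp
  qed
qed

end

lemma integral_indicator_complex:
  assumes "X \<in> sets M"
  shows "(\<integral>x. indicator X x \<partial>M) = complex_of_real (measure M X)"
proof -
  have "(\<integral>x. indicator X x \<partial>M) = (\<integral>x. complex_of_real (indicator X x) \<partial>M)"
    by (intro Bochner_Integration.integral_cong) (auto simp: indicator_def)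
  also have "\<dots> = complex_of_real (measure M X)"
    using assms by (simp add: Int_absorb1 Int_absorb2 sets.sets_into_space)
  finally show ?thesis .
qed

text \<open>Through \<open>integral_insert\<close> the Fourier coefficients determine the measures
  of all \<open>supergroups G A\<close>, and these sets determine the measure.\<close>

lemma character_measure_eqI:
  assumes "character_measure G N \<mu>" "character_measure G N \<nu>"
    and eq: "\<And>n. n \<in> N \<Longrightarrow> (\<integral>H. chi n H \<partial>\<mu>) = (\<integral>H. chi n H \<partial>\<nu>)"
  shows "\<mu> = \<nu>"
proof -
  interpret M: character_measure G N \<mu> by fact
  interpret K: character_measure G N \<nu> by fact
  have A: "(\<integral>H. 1 * chi n H * indicator (supergroups G A) H \<partial>\<mu>) = (\<integral>H. 1 * chi n H * indicator (supergroups G A) H \<partial>\<nu>)"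
    if "finite A" "A \<subseteq> carrier G" "n \<in> N" for A n
    using that
  proof (induction A arbitrary: n)
    case empty
    have "(\<integral>H. 1 * chi n H * indicator (supergroups G {}) H \<partial>\<mu>) = (\<integral>H. chi n H \<partial>\<mu>)"
      "(\<integral>H. 1 * chi n H * indicator (supergroups G {}) H \<partial>\<nu>) = (\<integral>H. chi n H \<partial>\<nu>)"
      by (auto intro!: Bochner_Integration.integral_cong simp: supergroups_def M.space_mu K.space_mu indicator_def)
    then show ?case using eq empty by simp
  next
    case (insert m A)
    then have *: "m \<in> carrier G" "A \<subseteq> carrier G" by auto
    have c: "integrable \<mu> (\<lambda>_. 1 :: complex)" "integrable \<nu> (\<lambda>_. 1 :: complex)" by simp_all
    show ?case
      unfolding M.integral_insert[OF c(1) insert.prems(2) insert.hyps(1) *(2,1)]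
        K.integral_insert[OF c(2) insert.prems(2) insert.hyps(1) *(2,1)]
      using insert.IH[OF *(2)] insert.prems(2) subgroup.m_closed[OF M.sub] by simp
  qed
  have "emeasure \<mu> (supergroups G A) = emeasure \<nu> (supergroups G A)" if "finite A" "A \<subseteq> carrier G" for A
  proof -
    have "(\<integral>H. 1 * chi \<one>\<^bsub>G\<^esub> H * indicator (supergroups G A) H \<partial>\<mu>) = (\<integral>H. indicator (supergroups G A) H \<partial>\<mu>)"
      "(\<integral>H. 1 * chi \<one>\<^bsub>G\<^esub> H * indicator (supergroups G A) H \<partial>\<nu>) = (\<integral>H. indicator (supergroups G A) H \<partial>\<nu>)"
      by (auto intro!: Bochner_Integration.integral_cong simp: supergroups_def M.space_mu K.space_mu indicator_def
          chi_def subgroup.one_closed)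
    then have "(\<integral>H. indicator (supergroups G A) H \<partial>\<mu>) = (\<integral>H. (indicator (supergroups G A) H :: complex) \<partial>\<nu>)"
      using A[OF that subgroup.one_closed[OF M.sub]] by simp
    then have "complex_of_real (measure \<mu> (supergroups G A)) = complex_of_real (measure \<nu> (supergroups G A))"
      using M.supergroups_sets[OF that] K.supergroups_sets[OF that]
      by (simp add: integral_indicator_complex)
    then show ?thesis by (simp add: M.emeasure_eq_measure K.emeasure_eq_measure)
  qed
  then show ?thesis
    by (rule measure_Sub_eqI[OF M.count M.prob M.sets_mu K.sets_mu])
qed

section \<open>Inner automorphisms and weak mixing\<close>

text \<open>Gaussian elimination: an unknown \<open>k0\<close> with nonzero coefficient in the
  equation \<open>b\<close> is solved for and substituted into the other equations.\<close>

lemma homogeneous_system: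
  fixes C :: "'k \<Rightarrow> 'b \<Rightarrow> 'f::field"
  assumes "finite B" "finite K" "card B < card K"
  shows "\<exists>x. (\<exists>k\<in>K. x k \<noteq> 0) \<and> (\<forall>b\<in>B. (\<Sum>k\<in>K. x k * C k b) = 0)"
  using assms
proof (induction B arbitrary: K C rule: finite_induct)
  case empty
  then show ?case by (intro exI[of _ "\<lambda>_. 1"]) (auto simp: card_gt_0_iff)
next
  case (insert b B)
  show ?case
  proof (cases "\<forall>k\<in>K. C k b = 0")
    case True
    then show ?thesis using insert.IH[of K C] insert by auto
  next
    case False
    then obtain k0 where k0: "k0 \<in> K" "C k0 b \<noteq> 0" by blast
    define C' where "C' k b' = C k b' - C k b / C k0 b * C k0 b'" for k b'
    have "card B < card (K - {k0})" using insert k0 by simp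
    then obtain x where x: "\<exists>k\<in>K - {k0}. x k \<noteq> 0" "\<forall>b\<in>B. (\<Sum>k\<in>K - {k0}. x k * C' k b) = 0"
      using insert.IH[of "K - {k0}" C'] insert.prems by auto
    define s where "s = (\<Sum>k\<in>K - {k0}. x k * C k b) / C k0 b"
    define y where "y k = (if k = k0 then - s else x k)" for k
    have y: "(\<Sum>k\<in>K. y k * D k) = - s * D k0 + (\<Sum>k\<in>K - {k0}. x k * D k)" for D
      using k0 insert.prems by (subst sum.remove[of K k0]) (auto simp: y_def intro!: sum.cong)
    have "(\<Sum>k\<in>K. y k * C k b) = 0" using k0 by (simp add: y s_def)
    moreover have "(\<Sum>k\<in>K. y k * C k b') = 0" if "b' \<in> B" for b'
    proof -
      have "(\<Sum>k\<in>K - {k0}. x k * C' k b') = (\<Sum>k\<in>K - {k0}. x k * C k b') - s * C k0 b'"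
        by (simp add: C'_def s_def algebra_simps sum_subtractf sum_divide_distrib sum_distrib_left sum_distrib_right)
      then show ?thesis using x(2) that by (simp add: y)
    qed
    moreover have "\<exists>k\<in>K. y k \<noteq> 0" using x(1) by (auto simp: y_def)
    ultimately show ?thesis by blast
  qed
qed

section \<open>The group of inner automorphisms\<close>

definition conjugate :: "('a, 'm) monoid_scheme \<Rightarrow> 'a \<Rightarrow> 'a \<Rightarrow> 'a" where
  "conjugate G g = (\<lambda>x\<in>carrier G. g \<otimes>\<^bsub>G\<^esub> x \<otimes>\<^bsub>G\<^esub> inv\<^bsub>G\<^esub> g)"

lemma Inn_conj: "Inn G = conjugate G ` carrier G"
  by (simp add: Inn_def conjugate_def)

context group
begin

lemma conj_closed: "g \<in> carrier G \<Longrightarrow> x \<in> carrier G \<Longrightarrow> conjugate G g x \<in> carrier G"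
  by (simp add: conjugate_def)

lemma conj_conj:
  "g \<in> carrier G \<Longrightarrow> h \<in> carrier G \<Longrightarrow> x \<in> carrier G \<Longrightarrow> conjugate G g (conjugate G h x) = conjugate G (g \<otimes> h) x"
  by (simp add: conjugate_def inv_mult_group m_assoc)

lemma conj_one: "x \<in> carrier G \<Longrightarrow> conjugate G \<one> x = x"
  by (simp add: conjugate_def)

lemma conj_bij: "g \<in> carrier G \<Longrightarrow> bij_betw (conjugate G g) (carrier G) (carrier G)"
  by (rule bij_betwI[where g = "conjugate G (inv g)"]) (auto simp: conj_closed conj_conj conj_one)

lemma conj_auto: "g \<in> carrier G \<Longrightarrow> conjugate G g \<in> auto G"
proof -
  assume g: "g \<in> carrier G"
  have "conjugate G g \<in> hom G G"
    using g by (intro homI) (auto simp: conj_closed, simp add: conjugate_def m_assoc inv_solve_left)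
  then show ?thesis using conj_bij[OF g] by (simp add: auto_def Bij_def conjugate_def)
qed

lemma compose_conj:
  "g \<in> carrier G \<Longrightarrow> h \<in> carrier G \<Longrightarrow> compose (carrier G) (conjugate G g) (conjugate G h) = conjugate G (g \<otimes> h)"
  by (rule ext) (simp add: compose_def conj_conj, simp add: conjugate_def)

lemma mult_InnGroup:
  "g \<in> carrier G \<Longrightarrow> h \<in> carrier G \<Longrightarrow> conjugate G g \<otimes>\<^bsub>InnGroup G\<^esub> conjugate G h = conjugate G (g \<otimes> h)"
  using conj_auto[of g] conj_auto[of h]
  by (simp add: InnGroup_def AutoGroup_def BijGroup_def auto_def compose_conj)

lemma group_InnGroup: "group (InnGroup G)"
proof (rule groupI)
  have c: "carrier (InnGroup G) = conjugate G ` carrier G" by (simp add: InnGroup_def Inn_conj)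
  fix x y z assume "x \<in> carrier (InnGroup G)" "y \<in> carrier (InnGroup G)" "z \<in> carrier (InnGroup G)"
  then show "x \<otimes>\<^bsub>InnGroup G\<^esub> y \<otimes>\<^bsub>InnGroup G\<^esub> z = x \<otimes>\<^bsub>InnGroup G\<^esub> (y \<otimes>\<^bsub>InnGroup G\<^esub> z)"
    unfolding c by (auto simp: mult_InnGroup m_assoc)
next
  have c: "carrier (InnGroup G) = conjugate G ` carrier G" by (simp add: InnGroup_def Inn_conj)
  have o: "\<one>\<^bsub>InnGroup G\<^esub> = conjugate G \<one>"
    by (auto simp: InnGroup_def AutoGroup_def BijGroup_def conjugate_def)
  show "\<one>\<^bsub>InnGroup G\<^esub> \<in> carrier (InnGroup G)" unfolding c o by blast
  fix x assume x: "x \<in> carrier (InnGroup G)"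
  then show "\<one>\<^bsub>InnGroup G\<^esub> \<otimes>\<^bsub>InnGroup G\<^esub> x = x" unfolding c o by (auto simp: mult_InnGroup)
  obtain g where g: "x = conjugate G g" "g \<in> carrier G" using x unfolding c by blast
  then show "\<exists>y\<in>carrier (InnGroup G). y \<otimes>\<^bsub>InnGroup G\<^esub> x = \<one>\<^bsub>InnGroup G\<^esub>"
    unfolding c o by (intro bexI[of _ "conjugate G (inv g)"]) (auto simp: mult_InnGroup)
  fix y assume y: "y \<in> carrier (InnGroup G)"
  then show "x \<otimes>\<^bsub>InnGroup G\<^esub> y \<in> carrier (InnGroup G)" using x unfolding c by (auto simp: mult_InnGroup)
qed

text \<open>Weak mixing lets group elements act through their inverses in \<open>InnGroup G\<close>;
  this identity turns that into composition with an arbitrary conjugation.\<close>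

lemma inv_InnGroup:
  assumes "g \<in> carrier G"
  shows "inv\<^bsub>InnGroup G\<^esub> (conjugate G (inv g)) = conjugate G g"
proof (rule group.inv_equality[OF group_InnGroup])
  have "\<one>\<^bsub>InnGroup G\<^esub> = conjugate G \<one>"
    by (auto simp: InnGroup_def AutoGroup_def BijGroup_def conjugate_def)
  then show "conjugate G g \<otimes>\<^bsub>InnGroup G\<^esub> conjugate G (inv g) = \<one>\<^bsub>InnGroup G\<^esub>"
    using assms by (simp add: mult_InnGroup)
qed (use assms in \<open>auto simp: InnGroup_def Inn_conj\<close>)

end

section \<open>Orbits of characters and weak mixing\<close>

lemma (in prob_space) L2_integrable:
  assumes "f \<in> L2 M"
  shows "integrable M f"
proof -
  have f: "f \<in> borel_measurable M" and i: "integrable M (\<lambda>x. (cmod (f x))\<^sup>2)"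
    using assms by (auto simp: L2_def)
  show ?thesis
  proof (rule Bochner_Integration.integrable_bound)
    show "integrable M (\<lambda>x. 1 + (cmod (f x))\<^sup>2)" using i by simp
    show "AE x in M. norm (f x) \<le> norm (1 + (cmod (f x))\<^sup>2)"
    proof (rule AE_I2)
      fix x
      have "0 \<le> (cmod (f x) - 1)\<^sup>2 + 1 + (cmod (f x))\<^sup>2" by simp
      then have "2 * cmod (f x) \<le> 2 * (1 + (cmod (f x))\<^sup>2)" by (simp add: power2_eq_square algebra_simps)
      moreover have "0 \<le> 1 + (cmod (f x))\<^sup>2" by simp
      ultimately show "norm (f x) \<le> norm (1 + (cmod (f x))\<^sup>2)" by simp
    qed
  qed (rule f)
qed

text \<open>Within \<open>N\<close>, the set \<open>L\<close> marks the elements whose character is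
  almost surely trivial; all other characters have mean 0, as for Haar measure. By
  \<open>conj_distinct\<close> the conjugates of an element of \<open>N - L\<close> under the powers
  of \<open>a\<close> have orthonormal characters.\<close>

locale mixing_character_measure = character_measure +
  fixes L :: "'a set" and a :: 'a
  assumes a: "a \<in> carrier G"
    and normal: "\<And>g n. g \<in> carrier G \<Longrightarrow> n \<in> N \<Longrightarrow> conjugate G g n \<in> N"
    and invariant: "\<And>g. g \<in> carrier G \<Longrightarrow> distr \<mu> \<mu> (\<lambda>H. conjugate G g ` H) = \<mu>"
    and integral_chi: "\<And>n. n \<in> N \<Longrightarrow> (\<integral>H. chi n H \<partial>\<mu>) = (if n \<in> L then 1 else 0)"
    and conj_distinct: "\<And>n i j :: int. n \<in> N - L \<Longrightarrow> i \<noteq> j \<Longrightarrow>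
      conjugate G (a [^] i) n \<otimes> inv (conjugate G (a [^] j) n) \<notin> L"
    and nontrivial: "N - L \<noteq> {}"
begin

lemma conj_N: "n \<in> N \<Longrightarrow> conjugate G (a [^] (i :: int)) n \<in> N"
  by (intro normal int_pow_closed a)

lemma chi_sq: "chi n H * chi n H = 1"
  by (simp add: chi_def)

lemma cnj_chi: "cnj (chi n H) = chi n H"
  by (simp add: chi_def)

lemma chi_inv: "H \<in> space \<mu> \<Longrightarrow> n \<in> carrier G \<Longrightarrow> chi (inv n) H = chi n H"
  by (auto simp: chi_def space_mu subgroup.m_inv_closed) (metis inv_inv subgroup.m_inv_closed)

lemma integral_chi_chi:
  assumes "n \<in> N" "m \<in> N"
  shows "(\<integral>H. chi n H * chi m H \<partial>\<mu>) = (if n \<otimes> inv m \<in> L then 1 else 0)"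
proof -
  have m: "inv m \<in> N" "n \<otimes> inv m \<in> N"
    using assms subgroup.m_inv_closed[OF sub] subgroup.m_closed[OF sub] by auto
  have "(\<integral>H. chi n H * chi m H \<partial>\<mu>) = (\<integral>H. chi (n \<otimes> inv m) H \<partial>\<mu>)"
  proof (rule integral_cong_AE)
    show "AE H in \<mu>. chi n H * chi m H = chi (n \<otimes> inv m) H"
      using AE_char AE_space
    proof eventually_elim
      case (elim H)
      then have "chi (n \<otimes> inv m) H = chi n H * chi (inv m) H" using assms m by blast
      then show ?case using chi_inv[of H m] elim assms N_closed by simp
    qed
  qed (use assms m N_closed chi_measurable in \<open>auto intro!: borel_measurable_times\<close>)
  then show ?thesis using integral_chi m by simp
qed

definition coeff :: "('a set \<Rightarrow> complex) \<Rightarrow> 'a \<Rightarrow> int \<Rightarrow> complex" where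
  "coeff f n i = (\<integral>H. f H * chi (conjugate G (a [^] i) n) H \<partial>\<mu>)"

lemma bessel:
  assumes f: "f \<in> L2 \<mu>" and n: "n \<in> N - L" and J: "finite J"
  shows "(\<Sum>j\<in>J. (cmod (coeff f n j))\<^sup>2) \<le> (\<integral>H. (cmod (f H))\<^sup>2 \<partial>\<mu>)"
proof -
  let ?c = "coeff f n" and ?e = "\<lambda>j. chi (conjugate G (a [^] (j :: int)) n)"
  \<comment> \<open>The orthogonal projection of \<open>f\<close> to the span of the characters with
    index in \<open>J\<close>; expanding the squared distance between \<open>f\<close> and
    \<open>h\<close> gives Bessel's inequality.\<close>
  define h where "h H = (\<Sum>j\<in>J. ?c j * ?e j H)" for H
  have fi: "integrable \<mu> f" using f by (rule L2_integrable)
  have f2: "integrable \<mu> (\<lambda>H. f H * cnj (f H))"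
    using f by (simp only: L2_def mem_Collect_eq integrable_of_real flip: complex_norm_square)
  have cl: "conjugate G (a [^] j) n \<in> carrier G" for j :: int using n conj_N N_closed by blast
  have e: "integrable \<mu> (?e j)" for j
    using integrable_mult_chi[of "\<lambda>_. 1" "conjugate G (a [^] j) n"] cl by simp
  have fe: "integrable \<mu> (\<lambda>H. f H * ?e j H)" for j
    by (rule integrable_mult_chi[OF fi cl])
  have ee: "integrable \<mu> (\<lambda>H. ?e i H * ?e j H)" for i j
    by (rule integrable_mult_chi[OF e cl])
  have cfe: "integrable \<mu> (\<lambda>H. cnj (f H) * ?e j H)" for j
    using integrable_cnj[OF fe[of j]] by (simp add: cnj_chi)
  have cfe': "(\<integral>H. cnj (f H) * ?e j H \<partial>\<mu>) = cnj (?c j)" for j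
    using Bochner_Integration.integral_cnj[of \<mu> "\<lambda>H. f H * ?e j H"] by (simp add: cnj_chi coeff_def)
  have orth: "(\<integral>H. ?e i H * ?e j H \<partial>\<mu>) = (if i = j then 1 else 0)" for i j
  proof (cases "i = j")
    case True
    then show ?thesis by (simp add: chi_sq prob_space)
  next
    case False
    then show ?thesis using integral_chi_chi[of "conjugate G (a [^] i) n" "conjugate G (a [^] j) n"] conj_N n conj_distinct[OF n False] by simp
  qed
  have 1: "(\<integral>H. f H * cnj (h H) \<partial>\<mu>) = (\<Sum>j\<in>J. ?c j * cnj (?c j))" and i1: "integrable \<mu> (\<lambda>H. f H * cnj (h H))"
  proof -
    have eq: "f H * cnj (h H) = (\<Sum>j\<in>J. cnj (?c j) * (f H * ?e j H))" for H
      by (simp add: h_def cnj_chi sum_distrib_left algebra_simps)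
    show "integrable \<mu> (\<lambda>H. f H * cnj (h H))" unfolding eq using fe by simp
    show "(\<integral>H. f H * cnj (h H) \<partial>\<mu>) = (\<Sum>j\<in>J. ?c j * cnj (?c j))"
      unfolding eq using fe by (simp add: coeff_def[symmetric] mult.commute)
  qed
  have 2: "(\<integral>H. h H * cnj (f H) \<partial>\<mu>) = (\<Sum>j\<in>J. ?c j * cnj (?c j))" and i2: "integrable \<mu> (\<lambda>H. h H * cnj (f H))"
  proof -
    have eq: "h H * cnj (f H) = (\<Sum>j\<in>J. ?c j * (cnj (f H) * ?e j H))" for H
      by (simp add: h_def sum_distrib_left sum_distrib_right algebra_simps)
    show "integrable \<mu> (\<lambda>H. h H * cnj (f H))" unfolding eq using cfe by simp
    show "(\<integral>H. h H * cnj (f H) \<partial>\<mu>) = (\<Sum>j\<in>J. ?c j * cnj (?c j))"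
      unfolding eq using cfe by (simp add: cfe')
  qed
  have 3: "(\<integral>H. h H * cnj (h H) \<partial>\<mu>) = (\<Sum>j\<in>J. ?c j * cnj (?c j))" and i3: "integrable \<mu> (\<lambda>H. h H * cnj (h H))"
  proof -
    have eq: "h H * cnj (h H) = (\<Sum>i\<in>J. \<Sum>j\<in>J. ?c i * cnj (?c j) * (?e i H * ?e j H))" for H
      by (simp add: h_def cnj_chi sum_product algebra_simps)
    show "integrable \<mu> (\<lambda>H. h H * cnj (h H))" unfolding eq using ee by simp
    have "(\<integral>H. h H * cnj (h H) \<partial>\<mu>) = (\<Sum>i\<in>J. \<Sum>j\<in>J. ?c i * cnj (?c j) * (if i = j then 1 else 0))"
      unfolding eq using ee by (simp add: orth)
    also have "\<dots> = (\<Sum>j\<in>J. ?c j * cnj (?c j))" using J by (simp add: if_distrib sum.delta cong: if_cong)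
    finally show "(\<integral>H. h H * cnj (h H) \<partial>\<mu>) = (\<Sum>j\<in>J. ?c j * cnj (?c j))" .
  qed
  have eq: "complex_of_real ((cmod (f H - h H))\<^sup>2) = f H * cnj (f H) - f H * cnj (h H) - h H * cnj (f H) + h H * cnj (h H)" for H
    unfolding complex_norm_square by (simp add: algebra_simps)
  have "complex_of_real (\<integral>H. (cmod (f H - h H))\<^sup>2 \<partial>\<mu>) = (\<integral>H. f H * cnj (f H) \<partial>\<mu>) - (\<Sum>j\<in>J. ?c j * cnj (?c j))"
    unfolding integral_complex_of_real[symmetric] eq using f2 i1 i2 i3 by (simp add: 1 2 3)
  also have "\<dots> = complex_of_real ((\<integral>H. (cmod (f H))\<^sup>2 \<partial>\<mu>) - (\<Sum>j\<in>J. (cmod (?c j))\<^sup>2))"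
    by (simp add: complex_norm_square[symmetric] integral_complex_of_real del: of_real_power)
  finally have "(\<integral>H. (cmod (f H - h H))\<^sup>2 \<partial>\<mu>) = (\<integral>H. (cmod (f H))\<^sup>2 \<partial>\<mu>) - (\<Sum>j\<in>J. (cmod (?c j))\<^sup>2)"
    by (simp only: of_real_eq_iff)
  moreover have "0 \<le> (\<integral>H. (cmod (f H - h H))\<^sup>2 \<partial>\<mu>)" by simp
  ultimately show ?thesis by simp
qed

lemma coeff_tendsto_zero:
  assumes f: "f \<in> L2 \<mu>" and n: "n \<in> N - L" and e: "0 < e"
  obtains K :: int where "0 < K" "\<And>j. K \<le> \<bar>j\<bar> \<Longrightarrow> cmod (coeff f n j) < e"
proof -
  let ?S = "{j. e \<le> cmod (coeff f n j)}"
  have "finite ?S"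
  proof (rule ccontr)
    assume inf: "infinite ?S"
    obtain m :: nat where m: "(\<integral>H. (cmod (f H))\<^sup>2 \<partial>\<mu>) / e\<^sup>2 < m" using reals_Archimedean2 by blast
    obtain J where J: "finite J" "card J = m" "J \<subseteq> ?S"
      using infinite_arbitrarily_large[OF inf] by blast
    have "real m * e\<^sup>2 = (\<Sum>j\<in>J. e\<^sup>2)" using J by simp
    also have "\<dots> \<le> (\<Sum>j\<in>J. (cmod (coeff f n j))\<^sup>2)"
      using J e by (intro sum_mono power_mono) auto
    also have "\<dots> \<le> (\<integral>H. (cmod (f H))\<^sup>2 \<partial>\<mu>)" by (rule bessel[OF f n J(1)])
    finally show False using m e by (simp add: divide_simps)
  qed
  \<comment> \<open>Inserting 0 covers an empty \<open>?S\<close>, and adding 1 makes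
    \<open>K\<close> positive and the bound strict.\<close>
  define K where "K = Max (insert 0 (abs ` ?S)) + 1"
  have "\<bar>j\<bar> < K" if "j \<in> ?S" for j
    using Max_ge[of "insert 0 (abs ` ?S)" "\<bar>j\<bar>"] that \<open>finite ?S\<close> unfolding K_def by simp
  moreover have "0 < K" using Max_ge[of "insert 0 (abs ` ?S)" 0] \<open>finite ?S\<close> unfolding K_def by simp
  ultimately show ?thesis using that by (metis (mono_tags, lifting) mem_Collect_eq not_le)
qed

text \<open>On \<open>{H0}\<close> every character is a constant sign, so all coefficients of the
  indicator have absolute value \<open>measure \<mu> {H0}\<close>, while they tend to 0 along the
  orbit.\<close>

lemma no_atoms:
  assumes "subgroup H0 G"
  shows "emeasure \<mu> {H0} = 0"
proof -
  obtain n where n: "n \<in> N - L" using nontrivial by blast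
  have H0: "{H0} \<in> sets \<mu>"
    unfolding sets_mu by (rule singleton_in_borel_of_Sub[OF count assms])
  let ?f = "indicator {H0} :: 'a set \<Rightarrow> complex"
  have sq: "(cmod (?f H))\<^sup>2 = indicator {H0} H" for H by (simp add: indicator_def)
  have "integrable \<mu> (indicat_real {H0})"
    using H0 by (intro integrable_real_indicator) (auto simp: emeasure_eq_measure)
  then have "?f \<in> L2 \<mu>" unfolding L2_def mem_Collect_eq sq using H0 by simp
  moreover have "cmod (coeff ?f n j) = measure \<mu> {H0}" for j
  proof -
    have "coeff ?f n j = (\<integral>H. indicator {H0} H * chi (conjugate G (a [^] j) n) H0 \<partial>\<mu>)"
      unfolding coeff_def by (intro Bochner_Integration.integral_cong) (auto simp: indicator_def)
    also have "\<dots> = complex_of_real (measure \<mu> {H0}) * chi (conjugate G (a [^] j) n) H0"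
      using H0 by (simp add: integral_indicator_complex)
    finally show ?thesis by (simp add: norm_mult) (simp add: chi_def)
  qed
  ultimately have "measure \<mu> {H0} < e" if "0 < e" for e
    using coeff_tendsto_zero[OF _ n that, of ?f] by (metis abs_of_pos order_refl)
  then have "measure \<mu> {H0} = 0" by (metis less_irrefl measure_nonneg order_le_less)
  then show ?thesis by (simp add: emeasure_eq_measure)
qed

lemma measurable_conj: "g \<in> carrier G \<Longrightarrow> (\<lambda>H. conjugate G g ` H) \<in> measurable \<mu> \<mu>"
  using measurable_Aut_Sub[OF is_group conj_auto] measurable_cong_sets[OF sets_mu sets_mu] by blast

lemma conj_image_iff:
  assumes "g \<in> carrier G" "m \<in> carrier G" "H \<in> space \<mu>"
  shows "conjugate G g m \<in> conjugate G g ` H \<longleftrightarrow> m \<in> H"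
proof -
  have "H \<subseteq> carrier G" using assms by (simp add: space_mu subgroup.subset)
  then show ?thesis
    by (rule inj_on_image_mem_iff[OF bij_betw_imp_inj_on[OF conj_bij[OF assms(1)]] assms(2)])
qed

text \<open>Invariance of \<open>\<mu>\<close> moves a conjugation from the function to the index of
  the character.\<close>

lemma integral_conj:
  assumes g: "g \<in> carrier G" and m: "m \<in> carrier G" and f: "integrable \<mu> f"
  shows "(\<integral>H. f (conjugate G g ` H) * chi m H \<partial>\<mu>) = (\<integral>H. f H * chi (conjugate G g m) H \<partial>\<mu>)"
proof -
  have "(\<integral>H. f H * chi (conjugate G g m) H \<partial>\<mu>) = (\<integral>H. f H * chi (conjugate G g m) H \<partial>distr \<mu> \<mu> (\<lambda>H. conjugate G g ` H))"
    unfolding invariant[OF g] ..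
  also have "\<dots> = (\<integral>H. f (conjugate G g ` H) * chi (conjugate G g m) (conjugate G g ` H) \<partial>\<mu>)"
    using f by (intro integral_distr measurable_conj g borel_measurable_times chi_measurable conj_closed m) auto
  also have "\<dots> = (\<integral>H. f (conjugate G g ` H) * chi m H \<partial>\<mu>)"
    using conj_image_iff[OF g m] by (intro Bochner_Integration.integral_cong) (auto simp: chi_def)
  finally show ?thesis ..
qed

text \<open>The real part of \<open>1 - chi n H\<close> is nonnegative and has integral 0.\<close>

lemma chi_L:
  assumes "n \<in> N" "n \<in> L"
  shows "AE H in \<mu>. chi n H = 1"
proof -
  have i: "integrable \<mu> (chi n)" using integrable_mult_chi[of "\<lambda>_. 1" n] assms N_closed by simp
  have "(\<integral>H. 1 - chi n H \<partial>\<mu>) = 0"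
    using i integral_chi[OF assms(1)] assms(2) by (simp add: prob_space)
  then have "(\<integral>H. Re (1 - chi n H) \<partial>\<mu>) = 0"
    using integral_Re[of \<mu> "\<lambda>H. 1 - chi n H"] i by simp
  moreover have "integrable \<mu> (\<lambda>H. Re (1 - chi n H))" using i by (intro integrable_Re) simp
  ultimately have "AE H in \<mu>. Re (1 - chi n H) = 0"
    by (subst (asm) integral_nonneg_eq_0_iff_AE) (auto simp: chi_def)
  then show ?thesis by eventually_elim (simp add: chi_def split: if_splits)
qed

text \<open>Subtracting the mean also removes the coefficients indexed by \<open>L\<close>, where
  the characters are almost surely 1; then completeness applies.\<close>

lemma AE_const:
  assumes f: "f \<in> L2 \<mu>" and zero: "\<And>n. n \<in> N - L \<Longrightarrow> (\<integral>H. f H * chi n H \<partial>\<mu>) = 0"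
  shows "AE H in \<mu>. f H = (\<integral>H. f H \<partial>\<mu>)"
proof -
  let ?c = "\<integral>H. f H \<partial>\<mu>"
  have fi: "integrable \<mu> f" using f by (rule L2_integrable)
  have i: "integrable \<mu> (chi n)" if "n \<in> N" for n using integrable_mult_chi[of "\<lambda>_. 1" n] that N_closed by simp
  have "AE H in \<mu>. f H - ?c = 0"
  proof (rule AE_zero_of_chi)
    fix n assume n: "n \<in> N"
    have "(\<integral>H. (f H - ?c) * chi n H \<partial>\<mu>) = (\<integral>H. f H * chi n H \<partial>\<mu>) - ?c * (\<integral>H. chi n H \<partial>\<mu>)"
      using integrable_mult_chi[OF fi, of n] i[OF n] n N_closed by (simp add: left_diff_distrib)
    also have "\<dots> = 0"
    proof (cases "n \<in> L")
      case True
      have "(\<integral>H. f H * chi n H \<partial>\<mu>) = ?c"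
      proof (rule integral_cong_AE)
        show "AE H in \<mu>. f H * chi n H = f H" using chi_L[OF n True] by eventually_elim simp
      qed (use fi n N_closed chi_measurable in auto)
      then show ?thesis using True integral_chi[OF n] by simp
    next
      case False
      then show ?thesis using zero n integral_chi[OF n] by simp
    qed
    finally show "(\<integral>H. (f H - ?c) * chi n H \<partial>\<mu>) = 0" .
  qed (use fi in simp)
  then show ?thesis by eventually_elim simp
qed

text \<open>Suppose that the coefficient at \<open>n\<close> is nonzero. Sufficiently many
  translates of \<open>f\<close> by powers of \<open>a\<close> are linearly dependent, but for
  powers spaced by a large \<open>K\<close> the matrix of their coefficients is diagonally dominant,
  hence regular.\<close>

lemma finite_dim_coeff_zero:
  assumes V: "L2_subspace \<mu> V" "L2_finite_dim \<mu> V"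
    and inv: "\<And>g f. g \<in> carrier G \<Longrightarrow> f \<in> V \<Longrightarrow> (\<lambda>H. f (conjugate G g ` H)) \<in> V"
    and f: "f \<in> V" and n: "n \<in> N - L"
  shows "(\<integral>H. f H * chi n H \<partial>\<mu>) = 0"
proof (rule ccontr)
  assume "(\<integral>H. f H * chi n H \<partial>\<mu>) \<noteq> 0"
  then have c0: "coeff f n 0 \<noteq> 0"
    using conj_one[OF N_closed, of n] n by (simp add: coeff_def)
  obtain B where B: "finite B" "B \<subseteq> V" and span: "\<And>f. f \<in> V \<Longrightarrow> \<exists>c. AE x in \<mu>. f x = (\<Sum>b\<in>B. c b * b x)"
    using V(2) unfolding L2_finite_dim_def by blast
  have VL: "V \<subseteq> L2 \<mu>" using V(1) by (simp add: L2_subspace_def)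
  \<comment> \<open>One more than the size of the spanning set, so that \<open>m\<close> translates
    are dependent.\<close>
  define m where "m = Suc (card B)"
  \<comment> \<open>With this bound, the \<open>m - 1\<close> off-diagonal entries of a row sum to
    less than the diagonal entry in absolute value.\<close>
  define e where "e = cmod (coeff f n 0) / m"
  have e: "0 < e" using c0 by (simp add: e_def m_def)
  obtain K where K: "0 < K" "\<And>j. K \<le> \<bar>j\<bar> \<Longrightarrow> cmod (coeff f n j) < e"
    using coeff_tendsto_zero[OF _ n e, of f] f VL by blast
  define F where "F k H = f (conjugate G (a [^] (K * int k)) ` H)" for k H
  have F: "F k \<in> V" for k
    unfolding F_def using inv[OF int_pow_closed[OF a] f] by simp
  have "\<forall>k. \<exists>c. AE x in \<mu>. F k x = (\<Sum>b\<in>B. c b * b x)"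
    using span[OF F] by (rule allI)
  from choice[OF this] obtain C where C: "\<forall>k. AE x in \<mu>. F k x = (\<Sum>b\<in>B. C k b * b x)" by (rule exE)
  obtain x where x: "\<exists>k\<in>{..<m}. x k \<noteq> 0" "\<forall>b\<in>B. (\<Sum>k<m. x k * C k b) = 0"
    using homogeneous_system[of B "{..<m}" C] B by (auto simp: m_def)
  have "AE H in \<mu>. \<forall>k<m. F k H = (\<Sum>b\<in>B. C k b * b H)"
    using C by (simp add: AE_all_countable)
  then have rel: "AE H in \<mu>. (\<Sum>k<m. x k * F k H) = 0"
  proof eventually_elim
    case (elim H)
    then have "(\<Sum>k<m. x k * F k H) = (\<Sum>k<m. \<Sum>b\<in>B. x k * C k b * b H)"
      by (simp add: sum_distrib_left algebra_simps)
    also have "\<dots> = (\<Sum>b\<in>B. (\<Sum>k<m. x k * C k b) * b H)"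
      by (subst sum.swap) (simp add: sum_distrib_right)
    finally show ?case using x(2) by simp
  qed
  have Fi: "integrable \<mu> (F k)" for k using F VL L2_integrable by blast
  have fi: "integrable \<mu> f" using f VL L2_integrable by blast
  \<comment> \<open>These coefficients form a Toeplitz matrix with diagonal entry
    \<open>coeff f n 0\<close>.\<close>
  have coeffF: "(\<integral>H. F k H * chi (conjugate G (a [^] (- (K * int l))) n) H \<partial>\<mu>) = coeff f n (K * (int k - int l))" for k l
  proof -
    have nc: "n \<in> carrier G" using n N_closed by blast
    have "conjugate G (a [^] (K * int k)) (conjugate G (a [^] (- (K * int l))) n) = conjugate G (a [^] (K * (int k - int l))) n"
      using a nc by (simp add: conj_conj int_pow_mult[symmetric] algebra_simps)
    then show ?thesis
      unfolding F_def coeff_def using integral_conj[OF int_pow_closed[OF a] conj_closed[OF int_pow_closed[OF a] nc] fi] by simp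
  qed
  have sum0: "(\<Sum>k<m. x k * coeff f n (K * (int k - int l))) = 0" for l
  proof -
    let ?e = "chi (conjugate G (a [^] (- (K * int l))) n)"
    have cl: "conjugate G (a [^] (- (K * int l))) n \<in> carrier G" using n conj_N N_closed by blast
    have "(\<Sum>k<m. x k * coeff f n (K * (int k - int l))) = (\<integral>H. (\<Sum>k<m. x k * (F k H * ?e H)) \<partial>\<mu>)"
      using integrable_mult_chi[OF Fi cl] by (simp add: coeffF)
    also have "\<dots> = (\<integral>H. 0 \<partial>\<mu>)"
    proof (rule integral_cong_AE)
      show "AE H in \<mu>. (\<Sum>k<m. x k * (F k H * ?e H)) = 0"
        using rel
      proof eventually_elim
        case (elim H)
        have "(\<Sum>k<m. x k * (F k H * ?e H)) = (\<Sum>k<m. x k * F k H) * ?e H"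
          by (simp add: sum_distrib_right algebra_simps)
        then show ?case using elim by simp
      qed
    qed (use integrable_mult_chi[OF Fi cl] in auto)
    finally show ?thesis by simp
  qed
  \<comment> \<open>The relation is evaluated in a row \<open>l\<close> where the absolute value of
    \<open>x\<close> is largest; there it contradicts diagonal dominance.\<close>
  define M where "M = Max ((\<lambda>k. cmod (x k)) ` {..<m})"
  have "M \<in> (\<lambda>k. cmod (x k)) ` {..<m}" unfolding M_def by (rule Max_in) (auto simp: m_def)
  then obtain l where l: "l < m" "M = cmod (x l)" by blast
  have max: "cmod (x k) \<le> M" if "k < m" for k using that unfolding M_def by (intro Max_ge) auto
  obtain k where "k < m" "x k \<noteq> 0" using x(1) by blast
  then have M: "0 < M" using max[of k] by (simp add: less_le_trans[OF zero_less_norm_iff[THEN iffD2]])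
  have "x l * coeff f n 0 = - (\<Sum>k\<in>{..<m} - {l}. x k * coeff f n (K * (int k - int l)))"
    using sum0[of l] l(1) by (subst (asm) sum.remove[of _ l]) (auto simp: eq_neg_iff_add_eq_0)
  then have "M * cmod (coeff f n 0) = cmod (\<Sum>k\<in>{..<m} - {l}. x k * coeff f n (K * (int k - int l)))"
    by (metis l(2) norm_minus_cancel norm_mult)
  also have "\<dots> \<le> (\<Sum>k\<in>{..<m} - {l}. M * e)"
  proof (rule sum_norm_le)
    fix k assume k: "k \<in> {..<m} - {l}"
    then have "1 \<le> \<bar>int k - int l\<bar>" by auto
    then have "K \<le> \<bar>K * (int k - int l)\<bar>" using K(1) by (simp add: abs_mult)
    then show "cmod (x k * coeff f n (K * (int k - int l))) \<le> M * e"
      unfolding norm_mult using K(2) max[of k] k M by (intro mult_mono) (auto intro: less_imp_le)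
  qed
  also have "\<dots> = real (m - 1) * (M * e)" using l(1) by simp
  also have "\<dots> < real m * (M * e)" using M e by (simp add: m_def)
  also have "\<dots> = M * cmod (coeff f n 0)" by (simp add: e_def m_def)
  finally show False by simp
qed

text \<open>Since the coefficients outside \<open>L\<close> vanish, every element of
  \<open>V\<close> is almost everywhere constant, and \<open>V\<close> depends only on whether a
  nonzero constant occurs.\<close>

lemma inner_weak_mixing: "Inn_weakly_mixing G \<mu>"
  unfolding Inn_weakly_mixing_def weakly_mixing_def
proof (intro allI impI, elim conjE)
  fix V assume V: "L2_subspace \<mu> V" "L2_finite_dim \<mu> V"
    and inv: "\<forall>\<phi>\<in>carrier (InnGroup G). \<forall>f\<in>V. (\<lambda>H. f ((inv\<^bsub>InnGroup G\<^esub> \<phi>) ` H)) \<in> V"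
  have inv': "(\<lambda>H. f (conjugate G g ` H)) \<in> V" if "g \<in> carrier G" "f \<in> V" for f g
  proof -
    have "conjugate G (inv g) \<in> carrier (InnGroup G)" using that by (auto simp: InnGroup_def Inn_conj)
    then show ?thesis using inv that inv_InnGroup[OF that(1)] by metis
  qed
  have VL: "V \<subseteq> L2 \<mu>" and V0: "(\<lambda>_. 0) \<in> V" and Vc: "\<And>c f. f \<in> V \<Longrightarrow> (\<lambda>x. c * f x) \<in> V"
    and VAE: "\<And>f h. f \<in> V \<Longrightarrow> h \<in> L2 \<mu> \<Longrightarrow> AE x in \<mu>. f x = h x \<Longrightarrow> h \<in> V"
    using V(1) by (auto simp: L2_subspace_def)
  have const: "AE H in \<mu>. f H = (\<integral>H. f H \<partial>\<mu>)" if "f \<in> V" for f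
    using that VL finite_dim_coeff_zero[OF V inv' that] by (intro AE_const) auto
  show "V = L2_zero \<mu> \<or> V = L2_const \<mu>"
  proof (cases "\<forall>f\<in>V. (\<integral>H. f H \<partial>\<mu>) = 0")
    case True
    have "V = L2_zero \<mu>"
    proof (intro equalityI subsetI)
      fix f assume "f \<in> V"
      then show "f \<in> L2_zero \<mu>" using const[of f] True VL by (auto simp: L2_zero_def)
    next
      fix f assume f: "f \<in> L2_zero \<mu>"
      then have "AE x in \<mu>. 0 = f x" unfolding L2_zero_def by (auto elim: eventually_mono)
      then show "f \<in> V" using VAE[OF V0, of f] f by (simp add: L2_zero_def)
    qed
    then show ?thesis ..
  next
    case False
    then obtain f where f: "f \<in> V" "(\<integral>H. f H \<partial>\<mu>) \<noteq> 0" by blast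
    have "V = L2_const \<mu>"
    proof (intro equalityI subsetI)
      fix h assume "h \<in> V"
      then show "h \<in> L2_const \<mu>" using const[of h] VL by (auto simp: L2_const_def)
    next
      fix h assume h: "h \<in> L2_const \<mu>"
      then obtain c where c: "AE x in \<mu>. h x = c" by (auto simp: L2_const_def)
      let ?d = "c / (\<integral>H. f H \<partial>\<mu>)"
      have "AE x in \<mu>. ?d * f x = h x"
        using c const[OF f(1)] by eventually_elim (use f(2) in simp)
      then show "h \<in> V" using VAE[OF Vc[OF f(1)], of h ?d] h by (simp add: L2_const_def)
    qed
    then show ?thesis ..
  qed
qed

end

section \<open>The mod 2 cycle space of a coset graph\<close>

lemma free_group_snoc:
  assumes "w @ [l] \<in> carrier (free_group S)"
  shows "w \<in> carrier (free_group S)" "[l] \<in> carrier (free_group S)"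
    and "w @ [l] = w \<otimes>\<^bsub>free_group S\<^esub> [l]"
proof -
  have red: "reduced (w @ [l])" and set: "set (w @ [l]) \<subseteq> S \<times> UNIV"
    using assms by (simp_all add: carrier_free_group)
  then have "reduced w" by (simp add: reduced_def successively_append_iff)
  then show "w \<in> carrier (free_group S)" "[l] \<in> carrier (free_group S)"
    using set by (simp_all add: carrier_free_group)
  show "w @ [l] = w \<otimes>\<^bsub>free_group S\<^esub> [l]"
    using foldr_red_cons_Nil[OF red] by (simp add: mult_free_group)
qed

lemma image_sym_diff:
  assumes "inj_on f U" "A \<subseteq> U" "B \<subseteq> U"
  shows "f ` sym_diff A B = sym_diff (f ` A) (f ` B)"
proof -
  have "A - B \<subseteq> U" "B - A \<subseteq> U" using assms by blast+
  then show ?thesis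
    unfolding image_Un using assms by (simp only: inj_on_image_set_diff)
qed

locale coset_graph =
  fixes S :: "'a set" and N :: "'a letter list set"
  assumes normal_N: "N \<lhd> free_group S"
begin

abbreviation F :: "'a letter list monoid" where "F \<equiv> free_group S"

sublocale F: group F by (rule group_free_group)

lemma sub_N: "subgroup N F"
  using normal_N by (simp add: normal_def)

lemma N_closed: "n \<in> N \<Longrightarrow> n \<in> carrier F" and N_subset: "N \<subseteq> carrier F"
  using subgroup.subset[OF sub_N] by auto

text \<open>An edge of the coset graph is a pair of a coset and a generator; an inverse letter traverses the
  edge that starts at its target.\<close>

definition cstep :: "'a letter \<Rightarrow> 'a letter list set \<times> ('a letter list set \<times> 'a) set \<Rightarrow>
    'a letter list set \<times> ('a letter list set \<times> 'a) set" where
  "cstep l s = (fst s #>\<^bsub>F\<^esub> [l], sym_diff (snd s) {(if snd l then fst s else fst s #>\<^bsub>F\<^esub> [l], fst l)})"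

text \<open>The edges that the path of \<open>w\<close> from \<open>p\<close> traverses an odd
  number of times. For \<open>p = N\<close> and \<open>w \<in> N\<close> the path is closed, and
  this is a mod 2 cycle.\<close>

definition cycle :: "'a letter list set \<Rightarrow> 'a letter list \<Rightarrow> ('a letter list set \<times> 'a) set" where
  "cycle p w = snd (fold cstep w (p, {}))"

lemma cstep_pair: "cstep l (p, C) =
    (p #>\<^bsub>F\<^esub> [l], sym_diff C {(if snd l then p else p #>\<^bsub>F\<^esub> [l], fst l)})"
  by (simp add: cstep_def)

sublocale cact: word_action S "{s. fst s \<subseteq> carrier F}" cstep
proof
  fix l :: "'a letter" and s :: "'a letter list set \<times> ('a letter list set \<times> 'a) set"
  assume l: "l \<in> S \<times> UNIV" and s: "s \<in> {s. fst s \<subseteq> carrier F}"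
  have c: "[l] \<in> carrier F" "[inv_letter l] \<in> carrier F"
    using l by (auto simp: carrier_free_group inv_letter_def)
  show "cstep l s \<in> {s. fst s \<subseteq> carrier F}"
    using s c by (simp add: cstep_def F.r_coset_subset_G)
  have "[l] \<otimes>\<^bsub>F\<^esub> [inv_letter l] = \<one>\<^bsub>F\<^esub>" by (simp add: mult_free_group one_free_group)
  then have "fst s #>\<^bsub>F\<^esub> [l] #>\<^bsub>F\<^esub> [inv_letter l] = fst s"
    using s c by (simp add: F.coset_mult_assoc F.coset_mult_one)
  moreover obtain p C where pC: "s = (p, C)" by (cases s)
  ultimately have p: "p #>\<^bsub>F\<^esub> [l] #>\<^bsub>F\<^esub> [inv_letter l] = p" by simp
  have "sym_diff (sym_diff C {e}) {e} = C" for e by blast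
  then show "cstep (inv_letter l) (cstep l s) = s"
    unfolding pC cstep_pair p by (cases "snd l") (simp_all only: inv_letter_def fst_conv snd_conv if_True if_False simp_thms)
qed

lemma fold_cstep:
  assumes "w \<in> carrier F" "p \<subseteq> carrier F"
  shows "fold cstep w (p, C) = (p #>\<^bsub>F\<^esub> w, sym_diff C (cycle p w))"
proof -
  have fst_fold: "fst (fold cstep w (p, C)) = p #>\<^bsub>F\<^esub> w" if "w \<in> carrier F" for w C
    using that
  proof (induction w rule: rev_induct)
    case Nil
    then show ?case using assms(2) F.coset_mult_one[of p] by (simp add: one_free_group)
  next
    case (snoc l w)
    note w = free_group_snoc[OF snoc.prems]
    have "p #>\<^bsub>F\<^esub> (w @ [l]) = p #>\<^bsub>F\<^esub> w #>\<^bsub>F\<^esub> [l]"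
      unfolding w(3) using w assms by (simp add: F.coset_mult_assoc)
    then show ?case using snoc.IH[OF w(1)] by (simp add: cstep_def)
  qed
  show ?thesis using assms(1)
  proof (induction w rule: rev_induct)
    case Nil
    then show ?case using assms(2) F.coset_mult_one[of p] by (simp add: cycle_def one_free_group)
  next
    case (snoc l w)
    note w = free_group_snoc[OF snoc.prems]
    let ?e = "(if snd l then p #>\<^bsub>F\<^esub> w else p #>\<^bsub>F\<^esub> w #>\<^bsub>F\<^esub> [l], fst l)"
    have p: "p #>\<^bsub>F\<^esub> (w @ [l]) = p #>\<^bsub>F\<^esub> w #>\<^bsub>F\<^esub> [l]"
      unfolding w(3) using w assms by (simp add: F.coset_mult_assoc)
    have "fold cstep w (p, {}) = (p #>\<^bsub>F\<^esub> w, cycle p w)"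
      using fst_fold[OF w(1)] by (simp add: cycle_def prod_eq_iff)
    then have "cycle p (w @ [l]) = sym_diff (cycle p w) {?e}"
      unfolding cycle_def[of p "w @ [l]"] by (simp add: cstep_pair)
    moreover have "sym_diff (sym_diff C (cycle p w)) {?e} = sym_diff C (sym_diff (cycle p w) {?e})" by blast
    moreover have "fold cstep (w @ [l]) (p, C) =
        (p #>\<^bsub>F\<^esub> w #>\<^bsub>F\<^esub> [l], sym_diff (sym_diff C (cycle p w)) {?e})"
      unfolding fold_append comp_apply snoc.IH[OF w(1)] by (simp add: cstep_pair)
    ultimately show ?case unfolding p by simp
  qed
qed

lemma cycle_snoc:
  assumes "w @ [l] \<in> carrier F" "p \<subseteq> carrier F"
  shows "cycle p (w @ [l]) = sym_diff (cycle p w)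
    {(if snd l then p #>\<^bsub>F\<^esub> w else p #>\<^bsub>F\<^esub> w #>\<^bsub>F\<^esub> [l], fst l)}"
proof -
  have "fold cstep w (p, {}) = (p #>\<^bsub>F\<^esub> w, cycle p w)"
    using fold_cstep[OF free_group_snoc(1)[OF assms(1)] assms(2), of "{}"] by simp
  then show ?thesis unfolding cycle_def[of p "w @ [l]"] by (simp add: cstep_pair)
qed

lemma cycle_Nil: "cycle p [] = {}"
  by (simp add: cycle_def)

lemma cycle_mult:
  assumes "u \<in> carrier F" "v \<in> carrier F" "p \<subseteq> carrier F"
  shows "cycle p (u \<otimes>\<^bsub>F\<^esub> v) = sym_diff (cycle p u) (cycle (p #>\<^bsub>F\<^esub> u) v)"
proof -
  have "fold cstep (u \<otimes>\<^bsub>F\<^esub> v) (p, {}) = fold cstep v (fold cstep u (p, {}))"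
    using assms by (intro cact.fold_mult) auto
  then show ?thesis using assms by (simp add: fold_cstep F.r_coset_subset_G)
qed

lemma finite_cycle: "w \<in> carrier F \<Longrightarrow> p \<subseteq> carrier F \<Longrightarrow> finite (cycle p w)"
proof (induction w rule: rev_induct)
  case (snoc l w)
  then show ?case using free_group_snoc(1)[OF snoc.prems(1)] by (simp add: cycle_snoc)
qed (simp add: cycle_Nil)

lemma cycle_cosets: "w \<in> carrier F \<Longrightarrow> cycle N w \<subseteq> {N #>\<^bsub>F\<^esub> x | x. x \<in> carrier F} \<times> UNIV"
proof (induction w rule: rev_induct)
  case (snoc l w)
  note w = free_group_snoc[OF snoc.prems]
  have "N #>\<^bsub>F\<^esub> w #>\<^bsub>F\<^esub> [l] = N #>\<^bsub>F\<^esub> (w \<otimes>\<^bsub>F\<^esub> [l])" using w N_subset by (simp add: F.coset_mult_assoc)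
  then have "N #>\<^bsub>F\<^esub> w #>\<^bsub>F\<^esub> [l] \<in> {N #>\<^bsub>F\<^esub> x | x. x \<in> carrier F}" using w by blast
  moreover have "N #>\<^bsub>F\<^esub> w \<in> {N #>\<^bsub>F\<^esub> x | x. x \<in> carrier F}" using w by blast
  ultimately show ?case using snoc.IH[OF w(1)] snoc.prems N_subset by (auto simp: cycle_snoc)
qed (simp add: cycle_Nil)

definition translate :: "'a letter list \<Rightarrow> 'a letter list set \<times> 'a \<Rightarrow> 'a letter list set \<times> 'a" where
  "translate g e = (g <#\<^bsub>F\<^esub> fst e, snd e)"

lemma l_coset_cancel:
  assumes "g \<in> carrier F" "p \<subseteq> carrier F"
  shows "inv\<^bsub>F\<^esub> g <#\<^bsub>F\<^esub> (g <#\<^bsub>F\<^esub> p) = p"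
  using assms F.lcos_m_assoc[of p "inv\<^bsub>F\<^esub> g" g] F.lcos_mult_one[of p] by simp

lemma cycle_in: "w \<in> carrier F \<Longrightarrow> p \<subseteq> carrier F \<Longrightarrow> cycle p w \<subseteq> Pow (carrier F) \<times> UNIV"
proof (induction w rule: rev_induct)
  case (snoc l w)
  note w = free_group_snoc(1,2)[OF snoc.prems(1)]
  have "p #>\<^bsub>F\<^esub> w \<subseteq> carrier F" "p #>\<^bsub>F\<^esub> w #>\<^bsub>F\<^esub> [l] \<subseteq> carrier F"
    using w snoc.prems by (simp_all add: F.r_coset_subset_G)
  then have "{(if snd l then p #>\<^bsub>F\<^esub> w else p #>\<^bsub>F\<^esub> w #>\<^bsub>F\<^esub> [l], fst l)} \<subseteq> Pow (carrier F) \<times> UNIV"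
    by simp
  then show ?case
    unfolding cycle_snoc[OF snoc.prems] using snoc.IH[OF w(1) snoc.prems(2)] by blast
qed (simp add: cycle_Nil)

lemma inj_translate: "g \<in> carrier F \<Longrightarrow> inj_on (translate g) (Pow (carrier F) \<times> UNIV)"
  by (rule inj_on_inverseI[where g = "translate (inv\<^bsub>F\<^esub> g)"]) (auto simp: translate_def l_coset_cancel)

lemma l_r_coset:
  "g \<in> carrier F \<Longrightarrow> x \<in> carrier F \<Longrightarrow> p \<subseteq> carrier F \<Longrightarrow> (g <#\<^bsub>F\<^esub> p) #>\<^bsub>F\<^esub> x = g <#\<^bsub>F\<^esub> (p #>\<^bsub>F\<^esub> x)"
  unfolding l_coset_def r_coset_def by (auto simp: F.m_assoc subset_iff)

text \<open>Left multiplication commutes with right multiplication by letters, so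
  \<open>translate g\<close> takes paths to paths; its injectivity lets images pass through
  symmetric differences.\<close>

lemma cycle_translate:
  assumes "g \<in> carrier F" "p \<subseteq> carrier F" "w \<in> carrier F"
  shows "cycle (g <#\<^bsub>F\<^esub> p) w = translate g ` cycle p w"
  using assms(3)
proof (induction w rule: rev_induct)
  case (snoc l w)
  note w = free_group_snoc[OF snoc.prems]
  let ?e = "(if snd l then p #>\<^bsub>F\<^esub> w else p #>\<^bsub>F\<^esub> w #>\<^bsub>F\<^esub> [l], fst l)"
  have gp: "g <#\<^bsub>F\<^esub> p \<subseteq> carrier F" using assms by (simp add: F.l_coset_subset_G)
  have pw: "p #>\<^bsub>F\<^esub> w \<subseteq> carrier F" "p #>\<^bsub>F\<^esub> w #>\<^bsub>F\<^esub> [l] \<subseteq> carrier F"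
    using assms w by (simp_all add: F.r_coset_subset_G)
  have e: "?e \<in> Pow (carrier F) \<times> UNIV" using pw by simp
  have i: "inj_on (translate g) (Pow (carrier F) \<times> UNIV)" by (rule inj_translate[OF assms(1)])
  have cy: "cycle p w \<subseteq> Pow (carrier F) \<times> UNIV" by (rule cycle_in[OF w(1) assms(2)])
  have te: "translate g ?e = (if snd l then (g <#\<^bsub>F\<^esub> p) #>\<^bsub>F\<^esub> w else (g <#\<^bsub>F\<^esub> p) #>\<^bsub>F\<^esub> w #>\<^bsub>F\<^esub> [l], fst l)"
    using assms w pw by (simp add: translate_def l_r_coset)
  have "translate g ` sym_diff (cycle p w) {?e} = sym_diff (translate g ` cycle p w) (translate g ` {?e})"
    by (rule image_sym_diff[OF i cy]) (use e in blast)
  also have "translate g ` {?e} = {translate g ?e}" by (simp only: image_insert image_empty)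
  finally have "translate g ` sym_diff (cycle p w) {?e} = sym_diff (translate g ` cycle p w) {translate g ?e}" .
  then show ?case
    unfolding cycle_snoc[OF snoc.prems gp] cycle_snoc[OF snoc.prems assms(2)] te snoc.IH[OF w(1)] by simp
qed (simp add: cycle_Nil)

lemma N_coset: "n \<in> N \<Longrightarrow> N #>\<^bsub>F\<^esub> n = N"
  using F.coset_join2[OF N_closed sub_N] by blast

lemma cycle_N_mult: "n \<in> N \<Longrightarrow> m \<in> N \<Longrightarrow> cycle N (n \<otimes>\<^bsub>F\<^esub> m) = sym_diff (cycle N n) (cycle N m)"
  by (simp add: cycle_mult N_closed N_subset N_coset)

lemma cycle_N_inv: "n \<in> N \<Longrightarrow> cycle N (inv\<^bsub>F\<^esub> n) = cycle N n"
proof -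
  assume n: "n \<in> N"
  then have "sym_diff (cycle N n) (cycle N (inv\<^bsub>F\<^esub> n)) = {}"
    using cycle_N_mult[of n "inv\<^bsub>F\<^esub> n"] subgroup.m_inv_closed[OF sub_N n] N_closed[OF n]
    by (simp add: one_free_group cycle_Nil)
  then show ?thesis by blast
qed

text \<open>The path goes out along \<open>g\<close>, around the cycle of \<open>n\<close> based at
  the coset of \<open>g\<close>, and back along the same edges, which cancel. Normality makes that
  coset a left translate of \<open>N\<close>.\<close>

lemma cycle_conjugate:
  assumes g: "g \<in> carrier F" and n: "n \<in> N"
  shows "cycle N (conjugate F g n) = translate g ` cycle N n"
proof -
  have nc: "n \<in> carrier F" using n by (rule N_closed)
  have eq: "N #>\<^bsub>F\<^esub> g = g <#\<^bsub>F\<^esub> N" using normal.coset_eq[OF normal_N] g by blast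
  have "N #>\<^bsub>F\<^esub> (g \<otimes>\<^bsub>F\<^esub> n) = (g <#\<^bsub>F\<^esub> N) #>\<^bsub>F\<^esub> n"
    unfolding eq[symmetric] using g nc N_subset by (simp add: F.coset_mult_assoc)
  also have "\<dots> = N #>\<^bsub>F\<^esub> g" using g nc N_subset N_coset[OF n] by (simp add: l_r_coset eq)
  finally have gn: "N #>\<^bsub>F\<^esub> (g \<otimes>\<^bsub>F\<^esub> n) = N #>\<^bsub>F\<^esub> g" .
  have "cycle N (g \<otimes>\<^bsub>F\<^esub> inv\<^bsub>F\<^esub> g) = {}" using g by (simp add: one_free_group cycle_Nil)
  then have "sym_diff (cycle N g) (cycle (N #>\<^bsub>F\<^esub> g) (inv\<^bsub>F\<^esub> g)) = {}"
    using cycle_mult[of g "inv\<^bsub>F\<^esub> g" N] g N_subset by simp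
  then have "cycle N g = cycle (N #>\<^bsub>F\<^esub> g) (inv\<^bsub>F\<^esub> g)" by blast
  moreover have "cycle N (conjugate F g n) =
      sym_diff (sym_diff (cycle N g) (cycle (N #>\<^bsub>F\<^esub> g) n)) (cycle (N #>\<^bsub>F\<^esub> g) (inv\<^bsub>F\<^esub> g))"
    using g nc N_subset by (simp add: conjugate_def cycle_mult gn)
  ultimately have "cycle N (conjugate F g n) = cycle (N #>\<^bsub>F\<^esub> g) n" by blast
  then show ?thesis using cycle_translate[OF g N_subset nc] eq by simp
qed

section \<open>Homomorphisms to Z/2 as edge weights\<close>

definition parity :: "('a letter list set \<times> 'a \<Rightarrow> bool) \<Rightarrow> 'a letter list \<Rightarrow> bool" where
  "parity X w \<longleftrightarrow> odd (card {e \<in> cycle N w. X e})"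

lemma parity_sym_diff:
  assumes "finite A" "finite B"
  shows "odd (card {e \<in> sym_diff A B. X e}) \<longleftrightarrow> (odd (card {e \<in> A. X e}) \<noteq> odd (card {e \<in> B. X e}))"
proof -
  have "{e \<in> sym_diff A B. X e} = sym_diff {e \<in> A. X e} {e \<in> B. X e}" by blast
  moreover have "finite {e \<in> A. X e}" "finite {e \<in> B. X e}" using assms by simp_all
  ultimately show ?thesis by (simp only: odd_card_sym_diff)
qed

lemma finite_cycle_N: "n \<in> N \<Longrightarrow> finite (cycle N n)"
  by (rule finite_cycle[OF N_closed N_subset])

lemma parity_mult: "n \<in> N \<Longrightarrow> m \<in> N \<Longrightarrow> parity X (n \<otimes>\<^bsub>F\<^esub> m) \<longleftrightarrow> parity X n \<noteq> parity X m"
  unfolding parity_def by (simp only: cycle_N_mult parity_sym_diff[OF finite_cycle_N finite_cycle_N])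

text \<open>The transversal contains the identity, so that for \<open>w\<close> in \<open>N\<close>
  the product of Schreier generators along the path is \<open>w\<close> itself.\<close>

definition rep :: "'a letter list set \<Rightarrow> 'a letter list" where
  "rep p = (if p = N then \<one>\<^bsub>F\<^esub> else SOME x. x \<in> p)"

lemma rep:
  assumes "w \<in> carrier F"
  shows "rep (N #>\<^bsub>F\<^esub> w) \<in> carrier F" "N #>\<^bsub>F\<^esub> rep (N #>\<^bsub>F\<^esub> w) = N #>\<^bsub>F\<^esub> w"
proof -
  have "rep (N #>\<^bsub>F\<^esub> w) \<in> N #>\<^bsub>F\<^esub> w"
  proof (cases "N #>\<^bsub>F\<^esub> w = N")
    case True
    then show ?thesis using subgroup.one_closed[OF sub_N] by (simp add: rep_def)
  next
    case False
    have "w \<in> N #>\<^bsub>F\<^esub> w" by (rule F.rcos_self[OF assms sub_N])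
    then have "(SOME x. x \<in> N #>\<^bsub>F\<^esub> w) \<in> N #>\<^bsub>F\<^esub> w" by (rule someI)
    then show ?thesis using False by (simp add: rep_def)
  qed
  then show "rep (N #>\<^bsub>F\<^esub> w) \<in> carrier F" "N #>\<^bsub>F\<^esub> rep (N #>\<^bsub>F\<^esub> w) = N #>\<^bsub>F\<^esub> w"
    using F.repr_independence[OF _ assms sub_N] F.r_coset_subset_G[OF N_subset assms] by blast+
qed

lemma coset_eq_mult_inv:
  assumes "x \<in> carrier F" "y \<in> carrier F" "N #>\<^bsub>F\<^esub> x = N #>\<^bsub>F\<^esub> y"
  shows "x \<otimes>\<^bsub>F\<^esub> inv\<^bsub>F\<^esub> y \<in> N"
  using F.coset_mult_inv2[OF assms(3,1,2) N_subset] F.coset_join1[OF _ _ sub_N] assms by simp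

text \<open>Schreier's rewriting: a homomorphism \<open>N \<rightarrow> Z/2\<close> is determined by its values on the Schreier
  generators, which are indexed by the edges of the coset graph.\<close>

lemma hom_eq_parity:
  assumes \<theta>: "\<And>n m. n \<in> N \<Longrightarrow> m \<in> N \<Longrightarrow> \<theta> (n \<otimes>\<^bsub>F\<^esub> m) \<longleftrightarrow> \<theta> n \<noteq> \<theta> m"
  obtains X where "\<And>n. n \<in> N \<Longrightarrow> \<theta> n \<longleftrightarrow> parity X n"
proof -
  define X where "X e \<longleftrightarrow> \<theta> (rep (fst e) \<otimes>\<^bsub>F\<^esub> [(snd e, True)] \<otimes>\<^bsub>F\<^esub> inv\<^bsub>F\<^esub> rep (fst e #>\<^bsub>F\<^esub> [(snd e, True)]))" for e
  have one: "\<one>\<^bsub>F\<^esub> \<in> N" by (rule subgroup.one_closed[OF sub_N])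
  have \<theta>1: "\<not> \<theta> \<one>\<^bsub>F\<^esub>" using \<theta>[OF one one] by simp
  have \<theta>inv: "\<theta> (inv\<^bsub>F\<^esub> n) = \<theta> n" if "n \<in> N" for n
    using \<theta>[OF that subgroup.m_inv_closed[OF sub_N that]] \<theta>1 N_closed[OF that] by auto
  \<comment> \<open>Along the path, \<open>w\<close> times the inverse of its representative is a
    product of Schreier generators and their inverses, and \<open>\<theta>\<close> takes the same
    value on an element of \<open>N\<close> and on its inverse.\<close>
  have main: "parity X w \<longleftrightarrow> \<theta> (w \<otimes>\<^bsub>F\<^esub> inv\<^bsub>F\<^esub> rep (N #>\<^bsub>F\<^esub> w))" if "w \<in> carrier F" for w
    using that
  proof (induction w rule: rev_induct)
    case Nil
    have "\<theta> (\<one>\<^bsub>F\<^esub> \<otimes>\<^bsub>F\<^esub> inv\<^bsub>F\<^esub> rep (N #>\<^bsub>F\<^esub> \<one>\<^bsub>F\<^esub>)) = False"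
      using \<theta>1 by (simp add: F.coset_mult_one[OF N_subset] rep_def)
    then show ?case unfolding one_free_group by (simp add: parity_def cycle_Nil)
  next
    case (snoc l w)
    note w = free_group_snoc[OF snoc.prems]
    define p where "p = N #>\<^bsub>F\<^esub> w"
    define p' where "p' = p #>\<^bsub>F\<^esub> [l]"
    have p'w: "p' = N #>\<^bsub>F\<^esub> (w @ [l])"
      unfolding p'_def p_def w(3) using w N_subset by (simp add: F.coset_mult_assoc)
    have r: "rep p \<in> carrier F" "N #>\<^bsub>F\<^esub> rep p = p" unfolding p_def using rep[OF w(1)] by blast+
    have r': "rep p' \<in> carrier F" "N #>\<^bsub>F\<^esub> rep p' = p'" unfolding p'w using rep[OF snoc.prems] by blast+
    let ?s = "rep p \<otimes>\<^bsub>F\<^esub> [l] \<otimes>\<^bsub>F\<^esub> inv\<^bsub>F\<^esub> rep p'"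
    have s: "?s \<in> N"
    proof (rule coset_eq_mult_inv)
      show "N #>\<^bsub>F\<^esub> (rep p \<otimes>\<^bsub>F\<^esub> [l]) = N #>\<^bsub>F\<^esub> rep p'"
        using F.coset_mult_assoc[OF N_subset r(1) w(2)] r r' by (simp add: p'_def)
    qed (use r r' w in auto)
    have wr: "w \<otimes>\<^bsub>F\<^esub> inv\<^bsub>F\<^esub> rep p \<in> N" by (rule coset_eq_mult_inv) (use r w in \<open>auto simp: p_def\<close>)
    have cancel: "inv\<^bsub>F\<^esub> rep p \<otimes>\<^bsub>F\<^esub> (rep p \<otimes>\<^bsub>F\<^esub> y) = y" if "y \<in> carrier F" for y
      using r(1) that by (simp flip: F.m_assoc)
    have "(w \<otimes>\<^bsub>F\<^esub> inv\<^bsub>F\<^esub> rep p) \<otimes>\<^bsub>F\<^esub> ?s = (w @ [l]) \<otimes>\<^bsub>F\<^esub> inv\<^bsub>F\<^esub> rep p'"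
      unfolding w(3) using w(1,2) r(1) r'(1) by (simp add: F.m_assoc cancel)
    then have "\<theta> ((w @ [l]) \<otimes>\<^bsub>F\<^esub> inv\<^bsub>F\<^esub> rep p') \<longleftrightarrow> \<theta> (w \<otimes>\<^bsub>F\<^esub> inv\<^bsub>F\<^esub> rep p) \<noteq> \<theta> ?s"
      using \<theta>[OF wr s] by simp
    moreover have "X (if snd l then p else p', fst l) \<longleftrightarrow> \<theta> ?s"
    proof (cases "snd l")
      case True
      then have "l = (fst l, True)" by (metis prod.collapse)
      then show ?thesis using True by (simp add: X_def p'_def)
    next
      case False
      then have l: "l = (fst l, False)" by (metis prod.collapse)
      have c: "[(fst l, True)] \<in> carrier F" using w(2) by (cases l) (simp add: carrier_free_group)
      have il: "inv\<^bsub>F\<^esub> [l] = [(fst l, True)]" using w(2) l by (cases l) (simp add: inv_free_group inv_letter_def)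
      have pc: "p \<subseteq> carrier F" unfolding p_def by (rule F.r_coset_subset_G[OF N_subset w(1)])
      have "p' #>\<^bsub>F\<^esub> [(fst l, True)] = p #>\<^bsub>F\<^esub> ([l] \<otimes>\<^bsub>F\<^esub> inv\<^bsub>F\<^esub> [l])"
        unfolding p'_def il using pc w(2) c by (rule F.coset_mult_assoc)
      then have "p' #>\<^bsub>F\<^esub> [(fst l, True)] = p" using w(2) pc by simp
      then have "X (p', fst l) \<longleftrightarrow> \<theta> (rep p' \<otimes>\<^bsub>F\<^esub> inv\<^bsub>F\<^esub> [l] \<otimes>\<^bsub>F\<^esub> inv\<^bsub>F\<^esub> rep p)"
        by (simp add: X_def il)
      also have "rep p' \<otimes>\<^bsub>F\<^esub> inv\<^bsub>F\<^esub> [l] \<otimes>\<^bsub>F\<^esub> inv\<^bsub>F\<^esub> rep p = inv\<^bsub>F\<^esub> ?s"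
        using w(2) r r' by (simp add: F.inv_mult_group F.m_assoc)
      finally show ?thesis using \<theta>inv[OF s] False by simp
    qed
    moreover have "parity X (w @ [l]) \<longleftrightarrow> parity X w \<noteq> X (if snd l then p else p', fst l)"
    proof -
      let ?e = "(if snd l then p else p', fst l)"
      have "cycle N (w @ [l]) = sym_diff (cycle N w) {?e}"
        using cycle_snoc[OF snoc.prems N_subset] by (simp add: p_def p'_def)
      moreover have "{e \<in> {?e}. X e} = (if X ?e then {?e} else {})" by auto
      ultimately show ?thesis
        unfolding parity_def using parity_sym_diff[OF finite_cycle[OF w(1) N_subset], of "{?e}" X] by simp
    qed
    ultimately show ?case using snoc.IH[OF w(1)] unfolding p'w[symmetric] p_def[symmetric] by blast
  qed
  have "\<theta> n \<longleftrightarrow> parity X n" if "n \<in> N" for n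
    using main[OF N_closed[OF that]] N_coset[OF that] N_closed[OF that] by (simp add: rep_def)
  then show ?thesis using that by blast
qed

text \<open>Every homomorphism to Z/2 is a parity and vanishes on an empty cycle; conversely, the
  parity for a single edge of the cycle does not vanish. This intrinsic description makes emptiness
  stable under endomorphisms that preserve \<open>N\<close>.\<close>

lemma cycle_empty_iff:
  assumes "n \<in> N"
  shows "cycle N n = {} \<longleftrightarrow> (\<forall>\<theta>. (\<forall>n\<in>N. \<forall>m\<in>N. \<theta> (n \<otimes>\<^bsub>F\<^esub> m) \<longleftrightarrow> \<theta> n \<noteq> \<theta> m) \<longrightarrow> \<not> \<theta> n)"
proof
  assume empty: "cycle N n = {}"
  show "\<forall>\<theta>. (\<forall>n\<in>N. \<forall>m\<in>N. \<theta> (n \<otimes>\<^bsub>F\<^esub> m) \<longleftrightarrow> \<theta> n \<noteq> \<theta> m) \<longrightarrow> \<not> \<theta> n"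
  proof (intro allI impI)
    fix \<theta> assume "\<forall>n\<in>N. \<forall>m\<in>N. \<theta> (n \<otimes>\<^bsub>F\<^esub> m) \<longleftrightarrow> \<theta> n \<noteq> \<theta> m"
    then obtain X where "\<And>n. n \<in> N \<Longrightarrow> \<theta> n \<longleftrightarrow> parity X n" using hom_eq_parity[of \<theta>] by blast
    then show "\<not> \<theta> n" using assms empty by (simp add: parity_def)
  qed
next
  assume hom: "\<forall>\<theta>. (\<forall>n\<in>N. \<forall>m\<in>N. \<theta> (n \<otimes>\<^bsub>F\<^esub> m) \<longleftrightarrow> \<theta> n \<noteq> \<theta> m) \<longrightarrow> \<not> \<theta> n"
  show "cycle N n = {}"
  proof (rule ccontr)
    assume "cycle N n \<noteq> {}"
    then obtain e where e: "e \<in> cycle N n" by blast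
    have "\<not> parity (\<lambda>x. x = e) n" using hom parity_mult by blast
    moreover have "{x \<in> cycle N n. x = e} = {e}" using e by blast
    ultimately show False by (simp add: parity_def)
  qed
qed

lemma cycle_hom_empty:
  assumes f: "f \<in> hom F F" "f ` N \<subseteq> N" and n: "n \<in> N" "cycle N n = {}"
  shows "cycle N (f n) = {}"
proof -
  have fn: "f n \<in> N" using f(2) n(1) by blast
  show ?thesis
    unfolding cycle_empty_iff[OF fn]
  proof (intro allI impI)
    fix \<theta> assume \<theta>: "\<forall>n\<in>N. \<forall>m\<in>N. \<theta> (n \<otimes>\<^bsub>F\<^esub> m) \<longleftrightarrow> \<theta> n \<noteq> \<theta> m"
    have "(\<theta> \<circ> f) (n \<otimes>\<^bsub>F\<^esub> m) \<longleftrightarrow> (\<theta> \<circ> f) n \<noteq> (\<theta> \<circ> f) m" if "n \<in> N" "m \<in> N" for n m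
      using \<theta> f(2) that hom_mult[OF f(1) N_closed[OF that(1)] N_closed[OF that(2)]] by (simp add: image_subset_iff)
    then have "\<not> (\<theta> \<circ> f) n"
      using spec[OF n(2)[unfolded cycle_empty_iff[OF n(1)]], of "\<theta> \<circ> f"] by simp
    then show "\<not> \<theta> (f n)" by simp
  qed
qed

text \<open>As \<open>h\<close> vanishes on \<open>N\<close>, it defines a height on cosets.
  Conjugation by the \<open>k\<close>-th power of \<open>g\<close> raises all heights by
  \<open>k\<close>, and a finite nonempty cycle has a maximal height.\<close>

lemma cycle_pow_conjugate_distinct:
  assumes ker: "N \<subseteq> chars_ker F" and h: "h \<in> int_chars F" and g: "g \<in> carrier F" "h g = 1"
    and n: "n \<in> N" "cycle N n \<noteq> {}" and ij: "(i :: int) \<noteq> j"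
  shows "cycle N (conjugate F (g [^]\<^bsub>F\<^esub> i) n) \<noteq> cycle N (conjugate F (g [^]\<^bsub>F\<^esub> j) n)"
proof
  assume eq: "cycle N (conjugate F (g [^]\<^bsub>F\<^esub> i) n) = cycle N (conjugate F (g [^]\<^bsub>F\<^esub> j) n)"
  have hadd: "h (x \<otimes>\<^bsub>F\<^esub> y) = h x + h y" if "x \<in> carrier F" "y \<in> carrier F" for x y
    using h that by (simp add: int_chars_def)
  have pow: "g [^]\<^bsub>F\<^esub> (k :: int) \<in> carrier F" for k using g(1) by (rule F.int_pow_closed)
  have "g [^]\<^bsub>F\<^esub> (k + 1 :: int) = g [^]\<^bsub>F\<^esub> k \<otimes>\<^bsub>F\<^esub> g" for k
    unfolding F.int_pow_mult[OF g(1)] using g(1) by simp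
  then have hsuc: "h (g [^]\<^bsub>F\<^esub> (k + 1 :: int)) = h (g [^]\<^bsub>F\<^esub> k) + 1" for k
    using hadd[OF pow g(1)] g(2) by simp
  have hpow: "h (g [^]\<^bsub>F\<^esub> (k :: int)) = k" for k
  proof (induction k rule: int_induct[where k = 0])
    case base
    then show ?case using F.int_chars_one[OF h] by simp
  next
    case (step1 i)
    then show ?case using hsuc[of i] by simp
  next
    case (step2 i)
    then show ?case using hsuc[of "i - 1"] by simp
  qed
  define ht where "ht e = h (SOME x. x \<in> fst e)" for e :: "'a letter list set \<times> 'a"
  have coset: "h y = h x" if y: "y \<in> N #>\<^bsub>F\<^esub> x" and x: "x \<in> carrier F" for x y
  proof -
    obtain m where "m \<in> N" "y = m \<otimes>\<^bsub>F\<^esub> x" using y unfolding r_coset_def by blast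
    moreover from this have "h m = 0" using ker h by (auto simp: chars_ker_def)
    ultimately show ?thesis using hadd[of m x] x N_closed[of m] by simp
  qed
  have ht: "ht (N #>\<^bsub>F\<^esub> x, s) = h x" if "x \<in> carrier F" for x s
    unfolding ht_def fst_conv
    by (rule coset[OF someI[of "\<lambda>y. y \<in> N #>\<^bsub>F\<^esub> x", OF F.rcos_self[OF that sub_N]] that])
  have tr: "ht (translate (g [^]\<^bsub>F\<^esub> k) e) = k + ht e" if e: "e \<in> cycle N n" for k e
  proof -
    obtain x s where x: "e = (N #>\<^bsub>F\<^esub> x, s)" "x \<in> carrier F"
      using cycle_cosets[OF N_closed[OF n(1)]] e by blast
    have c: "g [^]\<^bsub>F\<^esub> k \<in> carrier F" using g by simp
    have "g [^]\<^bsub>F\<^esub> k <#\<^bsub>F\<^esub> (N #>\<^bsub>F\<^esub> x) = N #>\<^bsub>F\<^esub> (g [^]\<^bsub>F\<^esub> k \<otimes>\<^bsub>F\<^esub> x)"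
      unfolding l_r_coset[OF c x(2) N_subset, symmetric]
        bspec[OF normal.coset_eq[OF normal_N] c, symmetric] F.coset_mult_assoc[OF N_subset c x(2)] ..
    then have "translate (g [^]\<^bsub>F\<^esub> k) e = (N #>\<^bsub>F\<^esub> (g [^]\<^bsub>F\<^esub> k \<otimes>\<^bsub>F\<^esub> x), s)" by (simp add: translate_def x)
    then show ?thesis using hadd[OF c x(2)] c x hpow[of k] by (simp add: ht)
  qed
  let ?H = "ht ` cycle N n"
  have im: "ht ` cycle N (conjugate F (g [^]\<^bsub>F\<^esub> k) n) = (+) k ` ?H" for k :: int
    unfolding cycle_conjugate[OF F.int_pow_closed[OF g(1)] n(1)] image_image using tr by auto
  have fin: "finite ?H" "?H \<noteq> {}" using finite_cycle_N n by auto
  have mx: "Max ((+) k ` ?H) = k + Max ?H" for k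
    using mono_Max_commute[of "(+) k" ?H] fin by (simp add: mono_def)
  have "(+) i ` ?H = (+) j ` ?H" unfolding im[symmetric] eq ..
  then have "i + Max ?H = j + Max ?H" unfolding mx[symmetric] by (rule arg_cong)
  then show False using ij by simp
qed

end

section \<open>The kernel of a random homomorphism to Z/2\<close>

definition coin :: "bool measure" where
  "coin = measure_pmf (bernoulli_pmf (1 / 2))"

lemma prob_space_coin: "prob_space coin"
  unfolding coin_def by (rule measure_pmf.prob_space_axioms)

lemma space_coin [simp]: "space coin = UNIV" and sets_coin [simp]: "sets coin = UNIV"
  by (simp_all add: coin_def)

definition sign :: "bool \<Rightarrow> complex" where
  "sign b = (if b then - 1 else 1)"

lemma integral_sign_coin: "integrable coin sign" "(\<integral>b. sign b \<partial>coin) = 0"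
proof -
  show "integrable coin sign"
    unfolding coin_def by (rule integrable_measure_pmf_finite) simp
  show "(\<integral>b. sign b \<partial>coin) = 0"
    unfolding coin_def by (subst integral_measure_pmf[of UNIV]) (auto simp: sign_def UNIV_bool)
qed

definition coins :: "('i \<Rightarrow> bool) measure" where
  "coins = PiM UNIV (\<lambda>_. coin)"

lemma product_prob_space_coin: "product_prob_space (\<lambda>_. coin)"
  by (simp add: product_prob_space_def product_sigma_finite_def product_prob_space_axioms_def
      prob_space_coin prob_space_imp_sigma_finite)

lemma prob_space_coins: "prob_space coins"
  unfolding coins_def by (intro prob_space_PiM prob_space_coin)

lemma space_coins [simp]: "space coins = UNIV"
  by (simp add: coins_def space_PiM)

lemma measurable_coins [measurable]: "(\<lambda>X. X i) \<in> measurable coins coin"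
  unfolding coins_def by (rule measurable_component_singleton) simp

lemma measurable_sign_coins [measurable]: "(\<lambda>X. sign (X i)) \<in> borel_measurable coins"
proof -
  have "sign \<in> borel_measurable coin" by (rule measurableI) simp_all
  then show ?thesis by (rule measurable_compose[OF measurable_coins])
qed

text \<open>The product depends on finitely many independent fair coins, so its mean is the product
  of their means, each of which is 0.\<close>

lemma integral_prod_sign:
  assumes "finite C"
  shows "(\<integral>X. (\<Prod>i\<in>C. sign (X i)) \<partial>coins) = (if C = {} then 1 else 0)"
proof -
  interpret P: product_prob_space "\<lambda>_. coin" UNIV by (rule product_prob_space_coin)
  have "(\<integral>X. (\<Prod>i\<in>C. sign (X i)) \<partial>coins) = (\<integral>X. (\<Prod>i\<in>C. sign (restrict X C i)) \<partial>coins)"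
    by (intro Bochner_Integration.integral_cong prod.cong) auto
  also have "\<dots> = (\<integral>X. (\<Prod>i\<in>C. sign (X i)) \<partial>distr coins (PiM C (\<lambda>_. coin)) (\<lambda>X. restrict X C))"
  proof (rule integral_distr[symmetric])
    show "(\<lambda>X. restrict X C) \<in> measurable coins (PiM C (\<lambda>_. coin))"
      unfolding coins_def by (rule measurable_restrict_subset) simp
    have "sign \<in> borel_measurable coin" by (rule measurableI) simp_all
    then show "(\<lambda>X. \<Prod>i\<in>C. sign (X i)) \<in> borel_measurable (PiM C (\<lambda>_. coin))"
      by (intro borel_measurable_prod measurable_compose[OF measurable_component_singleton]) auto
  qed
  also have "distr coins (PiM C (\<lambda>_. coin)) (\<lambda>X. restrict X C) = PiM C (\<lambda>_. coin)"
    unfolding coins_def using P.distr_PiM_restrict_finite[OF assms] by simp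
  also have "(\<integral>X. (\<Prod>i\<in>C. sign (X i)) \<partial>PiM C (\<lambda>_. coin)) = (\<Prod>i\<in>C. \<integral>b. sign b \<partial>coin)"
    by (rule P.product_integral_prod[OF assms]) (rule integral_sign_coin(1))
  also have "\<dots> = (if C = {} then 1 else 0)" using assms by (simp add: integral_sign_coin(2) card_gt_0_iff)
  finally show ?thesis .
qed

lemma prod_sign:
  assumes "finite C"
  shows "(\<Prod>i\<in>C. sign (X i)) = (if odd (card {i \<in> C. X i}) then - 1 else 1)"
  using assms
proof (induction C rule: finite_induct)
  case (insert i C)
  have "{j \<in> insert i C. X j} = (if X i then insert i {j \<in> C. X j} else {j \<in> C. X j})" by auto
  then show ?case using insert by (simp add: sign_def)
qed simp

lemma sets_Collect_countable_set:
  assumes "countable I" "\<And>i. i \<in> I \<Longrightarrow> {x \<in> space M. P i x} \<in> sets M"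
  shows "{x \<in> space M. \<forall>i\<in>I. P i x} \<in> sets M"
proof (cases "I = {}")
  case False
  then have "{x \<in> space M. \<forall>i\<in>I. P i x} = (\<Inter>i\<in>I. {x \<in> space M. P i x})" by blast
  also have "\<dots> \<in> sets M" using False assms by (intro sets.countable_INT') auto
  finally show ?thesis .
qed simp

text \<open>The defining property of a character holds on a Borel set, hence almost surely for the law of a
  random subgroup that has it everywhere.\<close>

lemma character_measure_distr:
  assumes G: "group G" "countable (carrier G)" "subgroup N G" and M: "prob_space M"
    and K: "K \<in> measurable M (borel_of (Sub G))"
    and char: "\<And>X. X \<in> space M \<Longrightarrow> K X \<subseteq> N"
      "\<And>X n m. X \<in> space M \<Longrightarrow> n \<in> N \<Longrightarrow> m \<in> N \<Longrightarrow> chi (n \<otimes>\<^bsub>G\<^esub> m) (K X) = chi n (K X) * chi m (K X)"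
  shows "character_measure G N (distr M (borel_of (Sub G)) K)"
proof -
  interpret group G by fact
  let ?B = "borel_of (Sub G)"
  have N: "N \<subseteq> carrier G" using G(3) by (rule subgroup.subset)
  have mem: "{H \<in> space ?B. g \<in> H} \<in> sets ?B" if "g \<in> carrier G" for g
    using supergroups_in_sets[of "{g}" G] that by (simp add: supergroups_def)
  then have nmem: "{H \<in> space ?B. g \<notin> H} \<in> sets ?B" if "g \<in> carrier G" for g
    using that by (intro sets.sets_Collect_neg)
  have "{H \<in> space ?B. \<forall>g\<in>carrier G - N. g \<notin> H} \<in> sets ?B"
    using nmem G(2) by (intro sets_Collect_countable_set) auto
  moreover have "{H \<in> space ?B. \<forall>n\<in>N. \<forall>m\<in>N. chi (n \<otimes>\<^bsub>G\<^esub> m) H = chi n H * chi m H} \<in> sets ?B"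
  proof (intro sets_Collect_countable_set)
    fix n m assume "n \<in> N" "m \<in> N"
    then have c: "n \<in> carrier G" "m \<in> carrier G" "n \<otimes>\<^bsub>G\<^esub> m \<in> carrier G" using N by auto
    have "(chi (n \<otimes>\<^bsub>G\<^esub> m) H = chi n H * chi m H) \<longleftrightarrow>
        (n \<otimes>\<^bsub>G\<^esub> m \<in> H \<and> (n \<in> H \<and> m \<in> H \<or> n \<notin> H \<and> m \<notin> H) \<or>
         n \<otimes>\<^bsub>G\<^esub> m \<notin> H \<and> (n \<in> H \<and> m \<notin> H \<or> n \<notin> H \<and> m \<in> H))" for H
      by (auto simp: chi_def)
    then show "{H \<in> space ?B. chi (n \<otimes>\<^bsub>G\<^esub> m) H = chi n H * chi m H} \<in> sets ?B"
      using mem[OF c(1)] mem[OF c(2)] mem[OF c(3)]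
      by (simp only:) (intro sets.sets_Collect_conj sets.sets_Collect_disj sets.sets_Collect_neg; assumption)
  qed (use G(2) N in \<open>auto intro: countable_subset\<close>)
  ultimately have "{H \<in> space ?B. (\<forall>g\<in>carrier G - N. g \<notin> H) \<and>
      (\<forall>n\<in>N. \<forall>m\<in>N. chi (n \<otimes>\<^bsub>G\<^esub> m) H = chi n H * chi m H)} \<in> sets ?B"
    by (intro sets.sets_Collect_conj)
  moreover have "{H \<in> space ?B. H \<subseteq> N \<and> (\<forall>n\<in>N. \<forall>m\<in>N. chi (n \<otimes>\<^bsub>G\<^esub> m) H = chi n H * chi m H)} =
    {H \<in> space ?B. (\<forall>g\<in>carrier G - N. g \<notin> H) \<and> (\<forall>n\<in>N. \<forall>m\<in>N. chi (n \<otimes>\<^bsub>G\<^esub> m) H = chi n H * chi m H)}"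
  proof (rule Collect_cong)
    fix H
    have "(\<forall>g\<in>carrier G - N. g \<notin> H) \<longleftrightarrow> H \<subseteq> N" if "H \<in> space ?B"
      using that by (auto dest: subgroup.subset)
    then show "(H \<in> space ?B \<and> H \<subseteq> N \<and> (\<forall>n\<in>N. \<forall>m\<in>N. chi (n \<otimes>\<^bsub>G\<^esub> m) H = chi n H * chi m H)) =
      (H \<in> space ?B \<and> (\<forall>g\<in>carrier G - N. g \<notin> H) \<and> (\<forall>n\<in>N. \<forall>m\<in>N. chi (n \<otimes>\<^bsub>G\<^esub> m) H = chi n H * chi m H))"
      by (simp cong: conj_cong)
  qed
  ultimately have S: "{H \<in> space ?B. H \<subseteq> N \<and> (\<forall>n\<in>N. \<forall>m\<in>N. chi (n \<otimes>\<^bsub>G\<^esub> m) H = chi n H * chi m H)} \<in> sets ?B"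
    by simp
  have AE: "AE H in distr M ?B K. H \<subseteq> N \<and> (\<forall>n\<in>N. \<forall>m\<in>N. chi (n \<otimes>\<^bsub>G\<^esub> m) H = chi n H * chi m H)"
    unfolding AE_distr_iff[OF K S] using char by (intro AE_I2) blast
  show ?thesis
    by (intro character_measure.intro character_measure_axioms.intro is_group G(2,3) AE
        prob_space.prob_space_distr[OF M K]) simp
qed

section \<open>The random subgroup and its law\<close>

context coset_graph
begin

text \<open>The kernel of \<open>parity X\<close>. Since all homomorphisms arise in this way by
  \<open>hom_eq_parity\<close>, independent fair coins on the edges push forward to Haar measure on
  the homomorphisms from \<open>N\<close> to Z/2.\<close>

definition random_subgroup :: "('a letter list set \<times> 'a \<Rightarrow> bool) \<Rightarrow> 'a letter list set" where
  "random_subgroup X = {n \<in> N. \<not> parity X n}"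

lemma subgroup_random: "subgroup (random_subgroup X) F"
proof (rule F.subgroupI)
  have "\<not> parity X \<one>\<^bsub>F\<^esub>" by (simp add: parity_def one_free_group cycle_Nil)
  then show "random_subgroup X \<noteq> {}"
    using subgroup.one_closed[OF sub_N] by (auto simp: random_subgroup_def)
  fix n m assume n: "n \<in> random_subgroup X" "m \<in> random_subgroup X"
  then show "n \<otimes>\<^bsub>F\<^esub> m \<in> random_subgroup X"
    using subgroup.m_closed[OF sub_N] by (simp add: random_subgroup_def parity_mult)
  show "inv\<^bsub>F\<^esub> n \<in> random_subgroup X"
    using n subgroup.m_inv_closed[OF sub_N] by (simp add: random_subgroup_def parity_def cycle_N_inv)
qed (use N_closed in \<open>auto simp: random_subgroup_def\<close>)

lemma chi_random: "n \<in> N \<Longrightarrow> chi n (random_subgroup X) = (\<Prod>e\<in>cycle N n. sign (X e))"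
  by (simp add: chi_def random_subgroup_def parity_def prod_sign[OF finite_cycle_N])

lemma chi_random_measurable: "n \<in> N \<Longrightarrow> (\<lambda>X. chi n (random_subgroup X)) \<in> borel_measurable coins"
  by (simp add: chi_random borel_measurable_prod)

lemma measurable_random:
  assumes "countable (carrier F)"
  shows "random_subgroup \<in> measurable coins (borel_of (Sub F))"
proof (rule measurable_sigma_sets[OF sets_borel_Sub[OF assms] supergroup_sets_Pow])
  show "random_subgroup \<in> space coins \<rightarrow> {H. subgroup H F}" using subgroup_random by simp
  have mem: "{X \<in> space coins. g \<in> random_subgroup X} \<in> sets coins" for g
  proof (cases "g \<in> N")
    case True
    have "(\<lambda>X. chi g (random_subgroup X)) -` {1} \<inter> space coins \<in> sets coins"
      by (rule measurable_sets[OF chi_random_measurable[OF True]]) simp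
    moreover have "(\<lambda>X. chi g (random_subgroup X)) -` {1} \<inter> space coins = {X \<in> space coins. g \<in> random_subgroup X}"
      by (auto simp: chi_def split: if_splits)
    ultimately show ?thesis by simp
  next
    case False
    then show ?thesis by (simp add: random_subgroup_def)
  qed
  fix Y assume "Y \<in> supergroup_sets F"
  then obtain A where Y: "Y = supergroups F A" "finite A" by blast
  have "{X \<in> space coins. \<forall>g\<in>A. g \<in> random_subgroup X} \<in> sets coins"
    by (rule sets_Collect_countable_set[OF countable_finite[OF Y(2)] mem])
  moreover have "random_subgroup -` Y \<inter> space coins = {X \<in> space coins. \<forall>g\<in>A. g \<in> random_subgroup X}"
    using subgroup_random by (auto simp: Y supergroups_def)
  ultimately show "random_subgroup -` Y \<inter> space coins \<in> sets coins" by simp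
qed

definition law :: "'a letter list set measure" where
  "law = distr coins (borel_of (Sub F)) random_subgroup"

lemma integral_chi_random:
  "n \<in> N \<Longrightarrow> (\<integral>X. chi n (random_subgroup X) \<partial>coins) = (if cycle N n = {} then 1 else 0)"
  by (simp add: chi_random integral_prod_sign finite_cycle_N)

end

lemma countable_free_group: "countable S \<Longrightarrow> countable (carrier (free_group S))"
proof -
  assume "countable S"
  then have "countable (lists (S \<times> (UNIV :: bool set)))" by (intro countable_lists countable_SIGMA) auto
  then show ?thesis by (rule countable_subset[rotated]) (auto simp: carrier_free_group)
qed

section \<open>Characteristic random subgroups from fully invariant subgroups\<close>

locale invariant_coset_graph = coset_graph +
  fixes a :: 'a
  assumes countable_S: "countable S" and a: "a \<in> S"
    and invariant: "\<And>f. f \<in> hom F F \<Longrightarrow> f ` N \<subseteq> N"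
    and ker: "N \<subseteq> chars_ker F"
    and nontriv: "\<exists>\<theta> n. (\<forall>n\<in>N. \<forall>m\<in>N. \<theta> (n \<otimes>\<^bsub>F\<^esub> m) \<longleftrightarrow> \<theta> n \<noteq> \<theta> m) \<and> n \<in> N \<and> \<theta> n"
begin

lemma count: "countable (carrier F)"
  by (rule countable_free_group[OF countable_S])

text \<open>Invariance applies to \<open>\<phi>\<close> and to its inverse, which turns the
  inclusion into an equality and the implication into an equivalence.\<close>

lemma auto_image:
  assumes "\<phi> \<in> auto F"
  shows "\<phi> ` N = N"
    and "n \<in> N \<Longrightarrow> cycle N (\<phi> n) = {} \<longleftrightarrow> cycle N n = {}"
proof -
  have \<phi>: "\<phi> \<in> hom F F" "\<phi> \<in> Bij (carrier F)" using assms by (auto simp: auto_def)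
  define \<psi> where "\<psi> = restrict (inv_into (carrier F) \<phi>) (carrier F)"
  have \<psi>: "\<psi> \<in> hom F F" unfolding \<psi>_def by (rule F.restrict_inv_into_hom[OF \<phi>])
  have bij: "bij_betw \<phi> (carrier F) (carrier F)" using \<phi>(2) by (simp add: Bij_def)
  have \<phi>\<psi>: "\<phi> (\<psi> n) = n" and \<psi>\<phi>: "\<psi> (\<phi> n) = n" if "n \<in> N" for n
    using bij N_closed[OF that] bij_betwE[OF bij]
    by (auto simp: \<psi>_def bij_betw_inv_into_left bij_betw_inv_into_right)
  show im: "\<phi> ` N = N"
  proof
    show "N \<subseteq> \<phi> ` N"
    proof
      fix n assume n: "n \<in> N"
      then have "\<psi> n \<in> N" using invariant[OF \<psi>] by blast
      then show "n \<in> \<phi> ` N" using \<phi>\<psi>[OF n] by (metis imageI)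
    qed
  qed (rule invariant[OF \<phi>(1)])
  assume n: "n \<in> N"
  then have "\<phi> n \<in> N" using im by blast
  then show "cycle N (\<phi> n) = {} \<longleftrightarrow> cycle N n = {}"
    using cycle_hom_empty[OF \<phi>(1) invariant[OF \<phi>(1)] n] cycle_hom_empty[OF \<psi> invariant[OF \<psi>], of "\<phi> n"] \<psi>\<phi>[OF n]
    by auto
qed

lemma character_measure_law: "character_measure F N law"
  unfolding law_def
proof (rule character_measure_distr[OF F.is_group count sub_N prob_space_coins measurable_random[OF count]])
  fix X n m assume nm: "n \<in> N" "m \<in> N"
  then show "chi (n \<otimes>\<^bsub>F\<^esub> m) (random_subgroup X) = chi n (random_subgroup X) * chi m (random_subgroup X)"
    using subgroup.m_closed[OF sub_N] by (simp add: chi_def random_subgroup_def parity_mult)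
qed (auto simp: random_subgroup_def)

sublocale character_measure F N law
  by (rule character_measure_law)

lemma integral_chi_law: "n \<in> N \<Longrightarrow> (\<integral>H. chi n H \<partial>law) = (if cycle N n = {} then 1 else 0)"
proof -
  assume n: "n \<in> N"
  have "chi n \<in> borel_measurable (borel_of (Sub F))"
    using chi_measurable[OF N_closed[OF n]] measurable_cong_sets[OF sets_mu refl] by blast
  then have "(\<integral>H. chi n H \<partial>law) = (\<integral>X. chi n (random_subgroup X) \<partial>coins)"
    unfolding law_def by (rule integral_distr[OF measurable_random[OF count]])
  then show ?thesis using integral_chi_random[OF n] by simp
qed

text \<open>The image measure again lives on kernels of characters of \<open>N\<close>, and its
  Fourier coefficients agree with those of \<open>law\<close>, because \<open>\<phi>\<close>
  preserves the emptiness of cycles.\<close>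

lemma law_invariant:
  assumes \<phi>: "\<phi> \<in> auto F"
  shows "distr law law (\<lambda>H. \<phi> ` H) = law"
proof -
  let ?B = "borel_of (Sub F)"
  let ?K = "\<lambda>X. \<phi> ` random_subgroup X"
  have bij: "bij_betw \<phi> (carrier F) (carrier F)" and hom: "\<phi> \<in> hom F F"
    using \<phi> by (auto simp: auto_def Bij_def)
  note m\<phi> = measurable_Aut_Sub[OF F.is_group \<phi>]
  have chi_image: "chi (\<phi> m) (?K X) = chi m (random_subgroup X)" if "m \<in> N" for m X
  proof -
    have "random_subgroup X \<subseteq> carrier F" using N_closed by (auto simp: random_subgroup_def)
    then have "\<phi> m \<in> ?K X \<longleftrightarrow> m \<in> random_subgroup X"
      by (rule inj_on_image_mem_iff[OF bij_betw_imp_inj_on[OF bij] N_closed[OF that]])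
    then show ?thesis by (simp add: chi_def)
  qed
  have K: "?K \<in> measurable coins ?B"
    using measurable_compose[OF measurable_random[OF count] m\<phi>] by simp
  have "distr law law (\<lambda>H. \<phi> ` H) = distr law ?B (\<lambda>H. \<phi> ` H)"
    by (rule distr_cong) (simp_all add: law_def)
  also have "\<dots> = distr coins ?B ?K"
    unfolding law_def by (subst distr_distr[OF m\<phi> measurable_random[OF count]]) (simp add: comp_def)
  finally have eq: "distr law law (\<lambda>H. \<phi> ` H) = distr coins ?B ?K" .
  have pre: "\<exists>m\<in>N. n = \<phi> m" if "n \<in> N" for n using auto_image(1)[OF \<phi>] that by blast
  have c: "character_measure F N (distr coins ?B ?K)"
  proof (rule character_measure_distr[OF F.is_group count sub_N prob_space_coins K])
    show "?K X \<subseteq> N" for X using auto_image(1)[OF \<phi>] by (auto simp: random_subgroup_def)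
    fix X n n' assume "n \<in> N" "n' \<in> N"
    then obtain m m' where m: "m \<in> N" "n = \<phi> m" "m' \<in> N" "n' = \<phi> m'" using pre by blast
    then have "n \<otimes>\<^bsub>F\<^esub> n' = \<phi> (m \<otimes>\<^bsub>F\<^esub> m')" using hom_mult[OF hom N_closed N_closed] by simp
    moreover have "chi (m \<otimes>\<^bsub>F\<^esub> m') (random_subgroup X) = chi m (random_subgroup X) * chi m' (random_subgroup X)"
      using m subgroup.m_closed[OF sub_N] by (simp add: chi_def random_subgroup_def parity_mult)
    ultimately show "chi (n \<otimes>\<^bsub>F\<^esub> n') (?K X) = chi n (?K X) * chi n' (?K X)"
      using m subgroup.m_closed[OF sub_N] by (simp add: chi_image)
  qed
  interpret K: character_measure F N "distr coins ?B ?K" by (rule c)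
  have "distr coins ?B ?K = law"
  proof (rule character_measure_eqI[OF c character_measure_law])
    fix n assume n: "n \<in> N"
    then obtain m where m: "m \<in> N" "n = \<phi> m" using pre by blast
    have "chi n \<in> borel_measurable ?B"
      using K.chi_measurable[OF N_closed[OF n]] measurable_cong_sets[OF K.sets_mu refl] by blast
    then have "(\<integral>H. chi n H \<partial>distr coins ?B ?K) = (\<integral>X. chi n (?K X) \<partial>coins)"
      by (rule integral_distr[OF K])
    also have "\<dots> = (if cycle N m = {} then 1 else 0)"
      unfolding m(2) by (simp add: chi_image[OF m(1)] integral_chi_random[OF m(1)])
    also have "\<dots> = (if cycle N n = {} then 1 else 0)"
      unfolding m(2) using auto_image(2)[OF \<phi> m(1)] by simp
    finally show "(\<integral>H. chi n H \<partial>distr coins ?B ?K) = (\<integral>H. chi n H \<partial>law)"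
      using integral_chi_law[OF n] by simp
  qed
  then show ?thesis using eq by simp
qed

lemma generator_char: "\<exists>h\<in>int_chars F. h [(a, True)] = 1"
proof -
  \<comment> \<open>The exponent sum of the generator \<open>a\<close>.\<close>
  let ?h = "\<lambda>w. \<Sum>l\<leftarrow>w. if fst l = a then if snd l then 1 else - 1 else (0 :: int)"
  have rc: "?h (red_cons l w) = ?h [l] + ?h w" for l w
    by (cases w) (auto simp: inv_letter_def)
  have "?h (foldr red_cons u v) = ?h u + ?h v" for u v
    by (induction u) (auto simp: rc)
  then have "?h \<in> int_chars F" by (simp add: int_chars_def mult_free_group)
  then show ?thesis by (intro bexI[of _ ?h]) simp
qed

sublocale mixing: mixing_character_measure F N law "{n. cycle N n = {}}" "[(a, True)]"
proof unfold_locales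
  show "[(a, True)] \<in> carrier F" using a by (simp add: carrier_free_group)
  show norm: "conjugate F g n \<in> N" if "g \<in> carrier F" "n \<in> N" for g n
    using invariant F.conj_auto[OF that(1)] that(2) by (auto simp: auto_def)
  show "distr law law (\<lambda>H. conjugate F g ` H) = law" if "g \<in> carrier F" for g
    by (rule law_invariant[OF F.conj_auto[OF that]])
  show "(\<integral>H. chi n H \<partial>law) = (if n \<in> {n. cycle N n = {}} then 1 else 0)" if "n \<in> N" for n
    using integral_chi_law[OF that] by simp
  show "conjugate F ([(a, True)] [^]\<^bsub>F\<^esub> i) n \<otimes>\<^bsub>F\<^esub> inv\<^bsub>F\<^esub> conjugate F ([(a, True)] [^]\<^bsub>F\<^esub> j) n \<notin> {n. cycle N n = {}}"
    if n: "n \<in> N - {n. cycle N n = {}}" and ij: "i \<noteq> j" for n and i j :: int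
  proof -
    have g: "[(a, True)] \<in> carrier F" using a by (simp add: carrier_free_group)
    have c: "conjugate F ([(a, True)] [^]\<^bsub>F\<^esub> k) n \<in> N" for k :: int
      using norm[OF F.int_pow_closed[OF g]] n by blast
    obtain h where "h \<in> int_chars F" "h [(a, True)] = 1" using generator_char by blast
    then have "cycle N (conjugate F ([(a, True)] [^]\<^bsub>F\<^esub> i) n) \<noteq> cycle N (conjugate F ([(a, True)] [^]\<^bsub>F\<^esub> j) n)"
      using cycle_pow_conjugate_distinct[OF ker _ g] n ij by blast
    then have "sym_diff (cycle N (conjugate F ([(a, True)] [^]\<^bsub>F\<^esub> i) n)) (cycle N (conjugate F ([(a, True)] [^]\<^bsub>F\<^esub> j) n)) \<noteq> {}"
      by blast
    then show ?thesis
      using cycle_N_mult[OF c subgroup.m_inv_closed[OF sub_N c]] cycle_N_inv[OF c] by simp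
  qed
  obtain \<theta> n where \<theta>: "\<forall>n\<in>N. \<forall>m\<in>N. \<theta> (n \<otimes>\<^bsub>F\<^esub> m) \<longleftrightarrow> \<theta> n \<noteq> \<theta> m" and n: "n \<in> N" "\<theta> n"
    using nontriv by (elim exE conjE)
  have "cycle N n \<noteq> {}"
  proof
    assume "cycle N n = {}"
    from mp[OF spec[OF iffD1[OF cycle_empty_iff[OF n(1)] this]] \<theta>] show False using n(2) by blast
  qed
  then show "N - {n. cycle N n = {}} \<noteq> {}" using n(1) by blast
qed

lemma continuous_law: "continuous_CRS F law"
  unfolding continuous_CRS_def CRS_def
  using prob sets_mu law_invariant mixing.no_atoms by (simp add: AutoGroup_def)

text \<open>For \<open>n\<close> in \<open>N\<close>, half of one plus the mean of
  \<open>chi n\<close> is the probability of \<open>n \<in> H\<close>, hence 1 or 1/2; for other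
  \<open>n\<close> it is 0. This recovers \<open>N\<close> from the measure.\<close>

lemma mem_iff_law:
  assumes "n \<in> carrier F"
  shows "n \<in> N \<longleftrightarrow> emeasure law (supergroups F {n}) \<noteq> 0"
proof
  assume n: "n \<in> N"
  have "(\<integral>H. 1 * chi \<one>\<^bsub>F\<^esub> H * indicator (supergroups F (insert n {})) H \<partial>law) =
      ((\<integral>H. 1 * chi \<one>\<^bsub>F\<^esub> H * indicator (supergroups F {}) H \<partial>law) + (\<integral>H. 1 * chi (\<one>\<^bsub>F\<^esub> \<otimes>\<^bsub>F\<^esub> n) H * indicator (supergroups F {}) H \<partial>law)) / 2"
    using integral_insert[of "\<lambda>_. 1" "\<one>\<^bsub>F\<^esub>" "{}" n] subgroup.one_closed[OF sub_N] n assms by simp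
  moreover have "(\<integral>H. 1 * chi m H * indicator (supergroups F {}) H \<partial>law) = (\<integral>H. chi m H \<partial>law)" for m
    by (intro Bochner_Integration.integral_cong) (auto simp: supergroups_def space_mu)
  moreover have "(\<integral>H. 1 * chi \<one>\<^bsub>F\<^esub> H * indicator (supergroups F (insert n {})) H \<partial>law) = (\<integral>H. indicator (supergroups F {n}) H \<partial>law)"
    by (intro Bochner_Integration.integral_cong)
      (auto simp: supergroups_def space_mu indicator_def chi_def subgroup.one_closed)
  moreover have "cycle N \<one>\<^bsub>F\<^esub> = {}" by (simp add: one_free_group cycle_Nil)
  ultimately have "complex_of_real (measure law (supergroups F {n})) = (1 + (if cycle N n = {} then 1 else 0)) / 2"
    using supergroups_sets[of "{n}"] assms n integral_chi_law subgroup.one_closed[OF sub_N]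
    by (simp add: integral_indicator_complex)
  then have "measure law (supergroups F {n}) \<noteq> 0" by (auto split: if_splits)
  then show "emeasure law (supergroups F {n}) \<noteq> 0" by (simp add: emeasure_eq_measure)
next
  assume "emeasure law (supergroups F {n}) \<noteq> 0"
  moreover have "emeasure law (supergroups F {n}) = 0" if "n \<notin> N"
  proof -
    have "random_subgroup -` supergroups F {n} \<inter> space coins = {}"
      using that by (auto simp: supergroups_def random_subgroup_def)
    moreover have "supergroups F {n} \<in> sets (borel_of (Sub F))" using assms by (intro supergroups_in_sets) auto
    ultimately show ?thesis
      unfolding law_def by (simp add: emeasure_distr[OF measurable_random[OF count]])
  qed
  ultimately show "n \<in> N" by blast
qed

end

section \<open>Counting\<close>

text \<open>The values on the countably many sets \<open>supergroups G A\<close> determine the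
  measure, and the rationals above each value encode them as a set of natural numbers.\<close>

lemma CRS_lepoll:
  fixes G :: "('a, 'm) monoid_scheme"
  assumes count: "countable (carrier G)"
  shows "{\<mu>. CRS G \<mu>} \<lesssim> (UNIV :: nat set set)"
proof -
  let ?K = "{A. finite A \<and> A \<subseteq> carrier G} \<times> (UNIV :: rat set)"
  have "countable ?K" using countable_Collect_finite_subset[OF count] by blast
  then obtain c :: "'a set \<times> rat \<Rightarrow> nat" where c: "inj_on c ?K" by (rule countableE)
  define \<Phi> where "\<Phi> \<mu> = c ` {(A, r) \<in> ?K. measure \<mu> (supergroups G A) < real_of_rat r}" for \<mu>
  have "inj_on \<Phi> {\<mu>. CRS G \<mu>}"
  proof (rule inj_onI)
    fix \<mu> \<nu> assume "\<mu> \<in> {\<mu>. CRS G \<mu>}" "\<nu> \<in> {\<mu>. CRS G \<mu>}" and eq: "\<Phi> \<mu> = \<Phi> \<nu>"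
    then have \<mu>: "prob_space \<mu>" "sets \<mu> = sets (borel_of (Sub G))"
      and \<nu>: "prob_space \<nu>" "sets \<nu> = sets (borel_of (Sub G))"
      by (auto simp: CRS_def)
    interpret M: prob_space \<mu> by fact
    interpret K: prob_space \<nu> by fact
    have "{(A, r) \<in> ?K. measure \<mu> (supergroups G A) < real_of_rat r} =
        {(A, r) \<in> ?K. measure \<nu> (supergroups G A) < real_of_rat r}"
      using eq unfolding \<Phi>_def by (rule inj_on_image_eq_iff[OF c, THEN iffD1, rotated 2]) auto
    then have iff: "measure \<mu> (supergroups G A) < real_of_rat r \<longleftrightarrow> measure \<nu> (supergroups G A) < real_of_rat r"
      if "finite A" "A \<subseteq> carrier G" for A r
      using that by blast
    have "measure \<mu> (supergroups G A) = measure \<nu> (supergroups G A)" if A: "finite A" "A \<subseteq> carrier G" for A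
    proof (rule ccontr)
      assume "measure \<mu> (supergroups G A) \<noteq> measure \<nu> (supergroups G A)"
      then consider "measure \<mu> (supergroups G A) < measure \<nu> (supergroups G A)"
        | "measure \<nu> (supergroups G A) < measure \<mu> (supergroups G A)" by linarith
      then show False
        by cases (use of_rat_dense iff[OF A] in \<open>metis order_less_asym\<close>)+
    qed
    then show "\<mu> = \<nu>"
      by (intro measure_Sub_eqI[OF count \<mu>(1,2) \<nu>(2)]) (simp add: M.emeasure_eq_measure K.emeasure_eq_measure)
  qed
  then show ?thesis unfolding lepoll_def by blast
qed

section \<open>Separating the subgroups\<close>

lemma pattern_machine:
  assumes ab: "a \<in> S" "b \<in> S" "a \<noteq> b" and n: "prime n"
  obtains pt where "machine S a b (lamp_pattern n) pt"
proof -
  \<comment> \<open>A lit lamp to serve as \<open>pt\<close> is found in row 3, or in row 5 if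
    \<open>n = 3\<close>.\<close>
  have "\<exists>q :: nat. prime q \<and> odd q \<and> q \<noteq> n"
  proof (cases "n = 3")
    case True
    then show ?thesis by (intro exI[of _ 5]) simp
  next
    case False
    then show ?thesis by (intro exI[of _ 3]) simp
  qed
  then obtain q :: nat where "prime q" "odd q" "q \<noteq> n" by blast
  from lamp_pattern_neq[OF this(1,2) n this(3)] obtain r where "(q, r) \<in> lamp_pattern n" by blast
  then have "machine S a b (lamp_pattern n) (q, r)" using ab by unfold_locales
  then show ?thesis by (rule that)
qed

text \<open>This relator detects whether \<open>n\<close> belongs to \<open>D\<close>. Both words
  are determined by \<open>S\<close>, \<open>a\<close> and \<open>b\<close>, so it is named before
  the lamps of a machine are chosen.\<close>

definition witness :: "'a set \<Rightarrow> 'a \<Rightarrow> 'a \<Rightarrow> nat \<Rightarrow> 'a letter list" where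
  "witness S a b n = twisted_comm (free_group S) (machine.base_word S a b) (machine.mod_word S a b n)"

lemma witness_in:
  assumes ab: "a \<in> S" "b \<in> S" "a \<noteq> b" and n: "prime n" "n \<in> D"
  shows "witness S a b n \<in> rel_subgroup (free_group S) D"
proof -
  obtain pt where "machine S a b (lamp_pattern n) pt" using pattern_machine[OF ab n(1)] .
  then interpret machine S a b "lamp_pattern n" pt .
  show ?thesis unfolding witness_def by (rule twisted_in_rel[OF n(2)])
qed

text \<open>Every \<open>q\<close> in \<open>D\<close> is an odd prime different from
  \<open>n\<close>, so \<open>lamp_pattern n\<close> has a lit lamp in row \<open>q\<close>, and the
  central bit of the machine for this pattern vanishes on the subgroup. On the witness it does
  not.\<close>

lemma witness_notin:
  assumes ab: "a \<in> S" "b \<in> S" "a \<noteq> b" and n: "prime n" "n \<notin> D" and D: "\<And>q. q \<in> D \<Longrightarrow> prime q \<and> odd q"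
  shows "witness S a b n \<notin> rel_subgroup (free_group S) D"
proof
  assume w: "witness S a b n \<in> rel_subgroup (free_group S) D"
  obtain pt where "machine S a b (lamp_pattern n) pt" using pattern_machine[OF ab n(1)] .
  then interpret machine S a b "lamp_pattern n" pt .
  have "\<exists>r. (q, r) \<in> lamp_pattern n" if "q \<in> D" for q
    using lamp_pattern_neq[of q n] D[OF that] n that by blast
  then have "\<not> vbit (witness S a b n)" using rel_subgroup_step(2)[OF w] by blast
  then show False using vbit_twisted[of n] by (simp add: witness_def)
qed

text \<open>Normality is the case of inner automorphisms of full invariance; \<open>vbit\<close> is
  a homomorphism to Z/2 that does not vanish on the witness.\<close>

lemma invariant_coset_graph_rel:
  assumes ab: "a \<in> S" "b \<in> S" "a \<noteq> b" and S: "countable S" and n: "prime n" "n \<in> D"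
  shows "invariant_coset_graph S (rel_subgroup (free_group S) D) a"
proof -
  let ?F = "free_group S" and ?N = "rel_subgroup (free_group S) D"
  interpret F: group ?F by (rule group_free_group)
  have inv: "f ` ?N \<subseteq> ?N" if "f \<in> hom ?F ?F" for f
    by (rule rel_subgroup_hom[OF group_free_group that])
  have cl: "x \<in> carrier ?F" if "x \<in> ?N" for x using F.rel_subgroup_subset that by (auto simp: chars_ker_def)
  have "?N \<lhd> ?F"
  proof (rule F.normal_invI[OF F.subgroup_rel_subgroup])
    fix x h assume xh: "x \<in> carrier ?F" "h \<in> ?N"
    then have "conjugate ?F x h \<in> ?N" using inv F.conj_auto[OF xh(1)] by (auto simp: auto_def)
    then show "x \<otimes>\<^bsub>?F\<^esub> h \<otimes>\<^bsub>?F\<^esub> inv\<^bsub>?F\<^esub> x \<in> ?N" using cl[OF xh(2)] by (simp add: conjugate_def)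
  qed
  moreover have "\<exists>\<theta> n. (\<forall>n\<in>?N. \<forall>m\<in>?N. \<theta> (n \<otimes>\<^bsub>?F\<^esub> m) \<longleftrightarrow> \<theta> n \<noteq> \<theta> m) \<and> n \<in> ?N \<and> \<theta> n"
  proof -
    obtain pt where "machine S a b (lamp_pattern n) pt" using pattern_machine[OF ab n(1)] .
    then interpret machine S a b "lamp_pattern n" pt .
    have "vbit (witness S a b n)" using vbit_twisted[of n] by (simp add: witness_def)
    then show ?thesis
      using vbit_mult witness_in[OF ab n] by (intro exI[of _ vbit] exI[of _ "witness S a b n"]) blast
  qed
  ultimately show ?thesis
    by (intro invariant_coset_graph.intro coset_graph.intro invariant_coset_graph_axioms.intro S ab(1) inv
        F.rel_subgroup_subset)
qed

section \<open>Continuum many characteristic random subgroups\<close>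

theorem theorem1p2:
  fixes S :: "'a set"
  assumes "{..<2::nat} \<lesssim> S" and "S \<lesssim> (UNIV :: nat set)"
  shows "{\<mu>. continuous_CRS (free_group S) \<mu> \<and> Inn_weakly_mixing (free_group S) \<mu>}
           \<approx> (UNIV :: nat set set)"
proof (rule lepoll_antisym)
  let ?F = "free_group S"
  have S: "countable S" using assms(2) by (auto simp: lepoll_def countable_def)
  obtain f :: "nat \<Rightarrow> 'a" where f: "inj_on f {..<2}" "f ` {..<2} \<subseteq> S"
    using assms(1) by (auto simp: lepoll_def)
  define a b where "a = f 0" and "b = f 1"
  have ab: "a \<in> S" "b \<in> S" "a \<noteq> b"
    using f inj_onD[OF f(1), of 0 1] by (auto simp: a_def b_def image_subset_iff)
  show "{\<mu>. continuous_CRS ?F \<mu> \<and> Inn_weakly_mixing ?F \<mu>} \<lesssim> (UNIV :: nat set set)"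
    by (rule lepoll_trans[OF subset_imp_lepoll CRS_lepoll[OF countable_free_group[OF S]]])
      (auto simp: continuous_CRS_def)
  have "infinite ({p :: nat. prime p} - {..3})" using primes_infinite by simp
  then obtain p :: "nat \<Rightarrow> nat" where p: "inj p" "range p \<subseteq> {p. prime p} - {..3}"
    by (rule infinite_countable_subset[THEN exE]) blast
  have pp: "prime (p e)" "3 < p e" for e
    using range_subsetD[OF p(2), of e] by auto
  \<comment> \<open>The prime 3 belongs to every \<open>D E\<close>, which makes \<open>N E\<close>
    nontrivial even for empty \<open>E\<close>; the primes \<open>p e\<close> exceed 3, so
    \<open>E\<close> can be read off from \<open>D E\<close>.\<close>
  define D where "D E = insert 3 (p ` E)" for E
  have D: "prime q \<and> odd q" if "q \<in> D E" for q E
  proof (cases "q = 3")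
    case False
    then have "prime q" "3 < q" using that pp by (auto simp: D_def)
    then show ?thesis using primes_dvd_imp_eq[of 2 q] by auto
  qed simp
  define N where "N E = rel_subgroup ?F (D E)" for E
  define \<mu> where "\<mu> E = coset_graph.law S (N E)" for E
  have graph: "invariant_coset_graph S (N E) a" for E
    unfolding N_def by (rule invariant_coset_graph_rel[OF ab S, of 3]) (simp_all add: D_def)
  have CRS: "continuous_CRS ?F (\<mu> E) \<and> Inn_weakly_mixing ?F (\<mu> E)" for E
  proof -
    interpret invariant_coset_graph S "N E" a by (rule graph)
    show ?thesis unfolding \<mu>_def using continuous_law mixing.inner_weak_mixing by blast
  qed
  have mem: "x \<in> N E \<longleftrightarrow> emeasure (\<mu> E) (supergroups ?F {x}) \<noteq> 0" if "x \<in> carrier ?F" for x E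
  proof -
    interpret invariant_coset_graph S "N E" a by (rule graph)
    show ?thesis unfolding \<mu>_def using that by (rule mem_iff_law)
  qed
  \<comment> \<open>Equal measures give equal subgroups, and membership of the witness for
    \<open>p e\<close> transfers \<open>e\<close> from one index set to the other. Applied in both
    directions, this yields injectivity.\<close>
  have sub: "E \<subseteq> E'" if eq: "\<mu> E = \<mu> E'" for E E'
  proof
    fix e assume e: "e \<in> E"
    have pe: "prime (p e)" "p e \<noteq> 3" using pp[of e] by auto
    have "witness S a b (p e) \<in> N E"
      unfolding N_def by (rule witness_in[OF ab pe(1)]) (simp add: D_def e)
    moreover from this have "witness S a b (p e) \<in> carrier ?F"
      using group.rel_subgroup_subset[OF group_free_group] unfolding N_def chars_ker_def by blast
    ultimately have "witness S a b (p e) \<in> N E'" using mem eq by metis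
    then have "p e \<in> D E'" using witness_notin[OF ab pe(1), of "D E'"] D unfolding N_def by blast
    then show "e \<in> E'" using pe p(1) by (auto simp: D_def inj_eq)
  qed
  then have "inj \<mu>" by (intro injI equalityI) auto
  then show "(UNIV :: nat set set) \<lesssim> {\<mu>. continuous_CRS ?F \<mu> \<and> Inn_weakly_mixing ?F \<mu>}"
    using CRS unfolding lepoll_def by blast
qed

end
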